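(* Let $(M^n,g_t,H_t,\phi_t)$ be a solution to generalized Ricci flow (with $\phi_t$ a solution of the associated dilaton flow). Let $\tau=T-t>0$ for some fixed $T$, and suppose $u=(4\pi\tau)^{-\frac n2}e^{-f}$ is a solution of $\square^*_\phi u=0$. Suppose furthermore that $\psi$ is a solution of the conjugate dilaton flow associated to $u$. Then $$\square^*_\phi\Bigl[\bigl(W^{H,f+\phi}+\psi\bigr)u\Bigr]=-2\tau\,\Bigl|\mathrm{Rc}^{H,f+\phi}-\frac1{2\tau}g\Bigr|^2u .$$
   Context: Conventions: inner products and norms of tensors and forms are full tensor contractions, e.g. $|H|^2=H_{ijk}H^{ijk}$. $\mathrm{Rc}$ and $R$ are the Ricci tensor and scalar curvature of $g$; $\Delta=\mathrm{tr}_g\nabla^2$; $d^*_g$ is the codifferential, $(d^*_gH)_{jk}=-\nabla^iH_{ijk}$; $H^2(X,Y)=\langle i_XH,i_YH\rangle$; $\square=\frac{\partial}{\partial t}-\Delta$. Generalized Ricci flow: a one-parameter family of Riemannian metrics $g_t$ and closed three-forms $H_t=H_0+db_t$ with $\frac{\partial}{\partial t}g=-2\mathrm{Rc}+\frac12H^2$, $\frac{\partial}{\partial t}b=-d^*_gH$. Dilaton flow: smooth functions $\phi_t$ with $\square\phi=\frac16|H|^2$. A triple $(g_t,H_t,\phi_t)$ is called a solution of generalized Ricci flow if both hold. For a function $F$ and $\tau>0$: $$\mathrm{Rc}^{H,F}=\mathrm{Rc}-\tfrac14H^2+\nabla^2F-\tfrac12\bigl(d^*_gH+i_{\nabla F}H\bigr),\qquad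 R^{H,F}=R-\tfrac1{12}|H|^2+2\Delta F-|\nabla F|^2,$$ $$W^{H,F}=\tau R^{H,F}+F-n .$$ Weighted conjugate heat operator: $\square^*_\phi u=-\frac{\partial u}{\partial t}-\Delta u+2\langle\nabla\phi,\nabla u\rangle+R^{H,\phi}u$. Conjugate dilaton flow: given a solution $u$ of $\square^*_\phi u=0$, a function $\psi$ (on space-time) is a solution of the conjugate dilaton flow if $\square^*_\phi(\psi u)=-\frac16|H|^2u$. *)

theory Defs
  imports "HOL-Analysis.Analysis"
begin

section \<open>Smoothness\<close>

text \<open>
  Derivatives are taken within \<open>S\<close>. The notion is used for open \<open>S\<close> and for
  \<open>S = I \<times> V\<close> with \<open>I\<close> a nondegenerate interval (possibly containing end points) and \<open>V\<close> open;
  on such sets derivatives within \<open>S\<close> are unique, so the use of \<^const>\<open>frechet_derivative\<close> is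
  unambiguous.
\<close>

fun C_k_on :: "nat \<Rightarrow> 'a::real_normed_vector set \<Rightarrow> ('a \<Rightarrow> 'b::real_normed_vector) \<Rightarrow> bool" where
  "C_k_on 0 S F \<longleftrightarrow> continuous_on S F"
| "C_k_on (Suc k) S F \<longleftrightarrow> F differentiable_on S \<and>
     (\<forall>v. C_k_on k S (\<lambda>x. frechet_derivative F (at x within S) v))"

definition smooth_on :: "'a::real_normed_vector set \<Rightarrow> ('a \<Rightarrow> 'b::real_normed_vector) \<Rightarrow> bool" where
  "smooth_on S F \<longleftrightarrow> (\<forall>k. C_k_on k S F)"

definition nondegenerate_interval :: "real set \<Rightarrow> bool" where
  "nondegenerate_interval I \<longleftrightarrow> is_interval I \<and> (\<exists>a\<in>I. \<exists>b\<in>I. a < b)"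


section \<open>Manifolds and tensor fields\<close>

record ('m, 'n) chart =
  cdom :: "'m set"
  cmap :: "'m \<Rightarrow> real ^ 'n"

definition cimg :: "('m, 'n::finite) chart \<Rightarrow> (real ^ 'n) set" where
  "cimg c = cmap c ` cdom c"

definition cinv :: "('m, 'n::finite) chart \<Rightarrow> real ^ 'n \<Rightarrow> 'm" where
  "cinv c = inv_into (cdom c) (cmap c)"

definition is_chart :: "('m::topological_space, 'n::finite) chart \<Rightarrow> bool" where
  "is_chart c \<longleftrightarrow> open (cdom c) \<and> open (cimg c) \<and>
     homeomorphism (cdom c) (cimg c) (cmap c) (cinv c)"

definition transition :: "('m, 'n::finite) chart \<Rightarrow> ('m, 'n) chart \<Rightarrow> real ^ 'n \<Rightarrow> real ^ 'n" where
  "transition c d = cmap d \<circ> cinv c"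

text \<open>A smooth atlas on the (Hausdorff, second countable) space \<open>'m\<close>; the dimension is \<open>CARD('n)\<close>.\<close>

definition smooth_atlas ::
    "('m::{t2_space, second_countable_topology}, 'n::finite) chart set \<Rightarrow> bool" where
  "smooth_atlas A \<longleftrightarrow> (\<forall>c\<in>A. is_chart c) \<and> (\<Union>c\<in>A. cdom c) = UNIV \<and>
     (\<forall>c\<in>A. \<forall>d\<in>A. smooth_on (cmap c ` (cdom c \<inter> cdom d)) (transition c d))"

text \<open>\<open>jac c d x k i = \<partial>x\<^sub>d\<^sup>k / \<partial>x\<^sub>c\<^sup>i\<close>\<close>

definition pd :: "'n::finite \<Rightarrow> (real ^ 'n \<Rightarrow> real) \<Rightarrow> real ^ 'n \<Rightarrow> real" where
  "pd i F x = frechet_derivative F (at x) (axis i 1)"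

definition jac :: "('m, 'n::finite) chart \<Rightarrow> ('m, 'n) chart \<Rightarrow> real ^ 'n \<Rightarrow> 'n \<Rightarrow> 'n \<Rightarrow> real" where
  "jac c d x k i = pd i (\<lambda>y. transition c d y $ k) x"

text \<open>
  A covariant tensor field assigns to every chart its components, as functions of the coordinates
  in \<open>cimg c\<close>, subject to the transformation law under changes of charts.
\<close>

type_synonym 'n mat_field = "real ^ 'n \<Rightarrow> real ^ 'n ^ 'n"
type_synonym 'n cube_field = "real ^ 'n \<Rightarrow> real ^ 'n ^ 'n ^ 'n"
type_synonym ('m, 'n) tensor2 = "('m, 'n) chart \<Rightarrow> 'n mat_field"
type_synonym ('m, 'n) tensor3 = "('m, 'n) chart \<Rightarrow> 'n cube_field"

definition tensor2_field :: "('m, 'n::finite) chart set \<Rightarrow> ('m, 'n) tensor2 \<Rightarrow> bool" where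
  "tensor2_field A S \<longleftrightarrow> (\<forall>c\<in>A. \<forall>d\<in>A. \<forall>p\<in>cdom c \<inter> cdom d. \<forall>i j.
     S c (cmap c p) $ i $ j =
       (\<Sum>k\<in>UNIV. \<Sum>l\<in>UNIV. jac c d (cmap c p) k i * jac c d (cmap c p) l j *
          S d (cmap d p) $ k $ l))"

definition tensor3_field :: "('m, 'n::finite) chart set \<Rightarrow> ('m, 'n) tensor3 \<Rightarrow> bool" where
  "tensor3_field A S \<longleftrightarrow> (\<forall>c\<in>A. \<forall>d\<in>A. \<forall>p\<in>cdom c \<inter> cdom d. \<forall>i j m.
     S c (cmap c p) $ i $ j $ m =
       (\<Sum>k\<in>UNIV. \<Sum>l\<in>UNIV. \<Sum>q\<in>UNIV.
          jac c d (cmap c p) k i * jac c d (cmap c p) l j * jac c d (cmap c p) q m *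
          S d (cmap d p) $ k $ l $ q))"

definition coord :: "('m, 'n::finite) chart \<Rightarrow> ('m \<Rightarrow> real) \<Rightarrow> real ^ 'n \<Rightarrow> real" where
  "coord c F = (\<lambda>x. F (cinv c x))"

definition smooth_scalar_family ::
    "('m, 'n::finite) chart set \<Rightarrow> real set \<Rightarrow> (real \<Rightarrow> 'm \<Rightarrow> real) \<Rightarrow> bool" where
  "smooth_scalar_family A I F \<longleftrightarrow>
     (\<forall>c\<in>A. smooth_on (I \<times> cimg c) (\<lambda>(t, x). coord c (F t) x))"

definition metric_family ::
    "('m, 'n::finite) chart set \<Rightarrow> real set \<Rightarrow> (real \<Rightarrow> ('m, 'n) tensor2) \<Rightarrow> bool" where
  "metric_family A I g \<longleftrightarrow>
     (\<forall>c\<in>A. smooth_on (I \<times> cimg c) (\<lambda>(t, x). g t c x)) \<and>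
     (\<forall>t\<in>I. tensor2_field A (g t)) \<and>
     (\<forall>t\<in>I. \<forall>c\<in>A. \<forall>x\<in>cimg c. transpose (g t c x) = g t c x \<and>
        (\<forall>v. v \<noteq> 0 \<longrightarrow> v \<bullet> (g t c x *v v) > 0))"

definition two_form_family ::
    "('m, 'n::finite) chart set \<Rightarrow> real set \<Rightarrow> (real \<Rightarrow> ('m, 'n) tensor2) \<Rightarrow> bool" where
  "two_form_family A I b \<longleftrightarrow>
     (\<forall>c\<in>A. smooth_on (I \<times> cimg c) (\<lambda>(t, x). b t c x)) \<and>
     (\<forall>t\<in>I. tensor2_field A (b t)) \<and>
     (\<forall>t\<in>I. \<forall>c\<in>A. \<forall>x\<in>cimg c. \<forall>i j. b t c x $ i $ j = - b t c x $ j $ i)"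

definition three_form :: "('m, 'n::finite) chart set \<Rightarrow> ('m, 'n) tensor3 \<Rightarrow> bool" where
  "three_form A H \<longleftrightarrow>
     (\<forall>c\<in>A. smooth_on (cimg c) (H c)) \<and> tensor3_field A H \<and>
     (\<forall>c\<in>A. \<forall>x\<in>cimg c. \<forall>i j k.
        H c x $ i $ j $ k = - H c x $ j $ i $ k \<and> H c x $ i $ j $ k = - H c x $ i $ k $ j)"


section \<open>Exterior derivative in coordinates\<close>

definition ext_deriv2 :: "'n::finite mat_field \<Rightarrow> 'n cube_field" where
  "ext_deriv2 b x = (\<chi> i j k.
     pd i (\<lambda>y. b y $ j $ k) x + pd j (\<lambda>y. b y $ k $ i) x + pd k (\<lambda>y. b y $ i $ j) x)"

definition ext_deriv3 :: "'n::finite cube_field \<Rightarrow> real ^ 'n \<Rightarrow> real ^ 'n ^ 'n ^ 'n ^ 'n" where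
  "ext_deriv3 H x = (\<chi> i j k l.
     pd i (\<lambda>y. H y $ j $ k $ l) x - pd j (\<lambda>y. H y $ i $ k $ l) x
     + pd k (\<lambda>y. H y $ i $ j $ l) x - pd l (\<lambda>y. H y $ i $ j $ k) x)"

definition closed_three_form :: "('m, 'n::finite) chart set \<Rightarrow> ('m, 'n) tensor3 \<Rightarrow> bool" where
  "closed_three_form A H \<longleftrightarrow> three_form A H \<and> (\<forall>c\<in>A. \<forall>x\<in>cimg c. ext_deriv3 (H c) x = 0)"


section \<open>Riemannian geometry in coordinates\<close>

definition ginv :: "'n::finite mat_field \<Rightarrow> real ^ 'n \<Rightarrow> 'n \<Rightarrow> 'n \<Rightarrow> real" where
  "ginv g x i j = matrix_inv (g x) $ i $ j"

text \<open>\<open>christoffel g k i j = \<Gamma>\<^sup>k\<^sub>i\<^sub>j\<close>\<close>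

definition christoffel :: "'n::finite mat_field \<Rightarrow> 'n \<Rightarrow> 'n \<Rightarrow> 'n \<Rightarrow> real ^ 'n \<Rightarrow> real" where
  "christoffel g k i j x = (1/2) * (\<Sum>l\<in>UNIV. ginv g x k l *
     (pd i (\<lambda>y. g y $ j $ l) x + pd j (\<lambda>y. g y $ i $ l) x - pd l (\<lambda>y. g y $ i $ j) x))"

text \<open>\<open>riemann g i j k l\<close> is the component \<open>R\<^sub>i\<^sub>j\<^sub>k\<^sup>l\<close> in
  \<open>R(\<partial>\<^sub>i, \<partial>\<^sub>j)\<partial>\<^sub>k = \<nabla>\<^sub>i\<nabla>\<^sub>j\<partial>\<^sub>k - \<nabla>\<^sub>j\<nabla>\<^sub>i\<partial>\<^sub>k = \<Sum>\<^sub>l R\<^sub>i\<^sub>j\<^sub>k\<^sup>l \<partial>\<^sub>l\<close>.\<close>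

definition riemann :: "'n::finite mat_field \<Rightarrow> 'n \<Rightarrow> 'n \<Rightarrow> 'n \<Rightarrow> 'n \<Rightarrow> real ^ 'n \<Rightarrow> real" where
  "riemann g i j k l x =
     pd i (christoffel g l j k) x - pd j (christoffel g l i k) x
     + (\<Sum>m\<in>UNIV. christoffel g m j k x * christoffel g l i m x
                - christoffel g m i k x * christoffel g l j m x)"

definition ricci :: "'n::finite mat_field \<Rightarrow> 'n mat_field" where
  "ricci g x = (\<chi> j k. \<Sum>i\<in>UNIV. riemann g i j k i x)"

definition trace_g :: "'n::finite mat_field \<Rightarrow> 'n mat_field \<Rightarrow> real ^ 'n \<Rightarrow> real" where
  "trace_g g S x = (\<Sum>i\<in>UNIV. \<Sum>j\<in>UNIV. ginv g x i j * S x $ i $ j)"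

definition scal :: "'n::finite mat_field \<Rightarrow> real ^ 'n \<Rightarrow> real" where
  "scal g = trace_g g (ricci g)"

definition hess :: "'n::finite mat_field \<Rightarrow> (real ^ 'n \<Rightarrow> real) \<Rightarrow> 'n mat_field" where
  "hess g F x = (\<chi> i j. pd i (pd j F) x - (\<Sum>k\<in>UNIV. christoffel g k i j x * pd k F x))"

definition laplacian :: "'n::finite mat_field \<Rightarrow> (real ^ 'n \<Rightarrow> real) \<Rightarrow> real ^ 'n \<Rightarrow> real" where
  "laplacian g F = trace_g g (hess g F)"

definition grad :: "'n::finite mat_field \<Rightarrow> (real ^ 'n \<Rightarrow> real) \<Rightarrow> real ^ 'n \<Rightarrow> real ^ 'n" where
  "grad g F x = (\<chi> i. \<Sum>j\<in>UNIV. ginv g x i j * pd j F x)"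

definition inner_g :: "'n::finite mat_field \<Rightarrow> real ^ 'n \<Rightarrow> real ^ 'n \<Rightarrow> real ^ 'n \<Rightarrow> real" where
  "inner_g g x v w = (\<Sum>i\<in>UNIV. \<Sum>j\<in>UNIV. g x $ i $ j * v $ i * w $ j)"

text \<open>Squared norm of a covariant two-tensor, not assumed to be symmetric.\<close>

definition norm2_sq :: "'n::finite mat_field \<Rightarrow> 'n mat_field \<Rightarrow> real ^ 'n \<Rightarrow> real" where
  "norm2_sq g S x = (\<Sum>i\<in>UNIV. \<Sum>j\<in>UNIV. \<Sum>k\<in>UNIV. \<Sum>l\<in>UNIV.
     ginv g x i k * ginv g x j l * S x $ i $ j * S x $ k $ l)"

definition norm3_sq :: "'n::finite mat_field \<Rightarrow> 'n cube_field \<Rightarrow> real ^ 'n \<Rightarrow> real" where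
  "norm3_sq g H x = (\<Sum>i\<in>UNIV. \<Sum>j\<in>UNIV. \<Sum>k\<in>UNIV. \<Sum>l\<in>UNIV. \<Sum>m\<in>UNIV. \<Sum>q\<in>UNIV.
     ginv g x i l * ginv g x j m * ginv g x k q * H x $ i $ j $ k * H x $ l $ m $ q)"

text \<open>\<open>H\<^sup>2\<^sub>i\<^sub>j = g\<^sup>k\<^sup>l g\<^sup>m\<^sup>q H\<^sub>i\<^sub>k\<^sub>m H\<^sub>j\<^sub>l\<^sub>q\<close>\<close>

definition H_sq :: "'n::finite mat_field \<Rightarrow> 'n cube_field \<Rightarrow> 'n mat_field" where
  "H_sq g H x = (\<chi> i j. \<Sum>k\<in>UNIV. \<Sum>l\<in>UNIV. \<Sum>m\<in>UNIV. \<Sum>q\<in>UNIV.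
     ginv g x k l * ginv g x m q * H x $ i $ k $ m * H x $ j $ l $ q)"

text \<open>\<open>cov_deriv3 g H l i j k = \<nabla>\<^sub>l H\<^sub>i\<^sub>j\<^sub>k\<close>\<close>

definition cov_deriv3 ::
    "'n::finite mat_field \<Rightarrow> 'n cube_field \<Rightarrow> 'n \<Rightarrow> 'n \<Rightarrow> 'n \<Rightarrow> 'n \<Rightarrow> real ^ 'n \<Rightarrow> real" where
  "cov_deriv3 g H l i j k x = pd l (\<lambda>y. H y $ i $ j $ k) x
     - (\<Sum>m\<in>UNIV. christoffel g m l i x * H x $ m $ j $ k
                + christoffel g m l j x * H x $ i $ m $ k
                + christoffel g m l k x * H x $ i $ j $ m)"

definition codiff3 :: "'n::finite mat_field \<Rightarrow> 'n cube_field \<Rightarrow> 'n mat_field" where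
  "codiff3 g H x = (\<chi> j k. - (\<Sum>i\<in>UNIV. \<Sum>l\<in>UNIV. ginv g x i l * cov_deriv3 g H l i j k x))"

definition interior3 :: "real ^ 'n \<Rightarrow> real ^ 'n ^ 'n ^ 'n::finite \<Rightarrow> real ^ 'n ^ 'n" where
  "interior3 v H = (\<chi> j k. \<Sum>i\<in>UNIV. v $ i * H $ i $ j $ k)"


section \<open>Weighted curvatures and heat operators\<close>

definition Rc_HF :: "'n::finite mat_field \<Rightarrow> 'n cube_field \<Rightarrow> (real ^ 'n \<Rightarrow> real) \<Rightarrow> 'n mat_field" where
  "Rc_HF g H F x = ricci g x - (1/4) *\<^sub>R H_sq g H x + hess g F x
     - (1/2) *\<^sub>R (codiff3 g H x + interior3 (grad g F x) (H x))"

definition R_HF ::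
    "'n::finite mat_field \<Rightarrow> 'n cube_field \<Rightarrow> (real ^ 'n \<Rightarrow> real) \<Rightarrow> real ^ 'n \<Rightarrow> real" where
  "R_HF g H F x = scal g x - (1/12) * norm3_sq g H x + 2 * laplacian g F x
     - inner_g g x (grad g F x) (grad g F x)"

definition W_HF ::
    "real \<Rightarrow> 'n::finite mat_field \<Rightarrow> 'n cube_field \<Rightarrow> (real ^ 'n \<Rightarrow> real) \<Rightarrow> real ^ 'n \<Rightarrow> real" where
  "W_HF \<tau> g H F x = \<tau> * R_HF g H F x + F x - real CARD('n)"

text \<open>Time derivatives are taken within the time interval, so they are one-sided at an end point
  belonging to it.\<close>

definition heat_op ::
    "real set \<Rightarrow> (real \<Rightarrow> 'n::finite mat_field) \<Rightarrow> (real \<Rightarrow> real ^ 'n \<Rightarrow> real)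
      \<Rightarrow> real \<Rightarrow> real ^ 'n \<Rightarrow> real" where
  "heat_op I g u t x =
     vector_derivative (\<lambda>s. u s x) (at t within I) - laplacian (g t) (u t) x"

definition conj_heat_op ::
    "real set \<Rightarrow> (real \<Rightarrow> 'n::finite mat_field) \<Rightarrow> (real \<Rightarrow> 'n cube_field)
      \<Rightarrow> (real \<Rightarrow> real ^ 'n \<Rightarrow> real) \<Rightarrow> (real \<Rightarrow> real ^ 'n \<Rightarrow> real)
      \<Rightarrow> real \<Rightarrow> real ^ 'n \<Rightarrow> real" where
  "conj_heat_op I g H \<phi> u t x =
     - vector_derivative (\<lambda>s. u s x) (at t within I) - laplacian (g t) (u t) x
     + 2 * inner_g (g t) x (grad (g t) (\<phi> t) x) (grad (g t) (u t) x)
     + R_HF (g t) (H t) (\<phi> t) x * u t x"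


section \<open>The flows\<close>

text \<open>The metrics and three-forms of a generalized Ricci flow with dilaton flow \<open>\<phi>\<close>. The equations
  are equations between tensor fields on \<open>M\<close>, i.e. between their components in every chart.\<close>

definition generalized_Ricci_flow ::
    "('m, 'n::finite) chart set \<Rightarrow> real set \<Rightarrow> (real \<Rightarrow> ('m, 'n) tensor2)
      \<Rightarrow> (real \<Rightarrow> ('m, 'n) tensor3) \<Rightarrow> (real \<Rightarrow> 'm \<Rightarrow> real) \<Rightarrow> bool" where
  "generalized_Ricci_flow A I g H \<phi> \<longleftrightarrow>
     metric_family A I g \<and>
     (\<exists>H0 b. closed_three_form A H0 \<and> two_form_family A I b \<and>
        (\<forall>t\<in>I. \<forall>c\<in>A. \<forall>x\<in>cimg c.
           H t c x = H0 c x + ext_deriv2 (b t c) x \<and>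
           ((\<lambda>s. g s c x) has_vector_derivative
              (-2) *\<^sub>R ricci (g t c) x + (1/2) *\<^sub>R H_sq (g t c) (H t c) x) (at t within I) \<and>
           ((\<lambda>s. b s c x) has_vector_derivative - codiff3 (g t c) (H t c) x) (at t within I))) \<and>
     smooth_scalar_family A I \<phi> \<and>
     (\<forall>t\<in>I. \<forall>c\<in>A. \<forall>x\<in>cimg c.
        heat_op I (\<lambda>s. g s c) (\<lambda>s. coord c (\<phi> s)) t x = (1/6) * norm3_sq (g t c) (H t c) x)"

definition conj_heat_solution ::
    "('m, 'n::finite) chart set \<Rightarrow> real set \<Rightarrow> (real \<Rightarrow> ('m, 'n) tensor2)
      \<Rightarrow> (real \<Rightarrow> ('m, 'n) tensor3) \<Rightarrow> (real \<Rightarrow> 'm \<Rightarrow> real) \<Rightarrow> (real \<Rightarrow> 'm \<Rightarrow> real) \<Rightarrow> bool" where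
  "conj_heat_solution A I g H \<phi> u \<longleftrightarrow>
     smooth_scalar_family A I u \<and>
     (\<forall>t\<in>I. \<forall>c\<in>A. \<forall>x\<in>cimg c.
        conj_heat_op I (\<lambda>s. g s c) (\<lambda>s. H s c) (\<lambda>s. coord c (\<phi> s)) (\<lambda>s. coord c (u s)) t x = 0)"

definition conj_dilaton_flow ::
    "('m, 'n::finite) chart set \<Rightarrow> real set \<Rightarrow> (real \<Rightarrow> ('m, 'n) tensor2)
      \<Rightarrow> (real \<Rightarrow> ('m, 'n) tensor3) \<Rightarrow> (real \<Rightarrow> 'm \<Rightarrow> real) \<Rightarrow> (real \<Rightarrow> 'm \<Rightarrow> real)
      \<Rightarrow> (real \<Rightarrow> 'm \<Rightarrow> real) \<Rightarrow> bool" where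
  "conj_dilaton_flow A I g H \<phi> u \<psi> \<longleftrightarrow>
     smooth_scalar_family A I \<psi> \<and>
     (\<forall>t\<in>I. \<forall>c\<in>A. \<forall>x\<in>cimg c.
        conj_heat_op I (\<lambda>s. g s c) (\<lambda>s. H s c) (\<lambda>s. coord c (\<phi> s))
          (\<lambda>s. coord c (\<lambda>p. \<psi> s p * u s p)) t x
        = - (1/6) * norm3_sq (g t c) (H t c) x * coord c (u t) x)"

end

theory Submission
  imports Defs
begin

text \<open>
  Put \<open>F = f + \<phi>\<close>, let \<open>S = R\<^sup>H\<^sup>,\<^sup>F\<close>, let \<open>P\<close> and \<open>Q\<close> be the symmetric and the antisymmetric part of
  \<open>Rc\<^sup>H\<^sup>,\<^sup>F\<close>, and let \<open>\<Delta>\<^sub>F = \<Delta> - \<nabla>F \<cdot> \<nabla>\<close> and \<open>div\<^sub>F\<close> be the operators weighted by \<open>e\<^sup>-\<^sup>F\<close>. Since \<open>u\<close> solves the conjugate heat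
  equation, \<open>\<box>\<^sup>*\<^sub>\<phi>(h u) = u (- \<partial>\<^sub>t h - \<Delta> h + 2 \<langle>\<nabla>h, \<nabla>F\<rangle>)\<close> for every \<open>h\<close>, and \<open>F\<close> evolves by
  \<open>\<partial>\<^sub>t F = n/2\<tau> - \<Delta>F + |\<nabla>F|\<^sup>2 - R + |H|\<^sup>2/4\<close>. The theorem reduces to
  \<open>\<partial>\<^sub>t S = - \<Delta>S + 2 \<langle>\<nabla>S, \<nabla>F\<rangle> + 2 |P|\<^sup>2 + 2 |Q|\<^sup>2\<close>. This follows from the first variation of \<open>S\<close>,
  \<open>\<delta>S = div\<^sub>F div\<^sub>F h - \<langle>h, P\<rangle> - \<langle>H, \<delta>H\<rangle>/6 + \<Delta>\<^sub>F(2 \<delta>F - tr h)\<close> with \<open>h = \<delta>g\<close>,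
  the weighted Bianchi identity \<open>div\<^sub>F P = \<nabla>S/2 - \<langle>Q, i H\<rangle>/2\<close> and the Bochner formula for \<open>div\<^sub>F \<nabla>\<^sup>2F\<close>.

  At a fixed point of space-time a smooth function is replaced by its jet. Jets form a commutative ring on
  which all partial derivatives are total commuting derivations, so the tensor calculus becomes algebra.
  Contravariant components keep it short: for a totally antisymmetric \<open>H\<^sup>i\<^sup>a\<^sup>b\<close> the divergence involves only the
  traced Christoffel symbols \<open>\<gamma>\<^sub>i = \<Gamma>\<^sup>k\<^sub>k\<^sub>i\<close>.
\<close>

section \<open>Differential rings and matrices\<close>

text \<open>Smooth functions on a given set do not form a type, and derivatives elsewhere are
  arbitrary; in the ring of jets the rules of differentiation hold without side conditions. The
  price is that this ring has no division. The inverse metric \<open>K\<close> and the reciprocal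
  \<open>w\<close> of \<open>u\<close> are therefore carried along as elements tied down by
  \<open>K ** G = mat 1\<close> and \<open>u * w = 1\<close>, and denominators are cleared
  throughout.

  The evolution of S closes up because of two cancellations. Along the flow h = -2 (P - Hess F), so
  Bianchi and Bochner turn div_F h into gradients plus the terms P(grad F) and H paired with its
  codifferential. The fourth-order term \<Delta>_F \<Delta>_F F contained in div_F div_F h is then
  removed by the variation of the weighted volume, in which scalar curvature and |H|^2 drop out. The
  square in the theorem is finally completed by the trace of P, and \<psi> supplies exactly the
  multiple of |H|^2 that is missing from this trace.\<close>

lemma eq_neg_self_iff: "x = - x \<longleftrightarrow> x = (0::'a::real_vector)"
  by (metis scaleR_half_double add.right_inverse scaleR_zero_right neg_0_equal_iff_equal)

lemma sum_antisym_sym: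
  fixes A B :: "'n::finite \<Rightarrow> 'n \<Rightarrow> 'r::{comm_ring_1,real_algebra_1}"
  assumes "\<And>i j. A i j = - A j i" "\<And>i j. B i j = B j i"
  shows "(\<Sum>i\<in>UNIV. \<Sum>j\<in>UNIV. A i j * B i j) = 0"
proof -
  have "(\<Sum>i\<in>UNIV. \<Sum>j\<in>UNIV. A i j * B i j) = (\<Sum>i\<in>UNIV. \<Sum>j\<in>UNIV. A j i * B j i)"
    by (rule sum.swap)
  also have "\<dots> = (\<Sum>i\<in>UNIV. \<Sum>j\<in>UNIV. - (A i j * B i j))"
    by (intro sum.cong refl) (metis assms minus_mult_left)
  finally have "(\<Sum>i\<in>UNIV. \<Sum>j\<in>UNIV. A i j * B i j) = - (\<Sum>i\<in>UNIV. \<Sum>j\<in>UNIV. A i j * B i j)"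
    by (simp add: sum_negf)
  then show ?thesis
    by (simp only: eq_neg_self_iff)
qed

text \<open>Additivity and the Leibniz rule make integers constant, which suffices once denominators
  are cleared. The algebra structure over the reals serves to cancel integer factors.\<close>

locale differential_ring =
  fixes D :: "'d \<Rightarrow> 'r::{comm_ring_1,real_algebra_1} \<Rightarrow> 'r"
  assumes D_add [simp]: "D d (a + b) = D d a + D d b"
    and D_mult [simp]: "D d (a * b) = D d a * b + a * D d b"
    and D_commute: "D d (D e a) = D e (D d a)"
begin

lemma D_zero [simp]: "D d 0 = 0"
  using D_add[of d 0 0] by simp

lemma D_one [simp]: "D d 1 = 0"
  using D_mult[of d 1 1] by simp

lemma D_uminus [simp]: "D d (- a) = - D d a"
  using D_add[of d a "- a"] by (simp add: eq_neg_iff_add_eq_0 add.commute)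

lemma D_diff [simp]: "D d (a - b) = D d a - D d b"
  using D_add[of d a "- b"] by simp

lemma D_sum [simp]: "D d (sum f A) = (\<Sum>i\<in>A. D d (f i))"
  by (induction A rule: infinite_finite_induct) auto

lemma D_of_nat [simp]: "D d (of_nat n) = 0"
  by (induction n) auto

lemma D_numeral [simp]: "D d (numeral n) = 0"
  using D_of_nat[of d "numeral n"] by simp

definition Dmat :: "'d \<Rightarrow> 'r ^ 'm ^ 'n \<Rightarrow> 'r ^ 'm ^ 'n" where
  "Dmat d A = (\<chi> i j. D d (A $ i $ j))"

lemma Dmat_nth [simp]: "Dmat d A $ i $ j = D d (A $ i $ j)"
  by (simp add: Dmat_def)

lemma Dmat_add: "Dmat d (A + B) = Dmat d A + Dmat d B"
  and Dmat_diff: "Dmat d (A - B) = Dmat d A - Dmat d B"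
  and Dmat_uminus: "Dmat d (- A) = - Dmat d A"
  and Dmat_transpose: "Dmat d (transpose A) = transpose (Dmat d A)"
  and Dmat_commute: "Dmat d (Dmat e A) = Dmat e (Dmat d A)"
  by (simp_all add: vec_eq_iff transpose_def D_commute)

lemma Dmat_mult: "Dmat d (A ** B) = Dmat d A ** B + A ** Dmat d B"
  by (simp add: vec_eq_iff matrix_matrix_mult_def sum.distrib)

lemma Dmat_mat_1 [simp]: "Dmat d (mat 1) = 0"
  by (simp add: vec_eq_iff mat_def if_distrib[of "D d"] cong: if_cong)

end

lemma matrix_minus_left: "(- A) ** B = - (A ** B)" for A :: "'r::comm_ring_1 ^ 'n ^ 'm"
  by (simp add: vec_eq_iff matrix_matrix_mult_def sum_negf)

lemma matrix_minus_right: "A ** (- B) = - (A ** B)" for A :: "'r::comm_ring_1 ^ 'n ^ 'm"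
  by (simp add: vec_eq_iff matrix_matrix_mult_def sum_negf)

lemma matrix_add_rdist: "(A + B) ** C = A ** C + B ** C" for A :: "'r::comm_ring_1 ^ 'n ^ 'm"
  by (simp add: vec_eq_iff matrix_matrix_mult_def sum.distrib algebra_simps)

lemma matrix_diff_left: "(A - B) ** C = A ** C - B ** C" for A :: "'r::comm_ring_1 ^ 'n ^ 'm"
  by (simp add: vec_eq_iff matrix_matrix_mult_def sum_subtractf algebra_simps)

lemma matrix_diff_right: "A ** (B - C) = A ** B - A ** C" for A :: "'r::comm_ring_1 ^ 'n ^ 'm"
  by (simp add: vec_eq_iff matrix_matrix_mult_def sum_subtractf algebra_simps)

lemma transpose_arith:
  fixes A B :: "'r::comm_ring_1 ^ 'n ^ 'm"
  shows "transpose (A + B) = transpose A + transpose B" "transpose (A - B) = transpose A - transpose B"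
    "transpose (- A) = - transpose A"
  by (simp_all add: vec_eq_iff transpose_def)

lemmas matrix_ring_simps = matrix_minus_left matrix_minus_right matrix_add_rdist matrix_add_ldistrib
  matrix_diff_left matrix_diff_right transpose_arith matrix_transpose_mul matrix_mul_assoc

section \<open>Riemannian geometry over a differential ring\<close>

text \<open>\<open>D (Some i)\<close> are the coordinate derivatives and \<open>D None\<close> is the time derivative;
  \<open>\<Gamma> k i j = \<Gamma>\<^sup>k\<^sub>i\<^sub>j\<close>.\<close>

locale metric_ring = differential_ring D
  for D :: "'n::finite option \<Rightarrow> 'r::{comm_ring_1,real_algebra_1} \<Rightarrow> 'r" +
  fixes G K :: "'r ^ 'n ^ 'n" and \<Gamma> :: "'n \<Rightarrow> 'n \<Rightarrow> 'n \<Rightarrow> 'r"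
  assumes G_sym: "transpose G = G" and KG: "K ** G = mat 1" and GK: "G ** K = mat 1"
    and \<Gamma>_eq: "2 * \<Gamma> k i j = (\<Sum>l\<in>UNIV. K $ k $ l *
          (D (Some i) (G $ j $ l) + D (Some j) (G $ i $ l) - D (Some l) (G $ i $ j)))"
begin

abbreviation pdr ("\<partial>") where "\<partial> i \<equiv> D (Some i)"
abbreviation dtr ("\<delta>") where "\<delta> \<equiv> D None"

lemma two_cancel: "2 * a = 2 * b \<Longrightarrow> a = (b::'r)"
  by (metis mult_2 scaleR_half_double)

lemma G_comm: "G $ i $ j = G $ j $ i"
  using G_sym by (simp add: vec_eq_iff transpose_def)

lemma K_sym: "transpose K = K"
proof -
  have "G ** transpose K = mat 1"
    by (metis G_sym KG matrix_transpose_mul transpose_mat)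
  then have "K ** (G ** transpose K) = K" by simp
  then show ?thesis by (simp add: matrix_mul_assoc KG)
qed

lemma K_comm: "K $ i $ j = K $ j $ i"
  using K_sym by (simp add: vec_eq_iff transpose_def)

lemma KG_comp: "(\<Sum>j\<in>UNIV. K $ i $ j * G $ j $ k) = (if i = k then 1 else 0)"
  and GK_comp: "(\<Sum>j\<in>UNIV. G $ i $ j * K $ j $ k) = (if i = k then 1 else 0)"
  using KG GK by (simp_all add: vec_eq_iff matrix_matrix_mult_def mat_def)

lemma \<Gamma>_sym: "\<Gamma> k i j = \<Gamma> k j i"
  by (rule two_cancel) (simp add: \<Gamma>_eq G_comm add.commute)

definition \<Gamma>m :: "'n \<Rightarrow> 'r ^ 'n ^ 'n" where "\<Gamma>m k = (\<chi> i j. \<Gamma> i k j)"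

lemma \<Gamma>m_nth [simp]: "\<Gamma>m k $ i $ j = \<Gamma> i k j"
  by (simp add: \<Gamma>m_def)

lemma \<Gamma>_lower:
  "2 * (\<Sum>k\<in>UNIV. G $ l $ k * \<Gamma> k i j) = \<partial> i (G $ j $ l) + \<partial> j (G $ i $ l) - \<partial> l (G $ i $ j)"
    (is "?L = ?R l")
proof -
  have "?L = (\<Sum>k\<in>UNIV. G $ l $ k * (2 * \<Gamma> k i j))"
    by (simp add: sum_distrib_left mult.left_commute)
  also have "\<dots> = (\<Sum>k\<in>UNIV. \<Sum>m\<in>UNIV. G $ l $ k * K $ k $ m * ?R m)"
    by (simp add: \<Gamma>_eq sum_distrib_left mult.assoc)
  also have "\<dots> = (\<Sum>m\<in>UNIV. (\<Sum>k\<in>UNIV. G $ l $ k * K $ k $ m) * ?R m)"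
    by (subst sum.swap) (simp add: sum_distrib_right)
  also have "\<dots> = ?R l"
    by (simp add: GK_comp if_distrib[of "\<lambda>x. x * _"] cong: if_cong)
  finally show ?thesis .
qed

text \<open>Metric compatibility of the Levi-Civita connection as a matrix identity: in the sum of
  two instances of \<open>\<Gamma>_lower\<close> the derivatives in the directions i and j
  cancel.\<close>

lemma Dmat_G: "Dmat (Some k) G = G ** \<Gamma>m k + transpose (\<Gamma>m k) ** G"
proof -
  have "\<partial> k (G $ i $ j) = (\<Sum>m\<in>UNIV. G $ i $ m * \<Gamma> m k j) + (\<Sum>m\<in>UNIV. G $ j $ m * \<Gamma> m k i)" for i j
    by (rule two_cancel) (simp only: distrib_left \<Gamma>_lower, simp add: G_comm algebra_simps)
  then show ?thesis
    by (simp add: vec_eq_iff matrix_matrix_mult_def transpose_def G_comm mult.commute)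
qed

lemma Dmat_inverse: "Dmat d K = - (K ** Dmat d G ** K)"
proof -
  have "Dmat d K ** G = - (K ** Dmat d G)"
    using Dmat_mult[of d K G] by (simp add: KG eq_neg_iff_add_eq_0)
  then have "(Dmat d K ** G) ** K = - (K ** Dmat d G ** K)"
    by (simp add: matrix_minus_left)
  moreover have "(Dmat d K ** G) ** K = Dmat d K"
    by (simp add: matrix_mul_assoc[symmetric] GK)
  ultimately show ?thesis by simp
qed

lemma Dmat_K: "Dmat (Some k) K = - (\<Gamma>m k ** K + K ** transpose (\<Gamma>m k))"
proof -
  have "K ** (G ** \<Gamma>m k + transpose (\<Gamma>m k) ** G) ** K = (K ** G) ** \<Gamma>m k ** K + K ** transpose (\<Gamma>m k) ** (G ** K)"
    by (simp only: matrix_ring_simps)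
  then show ?thesis
    by (simp add: Dmat_inverse Dmat_G GK KG)
qed

lemma D_K: "\<partial> k (K $ i $ j) = - (\<Sum>m\<in>UNIV. \<Gamma> i k m * K $ m $ j) - (\<Sum>m\<in>UNIV. \<Gamma> j k m * K $ i $ m)"
  using Dmat_K[of k] by (simp add: vec_eq_iff matrix_matrix_mult_def transpose_def mult.commute)

section \<open>Curvature and its Bianchi identity\<close>

definition Rm :: "'n \<Rightarrow> 'n \<Rightarrow> 'r ^ 'n ^ 'n" where
  "Rm i j = Dmat (Some i) (\<Gamma>m j) - Dmat (Some j) (\<Gamma>m i) + \<Gamma>m i ** \<Gamma>m j - \<Gamma>m j ** \<Gamma>m i"

lemma Rm_antisym: "Rm i j = - Rm j i"
  by (simp add: Rm_def)

text \<open>The Jacobi identity for the operators \<open>\<partial> i + \<Gamma>m i\<close>, whose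
  commutators are the matrices \<open>Rm i j\<close>. It is the second Bianchi identity: the
  Christoffel corrections for the two form indices would cancel in the cyclic sum because \<Gamma>
  is symmetric.\<close>

lemma Rm_Bianchi:
  "(Dmat (Some i) (Rm j k) + \<Gamma>m i ** Rm j k - Rm j k ** \<Gamma>m i)
   + (Dmat (Some j) (Rm k i) + \<Gamma>m j ** Rm k i - Rm k i ** \<Gamma>m j)
   + (Dmat (Some k) (Rm i j) + \<Gamma>m k ** Rm i j - Rm i j ** \<Gamma>m k) = 0"
  by (simp add: Rm_def Dmat_add Dmat_diff Dmat_mult matrix_ring_simps
      Dmat_commute[of "Some j" "Some i"] Dmat_commute[of "Some k" "Some i"] Dmat_commute[of "Some k" "Some j"])

definition Ru :: "'n \<Rightarrow> 'n \<Rightarrow> 'r ^ 'n ^ 'n" where "Ru i j = Rm i j ** K"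

text \<open>The second derivatives of \<open>K\<close> commute while \<open>K\<close> is parallel,
  so the curvature annihilates \<open>K\<close>; this is antisymmetry in the last two
  indices.\<close>

lemma Ru_transpose: "transpose (Ru i j) = - Ru i j"
proof -
  have "Dmat (Some i) (Dmat (Some j) K) - Dmat (Some j) (Dmat (Some i) K) = 0"
    by (simp add: Dmat_commute)
  then have "Rm i j ** K + K ** transpose (Rm i j) = 0"
    by (simp add: Rm_def Dmat_K Dmat_uminus Dmat_add Dmat_diff Dmat_mult Dmat_transpose matrix_ring_simps algebra_simps)
  then show ?thesis
    by (simp add: Ru_def matrix_transpose_mul K_sym eq_neg_iff_add_eq_0 add.commute)
qed

text \<open>\<open>Rm_Bianchi\<close> multiplied by \<open>K\<close>: since \<open>K\<close> is
  parallel, raising an index turns right multiplication by \<open>- \<Gamma>m i\<close> into right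
  multiplication by \<open>transpose (\<Gamma>m i)\<close>.\<close>

lemma Ru_Bianchi:
  "(Dmat (Some i) (Ru j k) + \<Gamma>m i ** Ru j k + Ru j k ** transpose (\<Gamma>m i))
   + (Dmat (Some j) (Ru k i) + \<Gamma>m j ** Ru k i + Ru k i ** transpose (\<Gamma>m j))
   + (Dmat (Some k) (Ru i j) + \<Gamma>m k ** Ru i j + Ru i j ** transpose (\<Gamma>m k)) = 0"
proof -
  have *: "Dmat (Some i) (Ru j k) + \<Gamma>m i ** Ru j k + Ru j k ** transpose (\<Gamma>m i)
    = (Dmat (Some i) (Rm j k) + \<Gamma>m i ** Rm j k - Rm j k ** \<Gamma>m i) ** K" for i j k
    by (simp add: Ru_def Dmat_mult Dmat_K matrix_ring_simps)
  show ?thesis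
    unfolding * matrix_add_rdist[symmetric] Rm_Bianchi by (simp add: vec_eq_iff matrix_matrix_mult_def)
qed

end

section \<open>Reordering of triple sums\<close>

abbreviation sum_all (binder "\<Sum>\<^sub>u" 10) where "sum_all f \<equiv> sum f UNIV"

lemma sum3_213: "(\<Sum>\<^sub>u i j k. f i j k) = (\<Sum>\<^sub>u j i k. f i j k)"
  for f :: "'n::finite \<Rightarrow> 'n \<Rightarrow> 'n \<Rightarrow> 'r::comm_monoid_add"
  by (rule sum.swap)

lemma sum3_132: "(\<Sum>\<^sub>u i j k. f i j k) = (\<Sum>\<^sub>u i k j. f i j k)"
  for f :: "'n::finite \<Rightarrow> 'n \<Rightarrow> 'n \<Rightarrow> 'r::comm_monoid_add"
  by (intro sum.cong refl sum.swap)

lemma sum3_231: "(\<Sum>\<^sub>u i j k. f i j k) = (\<Sum>\<^sub>u j k i. f i j k)"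
  for f :: "'n::finite \<Rightarrow> 'n \<Rightarrow> 'n \<Rightarrow> 'r::comm_monoid_add"
  by (subst sum3_213) (rule sum3_132)

lemma sum3_312: "(\<Sum>\<^sub>u i j k. f i j k) = (\<Sum>\<^sub>u k i j. f i j k)"
  for f :: "'n::finite \<Rightarrow> 'n \<Rightarrow> 'n \<Rightarrow> 'r::comm_monoid_add"
  by (subst sum3_132) (rule sum3_213)

lemma sum3_321: "(\<Sum>\<^sub>u i j k. f i j k) = (\<Sum>\<^sub>u k j i. f i j k)"
  for f :: "'n::finite \<Rightarrow> 'n \<Rightarrow> 'n \<Rightarrow> 'r::comm_monoid_add"
  by (subst sum3_132) (rule sum3_231)

context metric_ring begin

section \<open>Ricci curvature, divergences and the contracted Bianchi identity\<close>

definition "\<gamma> i = (\<Sum>\<^sub>u k. \<Gamma> k k i)"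

definition "Ric j k = (\<Sum>\<^sub>u i. Rm i j $ i $ k)"

text \<open>The mixed Ricci tensor. The order of the arguments of \<open>Ric\<close> matters here,
  since its symmetry only becomes available with the flow equation, in
  \<open>Ric_sym\<close>.\<close>

definition "Rcm i k = (\<Sum>\<^sub>u m. Ric k m * K $ m $ i)"

lemma Ric_eq: "Ric j k = (\<Sum>\<^sub>u i. \<partial> i (\<Gamma> i j k)) - \<partial> j (\<gamma> k)
    + (\<Sum>\<^sub>u l. \<gamma> l * \<Gamma> l j k) - (\<Sum>\<^sub>u i l. \<Gamma> i j l * \<Gamma> l i k)"
proof -
  have "(\<Sum>\<^sub>u i l. \<Gamma> i i l * \<Gamma> l j k) = (\<Sum>\<^sub>u l. \<gamma> l * \<Gamma> l j k)"
    unfolding \<gamma>_def sum_distrib_right by (rule sum.swap)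
  then show ?thesis
    by (simp add: Ric_def Rm_def sum.distrib sum_subtractf matrix_matrix_mult_def \<gamma>_def)
qed

text \<open>Unweighted divergences of a vector field \<open>V\<^sup>i\<close>, of a mixed tensor \<open>h\<^sup>j\<^sub>k\<close> and of a symmetric tensor \<open>h\<^sup>j\<^sup>i\<close>.\<close>

definition "div0 V = (\<Sum>\<^sub>u i. \<partial> i (V i) + \<gamma> i * V i)"

lemma div0_add: "div0 (\<lambda>i. V i + W i) = div0 V + div0 W"
  and div0_diff: "div0 (\<lambda>i. V i - W i) = div0 V - div0 W"
  and div0_minus: "div0 (\<lambda>i. - V i) = - div0 V"
  by (simp_all add: div0_def sum.distrib sum_subtractf sum_negf algebra_simps)

definition "divm h k = (\<Sum>\<^sub>u j. \<partial> j (h j k) + \<gamma> j * h j k) - (\<Sum>\<^sub>u j m. \<Gamma> m j k * h j m)"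

definition "divu h i = (\<Sum>\<^sub>u j. \<partial> j (h j i) + \<gamma> j * h j i) + (\<Sum>\<^sub>u j k. \<Gamma> i j k * h j k)"

lemma divm_add: "divm (\<lambda>i k. g i k + h i k) k = divm g k + divm h k"
  and divm_diff: "divm (\<lambda>i k. g i k - h i k) k = divm g k - divm h k"
  and divm_scale: "divm (\<lambda>i k. numeral n * h i k) k = numeral n * divm h k"
  by (simp_all add: divm_def sum.distrib sum_subtractf sum_distrib_left algebra_simps)

text \<open>\<open>K\<close> is parallel, so raising the free index commutes with the divergence: of
  the two terms of \<open>D_K\<close> one cancels the Christoffel correction in \<open>divu\<close>
  and the other becomes the one in \<open>divm\<close>.\<close>

lemma divu_raise: "divu (\<lambda>j i. \<Sum>\<^sub>u k. h j k * K $ k $ i) i = (\<Sum>\<^sub>u k. K $ k $ i * divm h k)"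
proof -
  have 1: "(\<Sum>\<^sub>u j k m. h j k * (\<Gamma> i j m * K $ k $ m)) = (\<Sum>\<^sub>u j k m. \<Gamma> i j k * (h j m * K $ m $ k))"
    by (rule trans[OF sum3_132]) (simp add: ac_simps)
  have 2: "(\<Sum>\<^sub>u j k m. h j k * (\<Gamma> k j m * K $ m $ i)) = (\<Sum>\<^sub>u k j m. K $ k $ i * (\<Gamma> m j k * h j m))"
    by (rule trans[OF sum3_312]) (simp add: ac_simps)
  have 3: "(\<Sum>\<^sub>u j k. \<partial> j (h j k) * K $ k $ i) = (\<Sum>\<^sub>u k j. K $ k $ i * \<partial> j (h j k))"
    by (rule trans[OF sum.swap]) (simp add: ac_simps)
  have 4: "(\<Sum>\<^sub>u j k. \<gamma> j * (h j k * K $ k $ i)) = (\<Sum>\<^sub>u k j. K $ k $ i * (\<gamma> j * h j k))"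
    by (rule trans[OF sum.swap]) (simp add: ac_simps)
  show ?thesis
    unfolding divu_def divm_def
    by (simp add: D_K sum.distrib sum_subtractf sum_negf sum_distrib_left distrib_left right_diff_distrib 1 2 3 4)
qed

lemma Ru_antisym: "Ru i j $ l $ q = - Ru i j $ q $ l"
proof -
  have "transpose (Ru i j) $ q $ l = (- Ru i j) $ q $ l"
    by (simp only: Ru_transpose)
  then show ?thesis by (simp add: transpose_def)
qed

lemma Ru_antisym': "Ru i j $ l $ q = - Ru j i $ l $ q"
  unfolding Ru_def by (subst Rm_antisym) (simp add: matrix_minus_left)

lemma Rcm_Ru: "Rcm i k = - (\<Sum>\<^sub>u j. Ru j k $ i $ j)"
proof -
  have "(\<Sum>\<^sub>u j. Ru j k $ i $ j) = (\<Sum>\<^sub>u j. - Ru j k $ j $ i)"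
    by (intro sum.cong refl) (rule Ru_antisym)
  also have "\<dots> = - (\<Sum>\<^sub>u j m. Rm j k $ j $ m * K $ m $ i)"
    by (simp add: Ru_def matrix_matrix_mult_def sum_negf)
  also have "(\<Sum>\<^sub>u j m. Rm j k $ j $ m * K $ m $ i) = Rcm i k"
    by (subst sum.swap) (simp add: Rcm_def Ric_def sum_distrib_right)
  finally show ?thesis by simp
qed

definition "scalar = (\<Sum>\<^sub>u i. Rcm i i)"

text \<open>Contracting the full Bianchi identity for the curvature with its last index raised avoids every
  commutation of covariant derivatives.\<close>

lemma contracted_Bianchi: "2 * divm Rcm k = \<partial> k scalar"
proof -
  \<comment> \<open>By antisymmetry in both index pairs, every contraction of a lower with an upper
    index of \<open>Ru\<close> is \<open>r\<close> up to sign, and \<open>r\<close> is minus the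
    mixed Ricci tensor.\<close>
  define r where "r k i = (\<Sum>\<^sub>u j. Ru j k $ i $ j)" for k i
  have r2: "(\<Sum>\<^sub>u i. Ru k i $ i $ j) = r k j" for k j
    unfolding r_def by (intro sum.cong refl) (metis Ru_antisym Ru_antisym' minus_minus)
  have r3: "(\<Sum>\<^sub>u j. Ru i j $ m $ j) = - r i m" for i m
    unfolding r_def sum_negf[symmetric] by (intro sum.cong refl) (rule Ru_antisym')
  have r4: "(\<Sum>\<^sub>u i. Ru i j $ i $ m) = - r j m" for j m
    unfolding r_def sum_negf[symmetric] by (intro sum.cong refl) (rule Ru_antisym)
  \<comment> \<open>The entry of \<open>Ru_Bianchi\<close> in row i and column j; summing over i and
    j then takes the double trace.\<close>
  have B: "(\<partial> i (Ru j k $ i $ j) + (\<Sum>\<^sub>u m. \<Gamma> i i m * Ru j k $ m $ j) + (\<Sum>\<^sub>u m. Ru j k $ i $ m * \<Gamma> j i m))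
     + (\<partial> j (Ru k i $ i $ j) + (\<Sum>\<^sub>u m. \<Gamma> i j m * Ru k i $ m $ j) + (\<Sum>\<^sub>u m. Ru k i $ i $ m * \<Gamma> j j m))
     + (\<partial> k (Ru i j $ i $ j) + (\<Sum>\<^sub>u m. \<Gamma> i k m * Ru i j $ m $ j) + (\<Sum>\<^sub>u m. Ru i j $ i $ m * \<Gamma> j k m)) = 0" (is "?E i j = 0") for i j
    using Ru_Bianchi[of i j k] by (simp add: vec_eq_iff matrix_matrix_mult_def transpose_def)
  have a1: "(\<Sum>\<^sub>u i j. \<partial> i (Ru j k $ i $ j)) = (\<Sum>\<^sub>u i. \<partial> i (r k i))"
    by (simp add: r_def)
  have a2: "(\<Sum>\<^sub>u i j m. \<Gamma> i i m * Ru j k $ m $ j) = (\<Sum>\<^sub>u m. \<gamma> m * r k m)"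
    by (rule trans[OF sum3_321], rule trans[OF sum3_132]) (simp add: r_def \<gamma>_def sum_product)
  \<comment> \<open>\<open>Ru\<close> is antisymmetric in its upper indices and \<Gamma> is
    symmetric in its lower ones; \<open>b2\<close> vanishes in the same way.\<close>
  have a3: "(\<Sum>\<^sub>u i j m. Ru j k $ i $ m * \<Gamma> j i m) = 0"
  proof -
    have "(\<Sum>\<^sub>u i m. Ru j k $ i $ m * \<Gamma> j i m) = 0" for j
      by (rule sum_antisym_sym) (rule Ru_antisym, rule \<Gamma>_sym)
    then show ?thesis by (subst sum.swap) simp
  qed
  have b1: "(\<Sum>\<^sub>u i j. \<partial> j (Ru k i $ i $ j)) = (\<Sum>\<^sub>u i. \<partial> i (r k i))"
    by (subst sum.swap) (simp add: r2 flip: D_sum)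
  have b2: "(\<Sum>\<^sub>u i j m. \<Gamma> i j m * Ru k i $ m $ j) = 0"
  proof -
    have "(\<Sum>\<^sub>u j m. Ru k i $ m $ j * \<Gamma> i j m) = 0" for i
      by (rule sum_antisym_sym) (rule Ru_antisym, rule \<Gamma>_sym)
    then show ?thesis by (simp add: mult.commute)
  qed
  have b3: "(\<Sum>\<^sub>u i j m. Ru k i $ i $ m * \<Gamma> j j m) = (\<Sum>\<^sub>u m. \<gamma> m * r k m)"
    by (rule trans[OF sum3_321])
       (simp add: r2[symmetric] \<gamma>_def sum_product mult.commute)
  have c1: "(\<Sum>\<^sub>u i j. \<partial> k (Ru i j $ i $ j)) = - \<partial> k (\<Sum>\<^sub>u i. r i i)"
    by (simp add: r3 flip: D_sum) (simp add: sum_negf)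
  have c2: "(\<Sum>\<^sub>u i j m. \<Gamma> i k m * Ru i j $ m $ j) = - (\<Sum>\<^sub>u i m. \<Gamma> i k m * r i m)"
    by (rule trans[OF sum3_132]) (simp add: r3 sum_negf flip: sum_distrib_left)
  have c3: "(\<Sum>\<^sub>u i j m. Ru i j $ i $ m * \<Gamma> j k m) = - (\<Sum>\<^sub>u i m. \<Gamma> i k m * r i m)"
    by (rule trans[OF sum3_231]) (simp add: r4 sum_negf mult.commute flip: sum_distrib_left sum_distrib_right)
  have e: "2 * (\<Sum>\<^sub>u i. \<partial> i (r k i)) + 2 * (\<Sum>\<^sub>u m. \<gamma> m * r k m)
      - 2 * (\<Sum>\<^sub>u i m. \<Gamma> i k m * r i m) - \<partial> k (\<Sum>\<^sub>u i. r i i) = (\<Sum>\<^sub>u i j. ?E i j)"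
    unfolding sum.distrib a1 a2 a3 b1 b2 b3 c1 c2 c3 by (simp add: algebra_simps)
  have R: "Rcm i k = - r k i" for i k
    by (simp add: Rcm_Ru r_def)
  have "(\<Sum>\<^sub>u j m. \<Gamma> m j k * r m j) = (\<Sum>\<^sub>u i m. \<Gamma> i k m * r i m)"
    by (rule trans[OF sum.swap]) (simp add: \<Gamma>_sym)
  then have "2 * divm Rcm k - \<partial> k scalar = - (2 * (\<Sum>\<^sub>u i. \<partial> i (r k i)) + 2 * (\<Sum>\<^sub>u m. \<gamma> m * r k m)
      - 2 * (\<Sum>\<^sub>u i m. \<Gamma> i k m * r i m) - \<partial> k (\<Sum>\<^sub>u i. r i i))"
    by (simp add: divm_def scalar_def R sum.distrib sum_negf sum_subtractf right_diff_distrib distrib_left)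
  then show ?thesis
    unfolding e B by simp
qed

section \<open>Hessians and the Bochner formula\<close>

definition "gradient a i = (\<Sum>\<^sub>u j. K $ i $ j * \<partial> j a)"

definition "hessian a i j = \<partial> i (\<partial> j a) - (\<Sum>\<^sub>u k. \<Gamma> k i j * \<partial> k a)"

definition "hessian_m a i k = (\<Sum>\<^sub>u l. K $ i $ l * hessian a l k)"

lemma hessian_sym: "hessian a i j = hessian a j i"
  by (simp add: hessian_def \<Gamma>_sym[of _ i j] D_commute)

text \<open>Raising an index commutes with covariant differentiation, so the mixed Hessian is the
  covariant derivative of the gradient. This is the form whose divergence is taken in
  \<open>Bochner\<close>.\<close>

lemma hessian_m_eq: "hessian_m a j k = \<partial> k (gradient a j) + (\<Sum>\<^sub>u m. \<Gamma> j k m * gradient a m)"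
proof -
  have 1: "(\<Sum>\<^sub>u l m. \<Gamma> l k m * (K $ j $ m * \<partial> l a)) = (\<Sum>\<^sub>u l m. K $ j $ l * (\<Gamma> m l k * \<partial> m a))"
    by (rule trans[OF sum.swap]) (simp add: \<Gamma>_sym ac_simps)
  have 2: "(\<Sum>\<^sub>u l m. \<Gamma> j k m * (K $ m $ l * \<partial> l a)) = (\<Sum>\<^sub>u m l. \<Gamma> j k m * (K $ m $ l * \<partial> l a))"
    by (rule sum.swap)
  show ?thesis
    by (simp add: hessian_m_def hessian_def gradient_def D_K D_commute sum.distrib sum_subtractf sum_negf sum_distrib_left
        sum_distrib_right left_diff_distrib right_diff_distrib mult.assoc 1 2)
qed

lemma lap_eq: "(\<Sum>\<^sub>u i. hessian_m a i i) = div0 (gradient a)"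
proof -
  have "(\<Sum>\<^sub>u i m. \<Gamma> i i m * gradient a m) = (\<Sum>\<^sub>u i. \<gamma> i * gradient a i)"
    unfolding \<gamma>_def sum_distrib_right by (rule sum.swap)
  then show ?thesis
    by (simp add: hessian_m_eq div0_def sum.distrib)
qed

text \<open>Exchanging the commuting derivatives \<open>\<partial> j\<close> and
  \<open>\<partial> k\<close> in the divergence of the covariant derivative of the gradient produces
  the derivative of the Laplacian; the Christoffel terms left over are exactly those of
  \<open>Ric_eq\<close>.\<close>

lemma Bochner: "divm (hessian_m a) k = \<partial> k (div0 (gradient a)) + (\<Sum>\<^sub>u m. Ric k m * gradient a m)"
proof -
  have 1: "(\<Sum>\<^sub>u j m. \<Gamma> m j k * \<partial> m (gradient a j)) = (\<Sum>\<^sub>u j m. \<Gamma> j k m * \<partial> j (gradient a m))"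
    by (rule trans[OF sum.swap]) (simp add: \<Gamma>_sym)
  have 2: "(\<Sum>\<^sub>u j m. \<partial> j (\<Gamma> j k m) * gradient a m) = (\<Sum>\<^sub>u m j. \<partial> j (\<Gamma> j k m) * gradient a m)"
    by (rule sum.swap)
  have 3: "(\<Sum>\<^sub>u j m. \<gamma> j * (\<Gamma> j k m * gradient a m)) = (\<Sum>\<^sub>u m l. \<gamma> l * \<Gamma> l k m * gradient a m)"
    by (rule trans[OF sum.swap]) (simp add: ac_simps)
  have 4: "(\<Sum>\<^sub>u j m l. \<Gamma> m j k * (\<Gamma> j m l * gradient a l)) = (\<Sum>\<^sub>u m i l. \<Gamma> i k l * \<Gamma> l i m * gradient a m)"
    by (rule trans[OF sum3_321]) (simp add: \<Gamma>_sym[of _ _ k] ac_simps)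
  show ?thesis
    by (simp add: divm_def hessian_m_eq div0_def Ric_eq D_commute[of "Some k"] sum.distrib sum_subtractf
        sum_distrib_left sum_distrib_right left_diff_distrib right_diff_distrib distrib_left distrib_right 1 2 3 4)
qed

end

section \<open>Raising of indices\<close>

context metric_ring begin

definition "up2 B a b = (\<Sum>\<^sub>u p. K $ a $ p * (\<Sum>\<^sub>u q. K $ b $ q * B p q))"

lemma up2_pair: "(\<Sum>\<^sub>u a b. up2 X a b * Y a b) = (\<Sum>\<^sub>u a b. X a b * up2 Y a b)"
proof -
  have "(\<Sum>\<^sub>u a b. up2 X a b * Y a b) = (\<Sum>\<^sub>u a b p q. K $ a $ p * K $ b $ q * X p q * Y a b)"
    by (simp add: up2_def sum_distrib_left sum_distrib_right mult.assoc)
  also have "\<dots> = (\<Sum>\<^sub>u a p b q. K $ a $ p * K $ b $ q * X p q * Y a b)"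
    by (intro sum.cong refl sum.swap)
  also have "\<dots> = (\<Sum>\<^sub>u p a q b. K $ a $ p * K $ b $ q * X p q * Y a b)"
    by (rule trans[OF sum.swap], intro sum.cong refl sum.swap)
  also have "\<dots> = (\<Sum>\<^sub>u p q a b. K $ a $ p * K $ b $ q * X p q * Y a b)"
    by (intro sum.cong refl sum.swap)
  also have "\<dots> = (\<Sum>\<^sub>u a b. X a b * up2 Y a b)"
    by (simp add: up2_def sum_distrib_left sum_distrib_right K_comm ac_simps)
  finally show ?thesis .
qed

text \<open>The product rule with \<open>K\<close> parallel: the raised covariant derivative minus a
  correction for the new upper index. Further indices of \<open>X\<close> are treated as parameters,
  so the rule can be applied to one index after the other.\<close>

lemma D_raise: "\<partial> i (\<Sum>\<^sub>u p. K $ a $ p * X p)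
   = (\<Sum>\<^sub>u p. K $ a $ p * (\<partial> i (X p) - (\<Sum>\<^sub>u m. \<Gamma> m i p * X m))) - (\<Sum>\<^sub>u m. \<Gamma> a i m * (\<Sum>\<^sub>u p. K $ m $ p * X p))"
proof -
  have 1: "(\<Sum>\<^sub>u p m. \<Gamma> a i m * (K $ m $ p * X p)) = (\<Sum>\<^sub>u m p. \<Gamma> a i m * (K $ m $ p * X p))"
    by (rule sum.swap)
  have 2: "(\<Sum>\<^sub>u p m. \<Gamma> p i m * (K $ a $ m * X p)) = (\<Sum>\<^sub>u p m. K $ a $ p * (\<Gamma> m i p * X m))"
    by (rule trans[OF sum.swap]) (simp add: ac_simps)
  show ?thesis
    by (simp add: D_K sum.distrib sum_subtractf sum_negf sum_distrib_left sum_distrib_right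
        left_diff_distrib right_diff_distrib mult.assoc 1 2)
qed

end

section \<open>Closed three-forms\<close>

locale three_form_ring = metric_ring D G K \<Gamma>
  for D :: "'n::finite option \<Rightarrow> 'r::{comm_ring_1,real_algebra_1} \<Rightarrow> 'r" and G K \<Gamma> +
  fixes H :: "'n \<Rightarrow> 'n \<Rightarrow> 'n \<Rightarrow> 'r"
  assumes H12: "H i j k = - H j i k" and H23: "H i j k = - H i k j"
    and H_closed: "D (Some i) (H j k l) - D (Some j) (H i k l) + D (Some k) (H i j l) - D (Some l) (H i j k) = 0"
begin

lemma H_cyc: "H i j k = H j k i"
  by (metis H12 H23 minus_minus)

lemma H13: "H i j k = - H k j i"
  by (metis H12 H23 minus_minus)

text \<open>H with its last two indices raised; in \<open>Hu\<close> all three are raised. The two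
  stages match repeated use of \<open>D_raise\<close>.\<close>

definition "Hp l a b = up2 (H l) a b"

definition "Hu i a b = (\<Sum>\<^sub>u l. K $ i $ l * Hp l a b)"

definition "H2 i j = (\<Sum>\<^sub>u a b. Hp i a b * H j a b)"

definition "H2m i j = (\<Sum>\<^sub>u l. K $ i $ l * H2 l j)"

definition "nH = (\<Sum>\<^sub>u i. H2m i i)"

lemma Hu_eq: "Hu i a b = (\<Sum>\<^sub>u l p q. K $ i $ l * K $ a $ p * K $ b $ q * H l p q)"
  by (simp add: Hu_def Hp_def up2_def sum_distrib_left mult.assoc)

lemma Hu12: "Hu i a b = - Hu a i b"
proof -
  have "Hu i a b = (\<Sum>\<^sub>u p l q. K $ i $ l * K $ a $ p * K $ b $ q * H l p q)"
    unfolding Hu_eq by (rule sum3_213)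
  also have "\<dots> = (\<Sum>\<^sub>u p l q. - (K $ a $ p * K $ i $ l * K $ b $ q * H p l q))"
    by (intro sum.cong refl) (subst H12, simp add: ac_simps)
  finally show ?thesis unfolding Hu_eq[of a] by (simp add: sum_negf)
qed

lemma Hu23: "Hu i a b = - Hu i b a"
proof -
  have "Hu i a b = (\<Sum>\<^sub>u l q p. K $ i $ l * K $ a $ p * K $ b $ q * H l p q)"
    unfolding Hu_eq by (rule sum3_132)
  also have "\<dots> = (\<Sum>\<^sub>u l q p. - (K $ i $ l * K $ b $ q * K $ a $ p * H l q p))"
    by (intro sum.cong refl) (subst H23, simp add: ac_simps)
  finally show ?thesis unfolding Hu_eq[of i b] by (simp add: sum_negf)
qed

lemma Hu13: "Hu i j k = - Hu k j i"
  by (metis Hu12 Hu23 minus_minus)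

lemma Hu_cyc: "Hu i j k = Hu j k i"
  by (metis Hu12 Hu23 minus_minus)

lemma H2m_eq: "H2m i j = (\<Sum>\<^sub>u a b. Hu i a b * H j a b)"
proof -
  have "H2m i j = (\<Sum>\<^sub>u l a b. K $ i $ l * Hp l a b * H j a b)"
    by (simp add: H2m_def H2_def sum_distrib_left mult.assoc)
  also have "\<dots> = (\<Sum>\<^sub>u a b l. K $ i $ l * Hp l a b * H j a b)"
    by (rule sum3_231)
  finally show ?thesis by (simp add: Hu_def sum_distrib_right)
qed

lemma nH_eq: "nH = (\<Sum>\<^sub>u i a b. Hu i a b * H i a b)"
  by (simp add: nH_def H2m_eq)

lemma H2_sym: "H2 i j = H2 j i"
  unfolding H2_def Hp_def by (subst up2_pair) (simp add: mult.commute)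

lemma H_raised_pair: "(\<Sum>\<^sub>u i a b. Hu i a b * X i a b) = (\<Sum>\<^sub>u i a b. H i a b * (\<Sum>\<^sub>u l. K $ i $ l * up2 (X l) a b))"
proof -
  have "(\<Sum>\<^sub>u i a b. Hu i a b * X i a b) = (\<Sum>\<^sub>u i a b l. K $ i $ l * Hp l a b * X i a b)"
    by (simp add: Hu_def sum_distrib_left sum_distrib_right mult.assoc)
  also have "\<dots> = (\<Sum>\<^sub>u i l a b. K $ i $ l * Hp l a b * X i a b)"
    by (intro sum.cong refl sum3_312)
  also have "\<dots> = (\<Sum>\<^sub>u i l. K $ i $ l * (\<Sum>\<^sub>u a b. Hp l a b * X i a b))"
    by (simp add: sum_distrib_left mult.assoc)
  also have "\<dots> = (\<Sum>\<^sub>u l i. K $ l $ i * (\<Sum>\<^sub>u a b. H l a b * up2 (X i) a b))"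
    unfolding Hp_def up2_pair by (rule trans[OF sum.swap]) (simp add: K_comm)
  also have "\<dots> = (\<Sum>\<^sub>u l i a b. H l a b * (K $ l $ i * up2 (X i) a b))"
    by (simp add: sum_distrib_left ac_simps)
  also have "\<dots> = (\<Sum>\<^sub>u l a b i. H l a b * (K $ l $ i * up2 (X i) a b))"
    by (intro sum.cong refl sum3_231)
  finally show ?thesis by (simp add: sum_distrib_left)
qed

text \<open>By total antisymmetry each of the three inverse metrics in \<open>|H|\<^sup>2\<close> contributes the same amount.\<close>

lemma D_nH: "D d nH = 3 * (\<Sum>\<^sub>u i l. D d (K $ i $ l) * H2 i l) + 2 * (\<Sum>\<^sub>u i a b. Hu i a b * D d (H i a b))"
proof -
  define X where "X = (\<Sum>\<^sub>u i a b. H i a b * (\<Sum>\<^sub>u l p q. D d (K $ i $ l) * K $ a $ p * K $ b $ q * H l p q))"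
  have X1: "(\<Sum>\<^sub>u i l. D d (K $ i $ l) * H2 i l) = X"
  proof -
    have "X = (\<Sum>\<^sub>u i a b l. D d (K $ i $ l) * (Hp l a b * H i a b))"
      by (simp add: X_def Hp_def up2_def sum_distrib_left sum_distrib_right ac_simps)
    also have "\<dots> = (\<Sum>\<^sub>u i l a b. D d (K $ i $ l) * (Hp l a b * H i a b))"
      by (intro sum.cong refl sum3_312)
    also have "\<dots> = (\<Sum>\<^sub>u i l. D d (K $ i $ l) * H2 l i)"
      by (simp add: H2_def sum_distrib_left)
    finally show ?thesis by (simp add: H2_sym)
  qed
  have X2: "(\<Sum>\<^sub>u i a b. H i a b * (\<Sum>\<^sub>u l p q. K $ i $ l * D d (K $ a $ p) * K $ b $ q * H l p q)) = X"
  proof -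
    have "X = (\<Sum>\<^sub>u a i b. H i a b * (\<Sum>\<^sub>u l p q. D d (K $ i $ l) * K $ a $ p * K $ b $ q * H l p q))"
      unfolding X_def by (rule sum3_213)
    also have "\<dots> = (\<Sum>\<^sub>u a i b. H i a b * (\<Sum>\<^sub>u p l q. D d (K $ i $ l) * K $ a $ p * K $ b $ q * H l p q))"
      by (subst sum3_213[of "\<lambda>l p q. _ l p q"]) (rule refl)
    also have "\<dots> = (\<Sum>\<^sub>u a i b. H a i b * (\<Sum>\<^sub>u p l q. D d (K $ i $ l) * K $ a $ p * K $ b $ q * H p l q))"
      by (subst (1 2) H12) (simp add: sum_negf)
    finally show ?thesis by (simp add: ac_simps)
  qed
  have X3: "(\<Sum>\<^sub>u i a b. H i a b * (\<Sum>\<^sub>u l p q. K $ i $ l * K $ a $ p * D d (K $ b $ q) * H l p q)) = X"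
  proof -
    have "X = (\<Sum>\<^sub>u b a i. H i a b * (\<Sum>\<^sub>u l p q. D d (K $ i $ l) * K $ a $ p * K $ b $ q * H l p q))"
      unfolding X_def by (rule sum3_321)
    also have "\<dots> = (\<Sum>\<^sub>u b a i. H i a b * (\<Sum>\<^sub>u q p l. D d (K $ i $ l) * K $ a $ p * K $ b $ q * H l p q))"
      by (subst sum3_321[of "\<lambda>l p q. _ l p q"]) (rule refl)
    also have "\<dots> = (\<Sum>\<^sub>u b a i. H b a i * (\<Sum>\<^sub>u q p l. D d (K $ i $ l) * K $ a $ p * K $ b $ q * H q p l))"
      by (subst (1 2) H13) (simp add: sum_negf)
    finally show ?thesis by (simp add: ac_simps)
  qed
  have "(\<Sum>\<^sub>u i a b. D d (Hu i a b) * H i a b) = 3 * X + (\<Sum>\<^sub>u i a b. H i a b * (\<Sum>\<^sub>u l. K $ i $ l * up2 (\<lambda>p q. D d (H l p q)) a b))"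
  proof -
    have "D d (Hu i a b) * H i a b = H i a b * (\<Sum>\<^sub>u l p q. D d (K $ i $ l) * K $ a $ p * K $ b $ q * H l p q)
       + H i a b * (\<Sum>\<^sub>u l p q. K $ i $ l * D d (K $ a $ p) * K $ b $ q * H l p q)
       + H i a b * (\<Sum>\<^sub>u l p q. K $ i $ l * K $ a $ p * D d (K $ b $ q) * H l p q)
       + H i a b * (\<Sum>\<^sub>u l. K $ i $ l * up2 (\<lambda>p q. D d (H l p q)) a b)" for i a b
      by (simp add: Hu_eq up2_def sum.distrib sum_distrib_left sum_distrib_right algebra_simps)
    then show ?thesis
      by (simp add: sum.distrib X2 X3) (simp add: X_def algebra_simps)
  qed
  then show ?thesis
    by (simp add: nH_eq sum.distrib X1 H_raised_pair[of "\<lambda>i a b. D d (H i a b)"])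
qed

text \<open>The codifferential with upper indices and reversed sign; \<open>Bl\<close> below is \<open>-d\<^sup>*H\<close>.\<close>

definition "Bu a b = (\<Sum>\<^sub>u i. \<partial> i (Hu i a b) + \<gamma> i * Hu i a b)"

text \<open>Contracting dH = 0 with \<open>Hu\<close> gives three equal terms, so \<open>Y\<close>
  is one third of the pairing of \<open>Hu\<close> with \<open>\<partial> j\<close> of H. By
  \<open>D_nH\<close> this is one sixth of the derivative of |H|^2 up to a Christoffel term, which
  is the correction occurring in \<open>divm\<close>.\<close>

lemma div_H2m: "6 * divm H2m j = 6 * (\<Sum>\<^sub>u a b. Bu a b * H j a b) + \<partial> j nH"
proof -
  define Y where "Y = (\<Sum>\<^sub>u i a b. Hu i a b * \<partial> i (H j a b))"
  have Y2: "(\<Sum>\<^sub>u i a b. Hu i a b * \<partial> a (H i j b)) = Y"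
  proof -
    have "Y = (\<Sum>\<^sub>u a i b. Hu i a b * \<partial> i (H j a b))"
      unfolding Y_def by (rule sum3_213)
    also have "\<dots> = (\<Sum>\<^sub>u a i b. Hu a i b * \<partial> i (H a j b))"
      by (subst Hu12, subst H12) simp
    finally show ?thesis by simp
  qed
  have Y3: "(\<Sum>\<^sub>u i a b. Hu i a b * \<partial> b (H i j a)) = - Y"
  proof -
    have "Y = (\<Sum>\<^sub>u b a i. Hu i a b * \<partial> i (H j a b))"
      unfolding Y_def by (rule sum3_321)
    also have "\<dots> = (\<Sum>\<^sub>u b a i. - (Hu b a i * \<partial> i (H b j a)))"
      by (subst Hu13, subst H_cyc[symmetric]) simp
    finally show ?thesis by (simp add: sum_negf)
  qed
  have "(\<Sum>\<^sub>u i a b. Hu i a b * (\<partial> i (H j a b) - \<partial> j (H i a b) + \<partial> a (H i j b) - \<partial> b (H i j a))) = 0"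
    by (simp only: H_closed) simp
  then have Y: "3 * Y = (\<Sum>\<^sub>u i a b. Hu i a b * \<partial> j (H i a b))"
    by (simp add: algebra_simps sum.distrib sum_subtractf Y2 Y3) (simp add: Y_def algebra_simps)
  have Z: "(\<Sum>\<^sub>u i l. \<partial> j (K $ i $ l) * H2 i l) = - 2 * (\<Sum>\<^sub>u i m. \<Gamma> i j m * H2m m i)"
  proof -
    have a: "(\<Sum>\<^sub>u i l m. \<Gamma> i j m * (K $ m $ l * H2 i l)) = (\<Sum>\<^sub>u i m. \<Gamma> i j m * H2m m i)"
      by (rule trans[OF sum3_132]) (simp add: H2m_def sum_distrib_left H2_sym)
    have b: "(\<Sum>\<^sub>u i l m. \<Gamma> l j m * (K $ i $ m * H2 i l)) = (\<Sum>\<^sub>u i m. \<Gamma> i j m * H2m m i)"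
      by (rule trans[OF sum3_231]) (simp add: H2m_def sum_distrib_left K_comm)
    show ?thesis
      by (simp add: D_K left_diff_distrib sum_subtractf sum_negf sum_distrib_right mult.assoc a b)
  qed
  have n: "\<partial> j nH = 6 * Y - 6 * (\<Sum>\<^sub>u i m. \<Gamma> i j m * H2m m i)"
    unfolding D_nH Z Y[symmetric] by (simp add: algebra_simps)
  have 1: "(\<Sum>\<^sub>u i. \<partial> i (H2m i j) + \<gamma> i * H2m i j) = (\<Sum>\<^sub>u a b. Bu a b * H j a b) + Y"
  proof -
    have "(\<Sum>\<^sub>u a b i. \<partial> i (Hu i a b) * H j a b + \<gamma> i * Hu i a b * H j a b)
        = (\<Sum>\<^sub>u i a b. \<partial> i (Hu i a b) * H j a b + \<gamma> i * Hu i a b * H j a b)"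
      by (rule sum3_312)
    then show ?thesis
      by (simp add: H2m_eq Bu_def Y_def sum.distrib sum_distrib_left sum_distrib_right distrib_right mult.assoc)
  qed
  have 2: "(\<Sum>\<^sub>u i m. \<Gamma> m i j * H2m i m) = (\<Sum>\<^sub>u i m. \<Gamma> i j m * H2m m i)"
    by (rule trans[OF sum.swap]) (simp add: \<Gamma>_sym)
  show ?thesis
    unfolding n divm_def 1 2 by (simp add: algebra_simps)
qed

definition "cH l i j k = \<partial> l (H i j k) - (\<Sum>\<^sub>u m. \<Gamma> m l i * H m j k + \<Gamma> m l j * H i m k + \<Gamma> m l k * H i j m)"

definition "Bl j k = (\<Sum>\<^sub>u i l. K $ i $ l * cH l i j k)"

lemma D_Hp: "\<partial> i (Hp l a b) - (\<Sum>\<^sub>u m. \<Gamma> m i l * Hp m a b)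
   = up2 (cH i l) a b - (\<Sum>\<^sub>u m. \<Gamma> a i m * Hp l m b) - (\<Sum>\<^sub>u m. \<Gamma> b i m * Hp l a m)"
proof -
  define H1 where "H1 l p b = (\<Sum>\<^sub>u q. K $ b $ q * H l p q)" for l p b
  have H1: "\<partial> i (H1 l p b) = (\<Sum>\<^sub>u q. K $ b $ q * (\<partial> i (H l p q) - (\<Sum>\<^sub>u m. \<Gamma> m i q * H l p m))) - (\<Sum>\<^sub>u m. \<Gamma> b i m * H1 l p m)" for p
    unfolding H1_def by (rule D_raise)
  have Hp: "Hp l a b = (\<Sum>\<^sub>u p. K $ a $ p * H1 l p b)" for l a b
    by (simp add: Hp_def up2_def H1_def)
  have D: "\<partial> i (Hp l a b) = (\<Sum>\<^sub>u p. K $ a $ p * (\<partial> i (H1 l p b) - (\<Sum>\<^sub>u m. \<Gamma> m i p * H1 l m b))) - (\<Sum>\<^sub>u m. \<Gamma> a i m * Hp l m b)"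
    unfolding Hp by (rule D_raise)
  have e: "(\<Sum>\<^sub>u m. \<Gamma> m i p * H1 l m b) = (\<Sum>\<^sub>u q. K $ b $ q * (\<Sum>\<^sub>u m. \<Gamma> m i p * H l m q))" for p
    unfolding H1_def sum_distrib_left by (rule trans[OF sum.swap]) (simp add: ac_simps)
  have f: "(\<Sum>\<^sub>u p. K $ a $ p * (\<Sum>\<^sub>u m. \<Gamma> b i m * H1 l p m)) = (\<Sum>\<^sub>u m. \<Gamma> b i m * Hp l a m)"
    unfolding Hp sum_distrib_left by (rule trans[OF sum.swap]) (simp add: ac_simps)
  have g: "(\<Sum>\<^sub>u m. \<Gamma> m i l * Hp m a b) = (\<Sum>\<^sub>u p. K $ a $ p * (\<Sum>\<^sub>u q. K $ b $ q * (\<Sum>\<^sub>u m. \<Gamma> m i l * H m p q)))"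
    unfolding Hp H1_def sum_distrib_left by (rule trans[OF sum3_231]) (simp add: ac_simps)
  have "\<partial> i (Hp l a b) = (\<Sum>\<^sub>u p. K $ a $ p * (\<Sum>\<^sub>u q. K $ b $ q *
      (\<partial> i (H l p q) - (\<Sum>\<^sub>u m. \<Gamma> m i q * H l p m) - (\<Sum>\<^sub>u m. \<Gamma> m i p * H l m q))))
      - (\<Sum>\<^sub>u m. \<Gamma> b i m * Hp l a m) - (\<Sum>\<^sub>u m. \<Gamma> a i m * Hp l m b)"
    unfolding D H1 e by (simp add: right_diff_distrib sum_subtractf f)
  then show ?thesis
    unfolding g by (simp add: up2_def cH_def right_diff_distrib distrib_left sum_subtractf sum.distrib)
qed

text \<open>Identifies the short contravariant divergence with the codifferential defined by
  covariant derivatives. The corrections \<open>z1\<close> and \<open>z2\<close> for the free upper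
  indices vanish, as they pair the symmetric \<Gamma> with the antisymmetric
  \<open>Hu\<close>.\<close>

lemma Bu_eq: "Bu a b = up2 Bl a b"
proof -
  have D: "\<partial> i (Hu i a b) = (\<Sum>\<^sub>u l. K $ i $ l * (\<partial> i (Hp l a b) - (\<Sum>\<^sub>u m. \<Gamma> m i l * Hp m a b))) - (\<Sum>\<^sub>u m. \<Gamma> i i m * Hu m a b)" for i
    unfolding Hu_def by (rule D_raise)
  have g: "(\<Sum>\<^sub>u i m. \<Gamma> i i m * Hu m a b) = (\<Sum>\<^sub>u i. \<gamma> i * Hu i a b)"
    unfolding \<gamma>_def sum_distrib_right by (rule sum.swap)
  have z1: "(\<Sum>\<^sub>u i l. K $ i $ l * (\<Sum>\<^sub>u m. \<Gamma> a i m * Hp l m b)) = 0"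
  proof -
    have "(\<Sum>\<^sub>u i l. K $ i $ l * (\<Sum>\<^sub>u m. \<Gamma> a i m * Hp l m b)) = (\<Sum>\<^sub>u i m. Hu i m b * \<Gamma> a i m)"
      unfolding Hu_def sum_distrib_left sum_distrib_right by (rule trans[OF sum3_132]) (simp add: ac_simps)
    also have "\<dots> = 0"
      by (rule sum_antisym_sym) (rule Hu12, rule \<Gamma>_sym)
    finally show ?thesis .
  qed
  have z2: "(\<Sum>\<^sub>u i l. K $ i $ l * (\<Sum>\<^sub>u m. \<Gamma> b i m * Hp l a m)) = 0"
  proof -
    have "(\<Sum>\<^sub>u i l. K $ i $ l * (\<Sum>\<^sub>u m. \<Gamma> b i m * Hp l a m)) = (\<Sum>\<^sub>u i m. Hu i a m * \<Gamma> b i m)"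
      unfolding Hu_def sum_distrib_left sum_distrib_right by (rule trans[OF sum3_132]) (simp add: ac_simps)
    also have "\<dots> = 0"
      by (rule sum_antisym_sym) (rule Hu13, rule \<Gamma>_sym)
    finally show ?thesis .
  qed
  have "Bu a b = (\<Sum>\<^sub>u i l. K $ i $ l * up2 (cH i l) a b)"
    unfolding Bu_def D D_Hp sum.distrib sum_subtractf right_diff_distrib g z1 z2 by simp
  also have "\<dots> = (\<Sum>\<^sub>u l i. K $ l $ i * up2 (cH i l) a b)"
    by (rule trans[OF sum.swap]) (simp add: K_comm)
  also have "\<dots> = (\<Sum>\<^sub>u l i p q. K $ a $ p * (K $ b $ q * (K $ l $ i * cH i l p q)))"
    by (simp add: up2_def sum_distrib_left ac_simps)
  also have "\<dots> = (\<Sum>\<^sub>u l p q i. K $ a $ p * (K $ b $ q * (K $ l $ i * cH i l p q)))"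
    by (intro sum.cong refl sum3_231)
  also have "\<dots> = (\<Sum>\<^sub>u p q l i. K $ a $ p * (K $ b $ q * (K $ l $ i * cH i l p q)))"
    by (rule sum3_231)
  finally show ?thesis
    by (simp add: up2_def Bl_def sum_distrib_left)
qed

end

section \<open>First variation\<close>

context metric_ring begin

text \<open>The variation of the inverse metric is minus h = \<delta>g with both indices raised;
  accordingly \<open>\<omega>\<close> is minus tr h and \<open>X0\<close> is minus div h. This
  accounts for the signs in \<open>variation_S\<close>.\<close>

definition "\<kappa> i j = \<delta> (K $ i $ j)"

definition "\<omega> = (\<Sum>\<^sub>u i j. G $ i $ j * \<kappa> i j)"

lemma \<kappa>_sym: "\<kappa> i j = \<kappa> j i"
  by (simp add: \<kappa>_def K_comm)

text \<open>The symbols \<open>\<gamma>\<close> are the logarithmic derivatives of the volume density.\<close>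

lemma G_DK: "(\<Sum>\<^sub>u i j. G $ i $ j * \<partial> k (K $ i $ j)) = - 2 * \<gamma> k"
proof -
  have 1: "(\<Sum>\<^sub>u i j m. G $ i $ j * (\<Gamma> i k m * K $ m $ j)) = \<gamma> k"
  proof -
    have "(\<Sum>\<^sub>u i j m. G $ i $ j * (\<Gamma> i k m * K $ m $ j)) = (\<Sum>\<^sub>u i m. \<Gamma> i k m * (\<Sum>\<^sub>u j. G $ i $ j * K $ j $ m))"
      unfolding sum_distrib_left by (rule trans[OF sum3_132]) (simp add: K_comm ac_simps)
    then show ?thesis
      by (simp add: GK_comp if_distrib[of "\<lambda>x. _ * x"] \<gamma>_def \<Gamma>_sym[of _ k] cong: if_cong)
  qed
  have 2: "(\<Sum>\<^sub>u i j m. G $ i $ j * (\<Gamma> j k m * K $ i $ m)) = \<gamma> k"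
    unfolding 1[symmetric] by (rule trans[OF sum3_213]) (simp add: G_comm K_comm)
  show ?thesis
    by (simp add: D_K right_diff_distrib sum_subtractf sum_negf sum_distrib_left 1 2)
qed

lemma D_inverse: "D d (K $ i $ j) = - (\<Sum>\<^sub>u a b. K $ i $ a * D d (G $ a $ b) * K $ b $ j)"
proof -
  have "D d (K $ i $ j) = - (\<Sum>\<^sub>u b a. K $ i $ a * D d (G $ a $ b) * K $ b $ j)"
    using Dmat_inverse[of d] by (simp add: vec_eq_iff matrix_matrix_mult_def sum_distrib_right)
  then show ?thesis by (subst sum.swap) simp
qed

text \<open>By \<open>D_inverse\<close> each side is minus the trace of the product of
  \<open>K\<close>, one derivative of \<open>G\<close>, \<open>K\<close> and the other derivative of
  \<open>G\<close>, which is symmetric in d and e.\<close>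

lemma D_G_D_K: "(\<Sum>\<^sub>u i j. D d (G $ i $ j) * D e (K $ i $ j)) = (\<Sum>\<^sub>u i j. D e (G $ i $ j) * D d (K $ i $ j))"
proof -
  have "(\<Sum>\<^sub>u i j a b. D d (G $ i $ j) * (K $ i $ a * D e (G $ a $ b) * K $ b $ j))
      = (\<Sum>\<^sub>u i a b j. D d (G $ i $ j) * (K $ i $ a * D e (G $ a $ b) * K $ b $ j))"
    by (intro sum.cong refl sum3_231)
  also have "\<dots> = (\<Sum>\<^sub>u a b i j. D d (G $ i $ j) * (K $ i $ a * D e (G $ a $ b) * K $ b $ j))"
    by (rule sum3_231)
  also have "\<dots> = (\<Sum>\<^sub>u a b i j. D e (G $ a $ b) * (K $ a $ i * D d (G $ i $ j) * K $ j $ b))"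
    by (simp add: K_comm ac_simps)
  finally show ?thesis
    by (simp add: D_inverse sum_distrib_left sum_negf)
qed

text \<open>This is \<delta> \<partial>_k log sqrt(det g) = \<partial>_k (tr h) / 2, obtained
  without determinants by differentiating \<open>G_DK\<close> in time and exchanging the two
  derivations through \<open>D_G_D_K\<close>.\<close>

lemma \<delta>_\<gamma>: "2 * \<delta> (\<gamma> k) = - \<partial> k \<omega>"
proof -
  have "- 2 * \<delta> (\<gamma> k) = \<delta> (\<Sum>\<^sub>u i j. G $ i $ j * \<partial> k (K $ i $ j))"
    unfolding G_DK by simp
  also have "\<dots> = (\<Sum>\<^sub>u i j. \<delta> (G $ i $ j) * \<partial> k (K $ i $ j)) + (\<Sum>\<^sub>u i j. G $ i $ j * \<partial> k (\<kappa> i j))"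
    by (simp add: sum.distrib D_commute[of None] \<kappa>_def)
  also have "\<dots> = \<partial> k \<omega>"
    by (subst D_G_D_K) (simp add: sum.distrib \<omega>_def \<kappa>_def)
  finally have "- (2 * \<delta> (\<gamma> k)) = \<partial> k \<omega>" by simp
  then show ?thesis by (metis minus_equation_iff)
qed

definition "X0 i = divu \<kappa> i"

text \<open>The variation of \<open>g\<^sup>j\<^sup>k \<Gamma>\<^sup>i\<^sub>j\<^sub>k\<close> is read off from \<open>g\<^sup>j\<^sup>k \<Gamma>\<^sup>i\<^sub>j\<^sub>k = - (\<partial>\<^sub>j g\<^sup>i\<^sup>j + \<gamma>\<^sub>j g\<^sup>i\<^sup>j)\<close>.\<close>

lemma \<delta>_scalar: "\<delta> scalar = (\<Sum>\<^sub>u j k. \<kappa> j k * Ric j k) - div0 X0 + div0 (gradient \<omega>)"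
proof -
  define C where "C i j k = \<delta> (\<Gamma> i j k)" for i j k
  define \<theta> where "\<theta> k = \<delta> (\<gamma> k)" for k
  define W where "W i = (\<Sum>\<^sub>u j k. K $ j $ k * C i j k)" for i
  define V where "V i = (\<Sum>\<^sub>u j. K $ i $ j * \<theta> j)" for i
  have KG: "(\<Sum>\<^sub>u j k. K $ j $ k * \<Gamma> i j k) = - (\<Sum>\<^sub>u j. \<partial> j (K $ i $ j) + \<gamma> j * K $ i $ j)" for i
  proof -
    have a: "(\<Sum>\<^sub>u j m. \<Gamma> i j m * K $ m $ j) = (\<Sum>\<^sub>u j k. K $ j $ k * \<Gamma> i j k)"
      by (simp add: K_comm mult.commute)
    have b: "(\<Sum>\<^sub>u j m. \<Gamma> j j m * K $ i $ m) = (\<Sum>\<^sub>u j. \<gamma> j * K $ i $ j)"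
      unfolding \<gamma>_def sum_distrib_right by (rule sum.swap)
    show ?thesis
      by (simp add: D_K sum.distrib sum_subtractf sum_negf a b)
  qed
  have W: "W i = - X0 i - V i" for i
  proof -
    have "\<delta> (\<Sum>\<^sub>u j k. K $ j $ k * \<Gamma> i j k) = \<delta> (- (\<Sum>\<^sub>u j. \<partial> j (K $ i $ j) + \<gamma> j * K $ i $ j))"
      by (simp only: KG)
    then have "(\<Sum>\<^sub>u j k. \<kappa> j k * \<Gamma> i j k) + W i = - (\<Sum>\<^sub>u j. \<partial> j (\<kappa> i j) + \<gamma> j * \<kappa> i j) - V i"
      by (simp add: W_def C_def V_def \<theta>_def \<kappa>_def sum.distrib D_commute[of None] mult.commute algebra_simps)
    then have "W i = - (\<Sum>\<^sub>u j. \<partial> j (\<kappa> i j) + \<gamma> j * \<kappa> i j) - V i - (\<Sum>\<^sub>u j k. \<kappa> j k * \<Gamma> i j k)"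
      by (simp add: eq_diff_eq add.commute)
    then show ?thesis
      by (simp add: X0_def divu_def \<kappa>_sym[of i] mult.commute)
  qed
  have \<delta>Ric: "\<delta> (Ric j k) = (\<Sum>\<^sub>u i. \<partial> i (C i j k)) - \<partial> j (\<theta> k) + (\<Sum>\<^sub>u l. \<theta> l * \<Gamma> l j k) + (\<Sum>\<^sub>u l. \<gamma> l * C l j k)
      - (\<Sum>\<^sub>u i l. C i j l * \<Gamma> l i k) - (\<Sum>\<^sub>u i l. \<Gamma> i j l * C l i k)" for j k
    by (simp add: Ric_eq C_def \<theta>_def sum.distrib D_commute[of None])
  have t1: "(\<Sum>\<^sub>u j k i. K $ j $ k * \<partial> i (C i j k)) = (\<Sum>\<^sub>u i. \<partial> i (W i)) - (\<Sum>\<^sub>u i j k. \<partial> i (K $ j $ k) * C i j k)"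
    by (rule trans[OF sum3_312]) (simp add: W_def sum.distrib)
  have t2: "(\<Sum>\<^sub>u i j k. \<partial> i (K $ j $ k) * C i j k) = - (\<Sum>\<^sub>u j k i l. K $ j $ k * (C i j l * \<Gamma> l i k)) - (\<Sum>\<^sub>u j k i l. K $ j $ k * (\<Gamma> i j l * C l i k))"
  proof -
    have "(\<Sum>\<^sub>u i j k m. \<Gamma> k i m * K $ j $ m * C i j k) = (\<Sum>\<^sub>u i j m k. \<Gamma> k i m * K $ j $ m * C i j k)"
      by (intro sum.cong refl sum.swap)
    also have "\<dots> = (\<Sum>\<^sub>u j m i k. \<Gamma> k i m * K $ j $ m * C i j k)"
      by (rule sum3_231)
    finally have a: "(\<Sum>\<^sub>u i j k m. \<Gamma> k i m * K $ j $ m * C i j k) = (\<Sum>\<^sub>u j k i l. K $ j $ k * (C i j l * \<Gamma> l i k))"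
      by (simp add: ac_simps)
    have "(\<Sum>\<^sub>u i j k m. \<Gamma> j i m * K $ m $ k * C i j k) = (\<Sum>\<^sub>u i k m j. \<Gamma> j i m * K $ m $ k * C i j k)"
      by (intro sum.cong refl sum3_231)
    also have "\<dots> = (\<Sum>\<^sub>u k m i j. \<Gamma> j i m * K $ m $ k * C i j k)"
      by (rule sum3_231)
    also have "\<dots> = (\<Sum>\<^sub>u m k i j. \<Gamma> j i m * K $ m $ k * C i j k)"
      by (rule sum.swap)
    also have "\<dots> = (\<Sum>\<^sub>u m k j i. \<Gamma> j i m * K $ m $ k * C i j k)"
      by (intro sum.cong refl sum.swap)
    finally have b: "(\<Sum>\<^sub>u i j k m. \<Gamma> j i m * K $ m $ k * C i j k) = (\<Sum>\<^sub>u j k i l. K $ j $ k * (\<Gamma> i j l * C l i k))"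
      by (simp add: \<Gamma>_sym ac_simps)
    show ?thesis
      by (simp add: D_K left_diff_distrib sum_subtractf sum_negf sum_distrib_right a b)
  qed
  have t3: "(\<Sum>\<^sub>u j k. K $ j $ k * \<partial> j (\<theta> k)) = (\<Sum>\<^sub>u j. \<partial> j (V j)) - (\<Sum>\<^sub>u j k. \<partial> j (K $ j $ k) * \<theta> k)"
    by (simp add: V_def sum.distrib)
  have t4: "(\<Sum>\<^sub>u j k l. K $ j $ k * (\<theta> l * \<Gamma> l j k)) = - (\<Sum>\<^sub>u j k. \<partial> j (K $ j $ k) * \<theta> k) - (\<Sum>\<^sub>u j. \<gamma> j * V j)"
  proof -
    have "(\<Sum>\<^sub>u j k l. K $ j $ k * (\<theta> l * \<Gamma> l j k)) = (\<Sum>\<^sub>u l j k. K $ j $ k * (\<theta> l * \<Gamma> l j k))"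
      by (rule sum3_312)
    also have "\<dots> = (\<Sum>\<^sub>u l. \<theta> l * (\<Sum>\<^sub>u j k. K $ j $ k * \<Gamma> l j k))"
      by (simp add: sum_distrib_left ac_simps)
    also have "\<dots> = - (\<Sum>\<^sub>u l j. \<partial> j (K $ j $ l) * \<theta> l + \<gamma> j * (K $ j $ l * \<theta> l))"
      unfolding KG by (simp add: sum_distrib_left sum_negf K_comm algebra_simps)
    also have "(\<Sum>\<^sub>u l j. \<partial> j (K $ j $ l) * \<theta> l + \<gamma> j * (K $ j $ l * \<theta> l)) = (\<Sum>\<^sub>u j l. \<partial> j (K $ j $ l) * \<theta> l + \<gamma> j * (K $ j $ l * \<theta> l))"
      by (rule sum.swap)
    finally show ?thesis
      by (simp add: V_def sum.distrib sum_distrib_left)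
  qed
  have t5: "(\<Sum>\<^sub>u j k l. K $ j $ k * (\<gamma> l * C l j k)) = (\<Sum>\<^sub>u l. \<gamma> l * W l)"
    by (rule trans[OF sum3_312]) (simp add: W_def sum_distrib_left ac_simps)
  \<comment> \<open>The contracted Palatini identity: the products of \<Gamma> with the variations
    \<open>C\<close> and \<open>\<theta>\<close> are absorbed by the derivatives of
    \<open>K\<close>, and two divergences remain.\<close>
  have "(\<Sum>\<^sub>u j k. K $ j $ k * \<delta> (Ric j k)) = div0 W - div0 V"
    by (simp add: \<delta>Ric distrib_left right_diff_distrib sum.distrib sum_subtractf sum_distrib_left t1 t2 t3 t4 t5 div0_def)
  also have "div0 W = - div0 X0 - div0 V"
    unfolding W[abs_def] by (simp add: div0_diff div0_minus)
  also have "- div0 X0 - div0 V - div0 V = - div0 X0 - (div0 V + div0 V)"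
    by simp
  also have "div0 V + div0 V = - div0 (gradient \<omega>)"
  proof -
    have "V i + V i = - gradient \<omega> i" for i
      unfolding mult_2[symmetric] V_def gradient_def \<theta>_def sum_distrib_left mult.left_commute[of 2] \<delta>_\<gamma>
      by (simp add: sum_negf)
    then have "(\<lambda>i. V i + V i) = (\<lambda>i. - gradient \<omega> i)" ..
    then show ?thesis
      by (metis div0_add div0_minus)
  qed
  finally have 1: "(\<Sum>\<^sub>u j k. K $ j $ k * \<delta> (Ric j k)) = - div0 X0 + div0 (gradient \<omega>)"
    by simp
  have "scalar = (\<Sum>\<^sub>u j k. K $ j $ k * Ric j k)"
    by (simp add: scalar_def Rcm_def K_comm mult.commute)
  then show ?thesis
    using 1 by (simp add: sum.distrib \<kappa>_def algebra_simps)
qed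

end

section \<open>Product rules for gradients and divergences\<close>

context metric_ring begin

lemma gradient_add: "gradient (a + b) i = gradient a i + gradient b i"
  and gradient_diff: "gradient (a - b) i = gradient a i - gradient b i"
  and gradient_scale: "gradient (numeral n * a) i = numeral n * gradient a i"
  by (simp_all add: gradient_def sum.distrib sum_subtractf sum_distrib_left algebra_simps)

lemma div0_scale: "div0 (\<lambda>i. numeral n * V i) = numeral n * div0 V"
  by (simp add: div0_def sum_distrib_left algebra_simps)

lemma gradient_pair: "(\<Sum>\<^sub>u i. gradient a i * \<partial> i b) = (\<Sum>\<^sub>u i. gradient b i * \<partial> i a)"
  unfolding gradient_def sum_distrib_right by (rule trans[OF sum.swap]) (simp add: K_comm ac_simps)

lemma div0_contract:
  "div0 (\<lambda>i. \<Sum>\<^sub>u k. h i k * w k)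
   = (\<Sum>\<^sub>u k. w k * divm h k) + (\<Sum>\<^sub>u i k. h i k * (\<partial> i (w k) + (\<Sum>\<^sub>u m. \<Gamma> k i m * w m)))"
proof -
  have 1: "(\<Sum>\<^sub>u k j m. w k * (\<Gamma> m j k * h j m)) = (\<Sum>\<^sub>u i k m. h i k * (\<Gamma> k i m * w m))"
    by (rule trans[OF sum3_231]) (simp add: ac_simps)
  have 2: "(\<Sum>\<^sub>u i k. \<partial> i (h i k) * w k) = (\<Sum>\<^sub>u k i. w k * \<partial> i (h i k))"
    by (rule trans[OF sum.swap]) (simp add: ac_simps)
  have 3: "(\<Sum>\<^sub>u i k. \<gamma> i * (h i k * w k)) = (\<Sum>\<^sub>u k i. w k * (\<gamma> i * h i k))"
    by (rule trans[OF sum.swap]) (simp add: ac_simps)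
  show ?thesis
    by (simp add: div0_def divm_def sum.distrib sum_distrib_left right_diff_distrib sum_subtractf distrib_left 1 2 3)
qed

lemma div0_contract_gradient:
  "div0 (\<lambda>i. \<Sum>\<^sub>u k. h i k * gradient a k) = (\<Sum>\<^sub>u k. gradient a k * divm h k) + (\<Sum>\<^sub>u i k. h i k * hessian_m a k i)"
  by (simp add: div0_contract hessian_m_eq)

lemma div0_\<kappa>: "div0 (\<lambda>i. \<Sum>\<^sub>u j. \<kappa> i j * \<partial> j a) = (\<Sum>\<^sub>u i. \<partial> i a * X0 i) + (\<Sum>\<^sub>u i j. \<kappa> i j * hessian a i j)"
proof -
  have 1: "(\<Sum>\<^sub>u k j m. \<partial> k a * (\<Gamma> k j m * \<kappa> j m)) = (\<Sum>\<^sub>u i j k. \<kappa> i j * (\<Gamma> k i j * \<partial> k a))"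
    by (rule trans[OF sum3_231]) (simp add: ac_simps)
  have 2: "(\<Sum>\<^sub>u i k. \<partial> i (\<kappa> i k) * \<partial> k a) = (\<Sum>\<^sub>u k i. \<partial> k a * \<partial> i (\<kappa> i k))"
    by (rule trans[OF sum.swap]) (simp add: ac_simps)
  have 3: "(\<Sum>\<^sub>u i k. \<gamma> i * (\<kappa> i k * \<partial> k a)) = (\<Sum>\<^sub>u k i. \<partial> k a * (\<gamma> i * \<kappa> i k))"
    by (rule trans[OF sum.swap]) (simp add: ac_simps)
  show ?thesis
    by (simp add: div0_def X0_def divu_def hessian_def sum.distrib sum_distrib_left right_diff_distrib sum_subtractf distrib_left 1 2 3)
qed

definition "grad_sq a = (\<Sum>\<^sub>u i. gradient a i * \<partial> i a)"

lemma gradient_grad_sq: "gradient (grad_sq a) i = 2 * (\<Sum>\<^sub>u k. hessian_m a i k * gradient a k)"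
  and D_grad_sq: "\<partial> k (grad_sq a) = 2 * (\<Sum>\<^sub>u j. \<partial> j a * hessian_m a j k)"
proof -
  have D: "\<partial> k (grad_sq a) = 2 * (\<Sum>\<^sub>u j. \<partial> j a * hessian_m a j k)" for k
  proof -
    have 1: "(\<Sum>\<^sub>u j m. \<Gamma> j k m * gradient a m * \<partial> j a) = (\<Sum>\<^sub>u i m. gradient a i * (\<Gamma> m i k * \<partial> m a))"
      by (rule trans[OF sum.swap]) (simp add: \<Gamma>_sym ac_simps)
    have "(\<Sum>\<^sub>u i. \<partial> k (gradient a i) * \<partial> i a) = (\<Sum>\<^sub>u j. \<partial> j a * hessian_m a j k) - (\<Sum>\<^sub>u i m. gradient a i * (\<Gamma> m i k * \<partial> m a))"
      by (simp add: hessian_m_eq distrib_left sum.distrib sum_distrib_left mult.commute flip: 1)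
         (simp add: ac_simps, rule trans[OF sum.swap], simp add: \<Gamma>_sym)
    moreover have "(\<Sum>\<^sub>u i. gradient a i * \<partial> k (\<partial> i a)) = (\<Sum>\<^sub>u j. \<partial> j a * hessian_m a j k) + (\<Sum>\<^sub>u i m. gradient a i * (\<Gamma> m i k * \<partial> m a))"
    proof -
      have "(\<Sum>\<^sub>u j. \<partial> j a * hessian_m a j k) = (\<Sum>\<^sub>u l. gradient a l * hessian a l k)"
        unfolding hessian_m_def gradient_def sum_distrib_left sum_distrib_right by (rule trans[OF sum.swap]) (simp add: K_comm ac_simps)
      then show ?thesis
        by (simp add: hessian_def D_commute[of "Some k"] right_diff_distrib sum_subtractf sum_distrib_left)
    qed
    ultimately show ?thesis
      by (simp add: grad_sq_def sum.distrib)
  qed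
  show "\<partial> k (grad_sq a) = 2 * (\<Sum>\<^sub>u j. \<partial> j a * hessian_m a j k)" by (rule D)
  have "(\<Sum>\<^sub>u k j l. K $ i $ k * (\<partial> j a * (K $ j $ l * hessian a l k))) = (\<Sum>\<^sub>u l k j. K $ i $ k * (\<partial> j a * (K $ j $ l * hessian a l k)))"
    by (rule sum3_312)
  then have e: "(\<Sum>\<^sub>u k. K $ i $ k * (\<Sum>\<^sub>u j. \<partial> j a * hessian_m a j k)) = (\<Sum>\<^sub>u k. hessian_m a i k * gradient a k)"
    by (simp add: hessian_m_def gradient_def sum_product) (simp add: sum_distrib_left sum_distrib_right hessian_sym K_comm ac_simps)
  show "gradient (grad_sq a) i = 2 * (\<Sum>\<^sub>u k. hessian_m a i k * gradient a k)"
    unfolding gradient_def[of "grad_sq a"] D mult.left_commute[of _ 2] sum_distrib_left[symmetric] e ..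
qed

end

section \<open>Weighted operators and the first variation of the weighted scalar curvature\<close>

locale weighted_ring = three_form_ring D G K \<Gamma> H
  for D :: "'n::finite option \<Rightarrow> 'r::{comm_ring_1,real_algebra_1} \<Rightarrow> 'r" and G K \<Gamma> H +
  fixes F :: 'r
begin

abbreviation "v \<equiv> gradient F"

definition "lap = div0 v"

text \<open>Equals e^F div(e^-F V), written so that the exponential need not be an element of the
  ring.\<close>

definition "divF V = div0 V - (\<Sum>\<^sub>u i. \<partial> i F * V i)"

lemma divF_add: "divF (\<lambda>i. V i + W i) = divF V + divF W"
  and divF_diff: "divF (\<lambda>i. V i - W i) = divF V - divF W"
  and divF_scale: "divF (\<lambda>i. numeral n * V i) = numeral n * divF V"
  by (simp_all add: divF_def div0_add div0_diff div0_scale sum.distrib sum_subtractf sum_distrib_left algebra_simps)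

definition "lapF a = divF (gradient a)"

lemma lapF_add: "lapF (a + b) = lapF a + lapF b"
  and lapF_diff: "lapF (a - b) = lapF a - lapF b"
  and lapF_scale: "lapF (numeral n * a) = numeral n * lapF a"
  unfolding lapF_def gradient_add[abs_def] gradient_diff[abs_def] gradient_scale[abs_def]
  by (simp_all add: divF_add divF_diff divF_scale)

lemma lapF_eq: "lapF a = div0 (gradient a) - (\<Sum>\<^sub>u i. v i * \<partial> i a)"
  by (simp add: lapF_def divF_def gradient_pair[of F]) (simp add: mult.commute)

text \<open>This is \<Delta>_F F. Up to constants it is the only second-order quantity left in the
  variation of the weighted volume, see \<open>\<omega>_F\<close>.\<close>

definition "L = lap - grad_sq F"

text \<open>To avoid division, \<open>S\<close> is \<open>12 R\<^sup>H\<^sup>,\<^sup>F\<close>, \<open>p\<close> is four times the symmetric part of \<open>Rc\<^sup>H\<^sup>,\<^sup>F\<close>, and \<open>q\<close> below is twice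
  its antisymmetric part.\<close>

definition "S = 12 * scalar - nH + 24 * lap - 12 * grad_sq F"

text \<open>The weighted divergence of \<open>\<kappa>\<close>, that is, minus div_F h with its
  index raised.\<close>

definition "Y i = X0 i - (\<Sum>\<^sub>u j. \<kappa> i j * \<partial> j F)"

definition "p i j = 4 * Ric i j - H2 i j + 4 * hessian F i j"

text \<open>The variation of the Laplacian contributes the divergence of \<kappa>(grad F) twice. One
  copy belongs to \<open>divF Y\<close>; the other, expanded by \<open>div0_\<kappa>\<close>,
  supplies the remaining part of \<open>divF Y\<close> and the Hessian term of
  \<open>p\<close>.\<close>

lemma variation_S:
  "\<delta> S = - 12 * divF Y + 3 * (\<Sum>\<^sub>u i j. \<kappa> i j * p i j) - 2 * (\<Sum>\<^sub>u i a b. Hu i a b * \<delta> (H i a b))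
    + 12 * lapF (\<omega> + 2 * \<delta> F)"
proof -
  have \<delta>v: "\<delta> (v i) = (\<Sum>\<^sub>u j. \<kappa> i j * \<partial> j F) + gradient (\<delta> F) i" for i
    by (simp add: gradient_def \<kappa>_def sum.distrib D_commute[of None])
  have "2 * \<delta> lap = 2 * div0 (\<lambda>i. \<delta> (v i)) + (\<Sum>\<^sub>u i. 2 * \<delta> (\<gamma> i) * v i)"
    by (simp add: lap_def div0_def sum.distrib sum_distrib_left D_commute[of None] algebra_simps)
  then have lap: "2 * \<delta> lap = 2 * div0 (\<lambda>i. \<Sum>\<^sub>u j. \<kappa> i j * \<partial> j F) + 2 * div0 (gradient (\<delta> F)) - (\<Sum>\<^sub>u i. v i * \<partial> i \<omega>)"
    unfolding \<delta>_\<gamma> \<delta>v div0_add by (simp add: sum_negf mult.commute distrib_left)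
  have "\<delta> (grad_sq F) = (\<Sum>\<^sub>u i. (\<Sum>\<^sub>u j. \<kappa> i j * \<partial> j F) * \<partial> i F) + ((\<Sum>\<^sub>u i. gradient (\<delta> F) i * \<partial> i F) + (\<Sum>\<^sub>u i. v i * \<partial> i (\<delta> F)))"
    by (simp add: grad_sq_def \<delta>v sum.distrib D_commute[of None] algebra_simps)
  then have grad_sq: "\<delta> (grad_sq F) = (\<Sum>\<^sub>u i. (\<Sum>\<^sub>u j. \<kappa> i j * \<partial> j F) * \<partial> i F) + 2 * (\<Sum>\<^sub>u i. v i * \<partial> i (\<delta> F))"
    by (simp only: gradient_pair[of "\<delta> F" F]) simp
  have Yd: "divF Y = div0 X0 - div0 (\<lambda>i. \<Sum>\<^sub>u j. \<kappa> i j * \<partial> j F) - (\<Sum>\<^sub>u i. \<partial> i F * X0 i)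
      + (\<Sum>\<^sub>u i. (\<Sum>\<^sub>u j. \<kappa> i j * \<partial> j F) * \<partial> i F)"
    unfolding divF_def Y_def[abs_def] div0_diff by (simp add: right_diff_distrib sum_subtractf) (simp add: mult.commute)
  have laplace: "lapF (\<omega> + 2 * \<delta> F) = div0 (gradient \<omega>) + 2 * div0 (gradient (\<delta> F)) - (\<Sum>\<^sub>u i. v i * \<partial> i \<omega>) - 2 * (\<Sum>\<^sub>u i. v i * \<partial> i (\<delta> F))"
    by (simp only: lapF_add lapF_scale) (simp add: lapF_eq algebra_simps)
  have pp: "3 * (\<Sum>\<^sub>u i j. \<kappa> i j * p i j) = 12 * (\<Sum>\<^sub>u i j. \<kappa> i j * Ric i j) - 3 * (\<Sum>\<^sub>u i j. \<kappa> i j * H2 i j)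
      + 12 * (\<Sum>\<^sub>u i j. \<kappa> i j * hessian F i j)"
    by (simp add: p_def algebra_simps sum.distrib sum_subtractf sum_distrib_left)
  have dS: "\<delta> S = 12 * \<delta> scalar - \<delta> nH + 12 * (2 * \<delta> lap) - 12 * \<delta> (grad_sq F)"
    by (simp add: S_def)
  have dn: "\<delta> nH = 3 * (\<Sum>\<^sub>u i j. \<kappa> i j * H2 i j) + 2 * (\<Sum>\<^sub>u i a b. Hu i a b * \<delta> (H i a b))"
    by (simp add: D_nH \<kappa>_def)
  show ?thesis
    unfolding dS \<delta>_scalar dn lap grad_sq Yd laplace pp div0_\<kappa> by (simp add: algebra_simps)
qed

end

section \<open>Generalized Ricci flow\<close>

text \<open>The element \<open>c\<close> stands for \<open>n/2\<tau>\<close>.\<close>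

locale flow_ring = weighted_ring D G K \<Gamma> H F
  for D :: "'n::finite option \<Rightarrow> 'r::{comm_ring_1,real_algebra_1} \<Rightarrow> 'r" and G K \<Gamma> H F +
  fixes c :: 'r
  assumes flow_G: "2 * D None (G $ i $ j) = H2 i j - 4 * Ric i j"
    and flow_H: "D None (H i j k) = D (Some i) (Bl j k) + D (Some j) (Bl k i) + D (Some k) (Bl i j)"
    and flow_F: "4 * D None F = 4 * c - 4 * L - 4 * scalar + nH"
    and c_const: "D (Some i) c = 0"
begin

lemma four_cancel: "4 * a = 4 * b \<Longrightarrow> a = (b::'r)"
  using two_cancel[of "2 * a" "2 * b"] two_cancel[of a b] by simp

text \<open>Read off from the flow equation, in which both \<delta>g and H^2 are symmetric.\<close>

lemma Ric_sym: "Ric i j = Ric j i"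
proof -
  have "H2 i j - 4 * Ric i j = H2 j i - 4 * Ric j i"
    unfolding flow_G[symmetric] by (simp add: G_comm)
  then show ?thesis
    using four_cancel by (simp add: H2_sym[of i j])
qed

lemma p_sym: "p i j = p j i"
  by (simp add: p_def Ric_sym[of i j] H2_sym[of i j] hessian_sym[of _ i j])

text \<open>By the flow equation this is minus twice \<delta>g with one index raised;
  \<open>pm\<close> below is the mixed form of \<open>p\<close>.\<close>

definition "e i k = 4 * Rcm i k - H2m i k"

definition "pm i k = e i k + 4 * hessian_m F i k"

lemma e_eq: "e i k = (\<Sum>\<^sub>u l. K $ i $ l * (4 * Ric l k - H2 l k))"
  by (simp add: e_def Rcm_def H2m_def Ric_sym[of k] K_comm[of _ i] right_diff_distrib sum_subtractf sum_distrib_left ac_simps)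

lemma pm_eq: "pm i k = (\<Sum>\<^sub>u l. K $ i $ l * p l k)"
  by (simp add: pm_def e_eq hessian_m_def p_def distrib_left right_diff_distrib sum_subtractf sum.distrib sum_distrib_left ac_simps)

lemma \<kappa>_eq: "2 * \<kappa> i j = (\<Sum>\<^sub>u k. e i k * K $ k $ j)"
proof -
  have "2 * \<kappa> i j = - (\<Sum>\<^sub>u a b. K $ i $ a * (2 * \<delta> (G $ a $ b)) * K $ b $ j)"
    by (simp add: \<kappa>_def D_inverse sum_distrib_left ac_simps)
  also have "\<dots> = (\<Sum>\<^sub>u a b. K $ i $ a * (4 * Ric a b - H2 a b) * K $ b $ j)"
    unfolding flow_G by (simp add: sum_negf[symmetric] algebra_simps)
  also have "\<dots> = (\<Sum>\<^sub>u b a. K $ i $ a * (4 * Ric a b - H2 a b) * K $ b $ j)"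
    by (rule sum.swap)
  finally show ?thesis
    by (simp add: e_eq sum_distrib_right)
qed

lemma \<omega>_eq: "2 * \<omega> = 4 * scalar - nH"
proof -
  have "2 * \<omega> = (\<Sum>\<^sub>u i j. G $ i $ j * (2 * \<kappa> i j))"
    by (simp add: \<omega>_def sum_distrib_left ac_simps)
  also have "\<dots> = (\<Sum>\<^sub>u i j k. G $ i $ j * (K $ j $ k * e i k))"
    unfolding \<kappa>_eq by (simp add: sum_distrib_left K_comm ac_simps)
  also have "\<dots> = (\<Sum>\<^sub>u i k j. G $ i $ j * (K $ j $ k * e i k))"
    by (rule sum3_132)
  also have "\<dots> = (\<Sum>\<^sub>u i k. (\<Sum>\<^sub>u j. G $ i $ j * K $ j $ k) * e i k)"
    by (simp add: sum_distrib_right mult.assoc)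
  also have "\<dots> = (\<Sum>\<^sub>u i. e i i)"
    by (simp add: GK_comp if_distrib[of "\<lambda>x. x * _"] cong: if_cong)
  finally show ?thesis
    by (simp add: e_def scalar_def nH_def sum_subtractf sum_distrib_left)
qed

text \<open>The left side is minus twice the logarithmic time derivative of the weighted volume e^-F
  dV. Scalar curvature and |H|^2 cancel between the evolutions of the metric and of F.\<close>

lemma \<omega>_F: "\<omega> + 2 * \<delta> F = 2 * c - 2 * L"
proof (rule two_cancel)
  have "2 * (\<omega> + 2 * \<delta> F) = 2 * \<omega> + 4 * \<delta> F" by simp
  then show "2 * (\<omega> + 2 * \<delta> F) = 2 * (2 * c - 2 * L)"
    unfolding \<omega>_eq flow_F by simp
qed

lemma divm_e: "6 * divm e k = \<partial> k S - 24 * \<partial> k lap + 12 * \<partial> k (grad_sq F) - 6 * (\<Sum>\<^sub>u a b. Bu a b * H k a b)"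
proof -
  have "6 * divm e k = 12 * (2 * divm Rcm k) - 6 * divm H2m k"
    by (simp add: e_def[abs_def] divm_diff divm_scale)
  then show ?thesis
    unfolding contracted_Bianchi div_H2m by (simp add: S_def algebra_simps)
qed

definition "U i = (\<Sum>\<^sub>u a b. Hu i a b * Bl a b)"

definition "Z i = (\<Sum>\<^sub>u k. pm i k * v k)"

lemma BH_raise: "(\<Sum>\<^sub>u k. K $ k $ i * (\<Sum>\<^sub>u a b. Bu a b * H k a b)) = U i"
proof -
  have "(\<Sum>\<^sub>u k. K $ k $ i * (\<Sum>\<^sub>u a b. Bu a b * H k a b)) = (\<Sum>\<^sub>u k a b. K $ i $ k * Hp k a b * Bl a b)"
    unfolding Bu_eq up2_pair by (simp add: Hp_def sum_distrib_left K_comm ac_simps)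
  also have "\<dots> = (\<Sum>\<^sub>u a b k. K $ i $ k * Hp k a b * Bl a b)"
    by (rule sum3_231)
  finally show ?thesis
    by (simp add: U_def Hu_def sum_distrib_right)
qed

lemma X0_eq: "12 * X0 i = gradient S i - 24 * gradient lap i + 12 * gradient (grad_sq F) i - 6 * U i"
proof -
  have "2 * X0 i = divu (\<lambda>i j. 2 * \<kappa> i j) i"
    by (simp add: X0_def divu_def sum.distrib sum_distrib_left distrib_left ac_simps)
  also have "\<dots> = (\<Sum>\<^sub>u k. K $ k $ i * divm e k)"
    unfolding \<kappa>_eq by (rule divu_raise)
  finally have "6 * (2 * X0 i) = (\<Sum>\<^sub>u k. K $ k $ i * (6 * divm e k))"
    by (simp add: sum_distrib_left mult.left_commute)
  then have "12 * X0 i = (\<Sum>\<^sub>u k. K $ k $ i * (6 * divm e k))"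
    by simp
  then show ?thesis
    unfolding divm_e BH_raise[symmetric]
    by (simp add: gradient_def K_comm[of i] sum.distrib sum_subtractf sum_distrib_left algebra_simps)
qed

text \<open>The weighted Bianchi identity along the flow. The gradients of the Laplacian and of
  |grad F|^2 recombine to that of \<open>L\<close> once the Hessian of F applied to grad F is added
  to complete \<open>e\<close> to \<open>pm\<close> in \<open>Z\<close>.\<close>

lemma Y_eq: "12 * Y i = gradient S i - 24 * gradient L i - 6 * Z i - 6 * U i"
proof -
  have "12 * (\<Sum>\<^sub>u j. \<kappa> i j * \<partial> j F) = 6 * (\<Sum>\<^sub>u j. (2 * \<kappa> i j) * \<partial> j F)"
    by (simp add: sum_distrib_left ac_simps)
  also have "(\<Sum>\<^sub>u j. (2 * \<kappa> i j) * \<partial> j F) = (\<Sum>\<^sub>u k. e i k * v k)"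
    unfolding \<kappa>_eq gradient_def sum_distrib_left sum_distrib_right by (rule trans[OF sum.swap]) (simp add: ac_simps)
  finally have y: "12 * Y i = gradient S i - 24 * gradient lap i + 12 * gradient (grad_sq F) i - 6 * U i - 6 * (\<Sum>\<^sub>u k. e i k * v k)"
    by (simp add: Y_def right_diff_distrib X0_eq)
  have z: "Z i = (\<Sum>\<^sub>u k. e i k * v k) + 4 * (\<Sum>\<^sub>u k. hessian_m F i k * v k)"
    by (simp add: Z_def pm_def distrib_right distrib_left sum.distrib sum_distrib_left ac_simps)
  have l: "gradient L i = gradient lap i - 2 * (\<Sum>\<^sub>u k. hessian_m F i k * v k)"
    by (simp add: L_def gradient_diff gradient_grad_sq)
  show ?thesis
    unfolding y z l gradient_grad_sq by (simp add: algebra_simps)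
qed

definition "\<iota> a b = (\<Sum>\<^sub>u i. v i * H i a b)"

definition "q a b = Bl a b - \<iota> a b"

lemma up2_\<iota>: "up2 \<iota> a b = (\<Sum>\<^sub>u i. \<partial> i F * Hu i a b)"
proof -
  have "(\<Sum>\<^sub>u i. \<partial> i F * Hu i a b) = (\<Sum>\<^sub>u l. v l * Hp l a b)"
    unfolding Hu_def gradient_def sum_distrib_left sum_distrib_right by (rule trans[OF sum.swap]) (simp add: K_comm ac_simps)
  also have "\<dots> = (\<Sum>\<^sub>u l p q. K $ a $ p * (K $ b $ q * (v l * H l p q)))"
    by (simp add: Hp_def up2_def sum_distrib_left ac_simps)
  also have "\<dots> = (\<Sum>\<^sub>u p q l. K $ a $ p * (K $ b $ q * (v l * H l p q)))"
    by (rule sum3_231)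
  finally show ?thesis
    by (simp add: up2_def \<iota>_def sum_distrib_left)
qed

lemma up2_q: "up2 q a b = Bu a b - up2 \<iota> a b"
  by (simp add: Bu_eq up2_def q_def right_diff_distrib sum_subtractf)

text \<open>Differentiating \<open>Hu\<close> gives the divergence \<open>Bu\<close>, the weight
  subtracts grad F contracted with H, and together they form q with raised indices.\<close>

lemma divF_U: "divF U = (\<Sum>\<^sub>u i a b. Hu i a b * \<partial> i (Bl a b)) + (\<Sum>\<^sub>u a b. up2 q a b * Bl a b)"
proof -
  have 1: "(\<Sum>\<^sub>u i a b. \<partial> i (Hu i a b) * Bl a b + \<gamma> i * Hu i a b * Bl a b) = (\<Sum>\<^sub>u a b. Bu a b * Bl a b)"
    by (rule trans[OF sum3_231]) (simp add: Bu_def sum_distrib_right distrib_right)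
  have 2: "(\<Sum>\<^sub>u i a b. \<partial> i F * Hu i a b * Bl a b) = (\<Sum>\<^sub>u a b. up2 \<iota> a b * Bl a b)"
    by (rule trans[OF sum3_231]) (simp add: up2_\<iota> sum_distrib_right)
  have "divF U = (\<Sum>\<^sub>u i a b. Hu i a b * \<partial> i (Bl a b)) + (\<Sum>\<^sub>u i a b. \<partial> i (Hu i a b) * Bl a b + \<gamma> i * Hu i a b * Bl a b)
      - (\<Sum>\<^sub>u i a b. \<partial> i F * Hu i a b * Bl a b)"
    by (simp add: divF_def div0_def U_def sum.distrib sum_distrib_left mult.assoc algebra_simps)
  then show ?thesis
    unfolding 1 2 by (simp add: up2_q left_diff_distrib sum_subtractf)
qed

text \<open>The Ricci term from \<open>Bochner\<close> is cancelled by the one in the weight term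
  \<open>FZ\<close>, and so is the Hessian paired with grad F twice. The H^2 part of
  \<open>FZ\<close> turns \<open>Bu\<close> into the raised q.\<close>

lemma divF_Z: "6 * divF Z = (\<Sum>\<^sub>u i. v i * \<partial> i S) - 6 * (\<Sum>\<^sub>u a b. up2 q a b * \<iota> a b) + 6 * (\<Sum>\<^sub>u i k. pm i k * hessian_m F k i)"
proof -
  have d: "6 * divm pm k = \<partial> k S + 24 * (\<Sum>\<^sub>u j. \<partial> j F * hessian_m F j k) - 6 * (\<Sum>\<^sub>u a b. Bu a b * H k a b)
      + 24 * (\<Sum>\<^sub>u m. Ric k m * v m)" for k
  proof -
    have "6 * divm pm k = 6 * divm e k + 24 * divm (hessian_m F) k"
      by (simp add: pm_def[abs_def] divm_add divm_scale algebra_simps)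
    then show ?thesis
      unfolding divm_e Bochner by (simp add: D_grad_sq lap_def algebra_simps)
  qed
  have s1: "(\<Sum>\<^sub>u k. v k * (\<Sum>\<^sub>u a b. Bu a b * H k a b)) = (\<Sum>\<^sub>u a b. Bu a b * \<iota> a b)"
    unfolding \<iota>_def sum_distrib_left by (rule trans[OF sum3_231]) (simp add: ac_simps)
  have s2: "(\<Sum>\<^sub>u i. \<partial> i F * Rcm i k) = (\<Sum>\<^sub>u m. Ric k m * v m)" for k
    unfolding Rcm_def gradient_def sum_distrib_left by (rule trans[OF sum.swap]) (simp add: ac_simps)
  have s3: "(\<Sum>\<^sub>u k. v k * (\<Sum>\<^sub>u i. \<partial> i F * H2m i k)) = (\<Sum>\<^sub>u a b. up2 \<iota> a b * \<iota> a b)"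
  proof -
    have "(\<Sum>\<^sub>u i. \<partial> i F * H2m i k) = (\<Sum>\<^sub>u a b. up2 \<iota> a b * H k a b)" for k
      unfolding H2m_eq up2_\<iota> sum_distrib_left sum_distrib_right by (rule trans[OF sum3_231]) (simp add: ac_simps)
    then have "(\<Sum>\<^sub>u k. v k * (\<Sum>\<^sub>u i. \<partial> i F * H2m i k)) = (\<Sum>\<^sub>u k a b. v k * (up2 \<iota> a b * H k a b))"
      by (simp add: sum_distrib_left)
    also have "\<dots> = (\<Sum>\<^sub>u a b k. v k * (up2 \<iota> a b * H k a b))"
      by (rule sum3_231)
    finally show ?thesis
      by (simp add: \<iota>_def sum_distrib_left ac_simps)
  qed
  have "(\<Sum>\<^sub>u i. \<partial> i F * Z i) = (\<Sum>\<^sub>u k i. v k * (\<partial> i F * pm i k))"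
    unfolding Z_def sum_distrib_left by (rule trans[OF sum.swap]) (simp add: ac_simps)
  also have "\<dots> = 4 * (\<Sum>\<^sub>u k. v k * (\<Sum>\<^sub>u m. Ric k m * v m)) - (\<Sum>\<^sub>u k. v k * (\<Sum>\<^sub>u i. \<partial> i F * H2m i k))
      + 4 * (\<Sum>\<^sub>u k. v k * (\<Sum>\<^sub>u j. \<partial> j F * hessian_m F j k))"
    unfolding s2[symmetric]
    by (simp add: pm_def e_def distrib_left right_diff_distrib sum.distrib sum_subtractf sum_distrib_left ac_simps)
  finally have FZ: "(\<Sum>\<^sub>u i. \<partial> i F * Z i) = 4 * (\<Sum>\<^sub>u k. v k * (\<Sum>\<^sub>u m. Ric k m * v m)) - (\<Sum>\<^sub>u a b. up2 \<iota> a b * \<iota> a b)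
      + 4 * (\<Sum>\<^sub>u k. v k * (\<Sum>\<^sub>u j. \<partial> j F * hessian_m F j k))"
    unfolding s3 .
  have "6 * div0 Z = (\<Sum>\<^sub>u k. v k * (6 * divm pm k)) + 6 * (\<Sum>\<^sub>u i k. pm i k * hessian_m F k i)"
    unfolding Z_def[abs_def] div0_contract_gradient by (simp add: distrib_left sum_distrib_left mult.left_commute)
  also have "(\<Sum>\<^sub>u k. v k * (6 * divm pm k)) = (\<Sum>\<^sub>u i. v i * \<partial> i S) + 24 * (\<Sum>\<^sub>u k. v k * (\<Sum>\<^sub>u j. \<partial> j F * hessian_m F j k))
     - 6 * (\<Sum>\<^sub>u a b. Bu a b * \<iota> a b) + 24 * (\<Sum>\<^sub>u k. v k * (\<Sum>\<^sub>u m. Ric k m * v m))"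
    unfolding d s1[symmetric]
    by (simp add: distrib_left right_diff_distrib sum.distrib sum_subtractf sum_distrib_left ac_simps)
  finally show ?thesis
    unfolding divF_def FZ by (simp add: up2_q left_diff_distrib sum_subtractf algebra_simps)
qed

lemma Hu_\<delta>H: "(\<Sum>\<^sub>u i a b. Hu i a b * \<delta> (H i a b)) = 3 * (\<Sum>\<^sub>u i a b. Hu i a b * \<partial> i (Bl a b))"
proof -
  have 1: "(\<Sum>\<^sub>u i a b. Hu i a b * \<partial> a (Bl b i)) = (\<Sum>\<^sub>u i a b. Hu i a b * \<partial> i (Bl a b))"
    by (rule trans[OF sum3_231]) (simp add: Hu_cyc[symmetric])
  have 2: "(\<Sum>\<^sub>u i a b. Hu i a b * \<partial> b (Bl i a)) = (\<Sum>\<^sub>u i a b. Hu i a b * \<partial> i (Bl a b))"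
    by (rule trans[OF sum3_312]) (subst Hu_cyc[symmetric], rule refl)
  show ?thesis
    by (simp add: flow_H distrib_left sum.distrib 1 2)
qed

text \<open>Three cancellations occur: \<open>lapF L\<close> between \<open>Y_eq\<close> and
  \<open>\<omega>_F\<close>, \<open>pm\<close> against the Hessian between \<open>kp\<close> and
  \<open>divF_Z\<close>, and \<open>Hu\<close> against the derivative of \<open>Bl\<close> between
  \<open>Hu_\<delta>H\<close> and \<open>divF_U\<close>. The pairings of q with \<open>Bl\<close>
  and with \<open>\<iota>\<close> then form |q|^2.\<close>

theorem \<delta>_S:
  "2 * \<delta> S = - 2 * lapF S + 2 * (\<Sum>\<^sub>u i. v i * \<partial> i S) + 12 * (\<Sum>\<^sub>u a b. up2 q a b * q a b)
     + 3 * (\<Sum>\<^sub>u i k. pm i k * pm k i)"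
proof -
  have "12 * divF Y = divF (\<lambda>i. 12 * Y i)"
    by (simp add: divF_scale)
  also have "\<dots> = lapF S - 24 * lapF L - 6 * divF Z - 6 * divF U"
    unfolding Y_eq divF_diff divF_scale lapF_def by simp
  finally have Yd: "12 * divF Y = lapF S - 24 * lapF L - 6 * divF Z - 6 * divF U" .
  have "2 * (\<Sum>\<^sub>u i j. \<kappa> i j * p i j) = (\<Sum>\<^sub>u i j. (2 * \<kappa> i j) * p i j)"
    by (simp add: sum_distrib_left mult.assoc)
  also have "\<dots> = (\<Sum>\<^sub>u i j k. e i k * (K $ k $ j * p j i))"
    unfolding \<kappa>_eq by (simp add: sum_distrib_right p_sym mult.assoc)
  also have "\<dots> = (\<Sum>\<^sub>u i k. e i k * pm k i)"
    by (rule trans[OF sum3_132]) (simp add: pm_eq sum_distrib_left)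
  also have "\<dots> = (\<Sum>\<^sub>u i k. pm i k * pm k i) - 4 * (\<Sum>\<^sub>u i k. hessian_m F i k * pm k i)"
    by (simp add: pm_def[of _ _] algebra_simps sum.distrib sum_subtractf sum_distrib_left)
  also have "(\<Sum>\<^sub>u i k. hessian_m F i k * pm k i) = (\<Sum>\<^sub>u i k. pm i k * hessian_m F k i)"
    by (rule trans[OF sum.swap]) (simp add: mult.commute)
  finally have kp: "2 * (\<Sum>\<^sub>u i j. \<kappa> i j * p i j) = (\<Sum>\<^sub>u i k. pm i k * pm k i) - 4 * (\<Sum>\<^sub>u i k. pm i k * hessian_m F k i)" .
  have lc: "lapF c = 0"
    by (simp add: lapF_eq gradient_def c_const div0_def)
  have qq: "(\<Sum>\<^sub>u a b. up2 q a b * q a b) = (\<Sum>\<^sub>u a b. up2 q a b * Bl a b) - (\<Sum>\<^sub>u a b. up2 q a b * \<iota> a b)"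
    by (simp add: q_def[of _ _] right_diff_distrib sum_subtractf)
  have "2 * \<delta> S = - 2 * (12 * divF Y) + 3 * (2 * (\<Sum>\<^sub>u i j. \<kappa> i j * p i j))
     - 4 * (\<Sum>\<^sub>u i a b. Hu i a b * \<delta> (H i a b)) + 24 * lapF (\<omega> + 2 * \<delta> F)"
    unfolding variation_S by (simp add: algebra_simps)
  also have "\<dots> = - 2 * lapF S + 48 * lapF L + 2 * (6 * divF Z) + 12 * divF U
     + 3 * (\<Sum>\<^sub>u i k. pm i k * pm k i) - 12 * (\<Sum>\<^sub>u i k. pm i k * hessian_m F k i)
     - 12 * (\<Sum>\<^sub>u i a b. Hu i a b * \<partial> i (Bl a b)) - 48 * lapF L"
    unfolding Yd kp Hu_\<delta>H \<omega>_F lapF_diff lapF_scale lc by (simp add: algebra_simps)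
  also have "\<dots> = - 2 * lapF S + 2 * (\<Sum>\<^sub>u i. v i * \<partial> i S) + 12 * (\<Sum>\<^sub>u a b. up2 q a b * q a b)
     + 3 * (\<Sum>\<^sub>u i k. pm i k * pm k i)"
    unfolding divF_Z divF_U qq by (simp add: algebra_simps)
  finally show ?thesis .
qed

end

section \<open>Traces, norms and product rules for the entropy computation\<close>

lemma three_cancel: "3 * a = 3 * b \<Longrightarrow> a = (b :: 'r::real_algebra_1)"
proof -
  assume "3 * a = 3 * b"
  moreover have "3 * x = (3 :: real) *\<^sub>R x" for x :: 'r
    by (simp add: scaleR_conv_of_real)
  ultimately show ?thesis by simp
qed

context metric_ring begin

lemma Rm_nth: "Rm i j $ l $ k = \<partial> i (\<Gamma> l j k) - \<partial> j (\<Gamma> l i k) + (\<Sum>\<^sub>u m. \<Gamma> m j k * \<Gamma> l i m - \<Gamma> m i k * \<Gamma> l j m)"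
  by (simp add: Rm_def matrix_matrix_mult_def sum_subtractf mult.commute)

lemma scalar_eq: "scalar = (\<Sum>\<^sub>u i j. K $ i $ j * Ric i j)"
  by (simp add: scalar_def Rcm_def K_comm mult.commute)

lemma lap_trace: "(\<Sum>\<^sub>u i j. K $ i $ j * hessian a i j) = div0 (gradient a)"
  by (simp add: lap_eq[symmetric] hessian_m_def hessian_sym)

lemma inner_gradient: "(\<Sum>\<^sub>u i j. G $ i $ j * gradient a i * gradient b j) = (\<Sum>\<^sub>u i. gradient a i * \<partial> i b)"
proof -
  have "(\<Sum>\<^sub>u j. G $ i $ j * gradient b j) = \<partial> i b" for i
  proof -
    have "(\<Sum>\<^sub>u j. G $ i $ j * gradient b j) = (\<Sum>\<^sub>u k. (\<Sum>\<^sub>u j. G $ i $ j * K $ j $ k) * \<partial> k b)"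
      unfolding gradient_def sum_distrib_left sum_distrib_right by (rule trans[OF sum.swap]) (simp add: ac_simps)
    then show ?thesis
      by (simp add: GK_comp if_distrib[of "\<lambda>x. x * _"] cong: if_cong)
  qed
  moreover have "(\<Sum>\<^sub>u i j. G $ i $ j * gradient a i * gradient b j) = (\<Sum>\<^sub>u i. gradient a i * (\<Sum>\<^sub>u j. G $ i $ j * gradient b j))"
    by (simp add: sum_distrib_left ac_simps)
  ultimately show ?thesis
    by simp
qed

definition "inner2 A B = (\<Sum>\<^sub>u a b. up2 A a b * B a b)"

lemma inner2_eq: "inner2 A B = (\<Sum>\<^sub>u i j k l. K $ i $ k * K $ j $ l * B i j * A k l)"
  by (simp add: inner2_def up2_def sum_distrib_left sum_distrib_right ac_simps)

lemma inner2_commute: "inner2 A B = inner2 B A"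
  unfolding inner2_def by (subst up2_pair) (simp add: mult.commute)

lemma inner2_add_right: "inner2 A (\<lambda>i j. B i j + C i j) = inner2 A B + inner2 A C"
  and inner2_diff_right: "inner2 A (\<lambda>i j. B i j - C i j) = inner2 A B - inner2 A C"
  and inner2_scale_right: "inner2 A (\<lambda>i j. r * B i j) = r * inner2 A B"
  by (simp_all add: inner2_def distrib_left right_diff_distrib sum.distrib sum_subtractf sum_distrib_left ac_simps)

lemma inner2_add_left: "inner2 (\<lambda>i j. B i j + C i j) A = inner2 B A + inner2 C A"
  and inner2_diff_left: "inner2 (\<lambda>i j. B i j - C i j) A = inner2 B A - inner2 C A"
  and inner2_scale_left: "inner2 (\<lambda>i j. r * B i j) A = r * inner2 B A"
  by (simp_all only: inner2_commute[of _ A] inner2_add_right inner2_diff_right inner2_scale_right)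

lemma inner2_G: "inner2 A (\<lambda>i j. G $ i $ j) = (\<Sum>\<^sub>u i j. K $ i $ j * A i j)"
proof -
  have "up2 (\<lambda>i j. G $ i $ j) a b = K $ a $ b" for a b
  proof -
    have "up2 (\<lambda>i j. G $ i $ j) a b = (\<Sum>\<^sub>u p. K $ a $ p * (\<Sum>\<^sub>u q. G $ p $ q * K $ q $ b))"
      by (simp add: up2_def K_comm mult.commute)
    then show ?thesis
      by (simp add: GK_comp if_distrib[of "\<lambda>x. _ * x"] cong: if_cong)
  qed
  then show ?thesis
    by (subst inner2_commute) (simp add: inner2_def)
qed

lemma inner2_G_G: "inner2 (\<lambda>i j. G $ i $ j) (\<lambda>i j. G $ i $ j) = of_nat CARD('n)"
proof -
  have "(\<Sum>\<^sub>u j. K $ i $ j * G $ i $ j) = 1" for i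
    using KG_comp[of i i] by (simp add: G_comm[of i])
  then show ?thesis by (simp add: inner2_G)
qed

lemma inner2_antisym_sym:
  assumes "\<And>i j. A i j = - A j i" "\<And>i j. B i j = B j i"
  shows "inner2 A B = 0"
proof -
  have "up2 B i j = up2 B j i" for i j
    unfolding up2_def sum_distrib_left by (rule trans[OF sum.swap]) (simp add: assms(2) ac_simps)
  then have "(\<Sum>\<^sub>u i j. A i j * up2 B i j) = 0"
    by (intro sum_antisym_sym assms(1))
  then show ?thesis
    by (simp add: inner2_def up2_pair)
qed

lemma gradient_mult: "gradient (a * b) i = a * gradient b i + b * gradient a i"
  by (simp add: gradient_def sum.distrib sum_distrib_left distrib_left ac_simps)

lemma div0_mult: "div0 (\<lambda>i. a * V i) = a * div0 V + (\<Sum>\<^sub>u i. V i * \<partial> i a)"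
  by (simp add: div0_def sum.distrib sum_distrib_left distrib_left ac_simps)

definition "grad_inner a b = (\<Sum>\<^sub>u i. gradient a i * \<partial> i b)"

lemma grad_inner_commute: "grad_inner a b = grad_inner b a"
  unfolding grad_inner_def by (rule gradient_pair)

lemma grad_inner_mult: "grad_inner a (b * d) = b * grad_inner a d + d * grad_inner a b"
  by (simp add: grad_inner_def sum.distrib sum_distrib_left distrib_left ac_simps)

lemma grad_inner_add: "grad_inner a (b + d) = grad_inner a b + grad_inner a d"
  and grad_inner_diff: "grad_inner a (b - d) = grad_inner a b - grad_inner a d"
  by (simp_all add: grad_inner_def sum.distrib sum_subtractf distrib_left right_diff_distrib)

definition "laplace a = div0 (gradient a)"

lemma laplace_add: "laplace (a + b) = laplace a + laplace b"
  and laplace_diff: "laplace (a - b) = laplace a - laplace b"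
  unfolding laplace_def gradient_add[abs_def] gradient_diff[abs_def] by (simp_all add: div0_add div0_diff)

lemma laplace_mult: "laplace (a * b) = a * laplace b + b * laplace a + 2 * grad_inner a b"
  unfolding laplace_def gradient_mult[abs_def] div0_add div0_mult
  by (simp add: grad_inner_commute[of a b, unfolded grad_inner_def] grad_inner_def)

lemma const_simps:
  assumes "\<And>i. \<partial> i a = 0"
  shows "laplace a = 0" "grad_inner b a = 0"
  using assms by (simp_all add: laplace_def gradient_def div0_def grad_inner_def)

end

context three_form_ring begin

lemma H2_eq: "H2 i j = (\<Sum>\<^sub>u k l m n. K $ k $ l * K $ m $ n * H i k m * H j l n)"
proof -
  have "H2 i j = (\<Sum>\<^sub>u l n k m. K $ k $ l * K $ m $ n * H i k m * H j l n)"
    by (simp add: H2_def Hp_def up2_def sum_distrib_left sum_distrib_right K_comm ac_simps)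
  also have "\<dots> = (\<Sum>\<^sub>u l k n m. K $ k $ l * K $ m $ n * H i k m * H j l n)"
    by (intro sum.cong refl sum.swap)
  also have "\<dots> = (\<Sum>\<^sub>u k l m n. K $ k $ l * K $ m $ n * H i k m * H j l n)"
    by (rule trans[OF sum.swap], intro sum.cong refl sum.swap)
  finally show ?thesis .
qed

lemma nH_full: "nH = (\<Sum>\<^sub>u i j k l m n. K $ i $ l * K $ j $ m * K $ k $ n * H i j k * H l m n)"
  by (simp add: nH_eq Hu_eq sum_distrib_left sum_distrib_right ac_simps)

lemma cH_antisym: "cH l i j k = - cH l i k j"
  unfolding cH_def by (subst (1 2 3 4) H23)
    (simp add: sum_negf sum.distrib sum_subtractf algebra_simps)

lemma Bl_antisym: "Bl j k = - Bl k j"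
  unfolding Bl_def by (subst cH_antisym) (simp add: sum_negf)

end

context weighted_ring begin

lemma lapF_laplace: "lapF a = laplace a - grad_inner F a"
  by (simp add: lapF_eq laplace_def grad_inner_def)

lemma L_laplace: "L = laplace F - grad_inner F F"
  by (simp add: L_def lap_def laplace_def grad_inner_def grad_sq_def)

lemma S_laplace: "S = 12 * scalar - nH + 24 * laplace F - 12 * grad_inner F F"
  by (simp add: S_def lap_def laplace_def grad_inner_def grad_sq_def)

lemma trace_p: "(\<Sum>\<^sub>u i j. K $ i $ j * p i j) = 4 * scalar - nH + 4 * laplace F"
proof -
  have "(\<Sum>\<^sub>u i j. K $ i $ j * H2 i j) = nH"
    by (simp add: nH_def H2m_def H2_sym)
  then show ?thesis
    by (simp add: p_def scalar_eq lap_trace[symmetric] laplace_def sum.distrib sum_subtractf sum_distrib_left algebra_simps)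
qed

end

context flow_ring begin

lemma q_antisym: "q i j = - q j i"
  unfolding q_def \<iota>_def by (subst Bl_antisym, subst H23) (simp add: sum_negf)

lemma inner2_p_p: "inner2 p p = (\<Sum>\<^sub>u i k. pm i k * pm k i)"
proof -
  have "(\<Sum>\<^sub>u i k. pm i k * pm k i) = (\<Sum>\<^sub>u i k l m. K $ i $ l * p l k * (K $ k $ m * p m i))"
    by (simp add: pm_eq sum_product)
  also have "\<dots> = (\<Sum>\<^sub>u i m l k. K $ i $ l * p l k * (K $ k $ m * p m i))"
    by (intro sum.cong refl sum3_321)
  finally show ?thesis
    unfolding inner2_eq by (simp add: p_sym K_comm ac_simps)
qed

end

section \<open>The conjugate heat operator\<close>

text \<open>\<open>w\<close> is 1/u. The relations \<open>D_u\<close> and \<open>\<delta>_u\<close>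
  encode u = (4 \<pi> \<tau>)^(-n/2) e^-f: as \<tau> decreases at unit rate, the time derivative of
  the prefactor contributes u n/2\<tau>, which is \<open>u * c\<close>.\<close>

locale conjugate_ring = three_form_ring D G K \<Gamma> H
  for D :: "'n::finite option \<Rightarrow> 'r::{comm_ring_1,real_algebra_1} \<Rightarrow> 'r" and G K \<Gamma> H +
  fixes f \<phi> u w \<tau> c :: 'r
  assumes flow_G: "2 * D None (G $ i $ j) = H2 i j - 4 * Ric i j"
    and flow_H: "D None (H i j k) = D (Some i) (Bl j k) + D (Some j) (Bl k i) + D (Some k) (Bl i j)"
    and c_const: "D (Some i) c = 0"
    and \<tau>_const: "D (Some i) \<tau> = 0" and \<delta>_\<tau>: "D None \<tau> = - 1"
    and \<tau>_c: "2 * (\<tau> * c) = of_nat CARD('n)"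
    and u_w: "u * w = 1"
    and D_u: "D (Some i) u = - (u * D (Some i) f)" and \<delta>_u: "D None u = u * (c - D None f)"
    and dilaton: "6 * D None \<phi> = 6 * laplace \<phi> + nH"
    and u_eq: "12 * (2 * grad_inner \<phi> u - D None u - laplace u) + (12 * scalar - nH + 24 * laplace \<phi> - 12 * grad_inner \<phi> \<phi>) * u = 0"
begin

text \<open>Twelve times \<open>\<box>\<^sup>*\<^sub>\<phi>\<close>.\<close>

definition "op a = 12 * (2 * grad_inner \<phi> a - \<delta> a - laplace a) + (12 * scalar - nH + 24 * laplace \<phi> - 12 * grad_inner \<phi> \<phi>) * a"

lemma gradient_u: "gradient u i = - (u * gradient f i)"
  by (simp add: gradient_def D_u sum_negf sum_distrib_left ac_simps)

lemma grad_inner_u: "grad_inner a u = - (u * grad_inner a f)"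
  by (simp add: grad_inner_def D_u sum_negf sum_distrib_left ac_simps)

lemma laplace_u: "laplace u = u * (grad_inner f f - laplace f)"
proof -
  have "laplace u = - div0 (\<lambda>i. u * gradient f i)"
    unfolding laplace_def gradient_u[abs_def] by (rule div0_minus)
  also have "\<dots> = - (u * laplace f) - grad_inner f u"
    by (simp add: div0_mult laplace_def grad_inner_def)
  finally show ?thesis
    by (simp add: grad_inner_u right_diff_distrib)
qed

lemma u_cancel: "u * a = u * b \<Longrightarrow> a = b"
  by (metis mult.assoc mult.commute mult_1 u_w)

lemma \<delta>_f: "12 * \<delta> f = 12 * c - 12 * laplace f + 12 * grad_inner f f + 24 * grad_inner \<phi> f - 12 * scalar + nH - 24 * laplace \<phi> + 12 * grad_inner \<phi> \<phi>"
proof (rule u_cancel)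
  have "u * (12 * \<delta> f - (12 * c - 12 * laplace f + 12 * grad_inner f f + 24 * grad_inner \<phi> f - 12 * scalar + nH - 24 * laplace \<phi> + 12 * grad_inner \<phi> \<phi>)) = 0"
    using u_eq unfolding grad_inner_u laplace_u \<delta>_u by (simp add: algebra_simps)
  then show "u * (12 * \<delta> f) = u * (12 * c - 12 * laplace f + 12 * grad_inner f f + 24 * grad_inner \<phi> f - 12 * scalar + nH - 24 * laplace \<phi> + 12 * grad_inner \<phi> \<phi>)"
    by (simp add: right_diff_distrib)
qed

text \<open>Adding twice the dilaton equation to \<open>\<delta>_f\<close> changes -24
  \<Delta>\<phi> into -12 \<Delta>\<phi> and |H|^2 into 3 |H|^2, so f and \<phi> enter only through
  their sum.\<close>

lemma flow_F: "4 * \<delta> (f + \<phi>) = 4 * c - 4 * (laplace (f + \<phi>) - grad_inner (f + \<phi>) (f + \<phi>)) - 4 * scalar + nH"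
proof (rule three_cancel)
  have i: "grad_inner (f + \<phi>) (f + \<phi>) = grad_inner f f + 2 * grad_inner \<phi> f + grad_inner \<phi> \<phi>"
    unfolding grad_inner_add by (subst (1 2) grad_inner_commute) (simp add: grad_inner_add grad_inner_commute[of f \<phi>] algebra_simps)
  have "3 * (4 * \<delta> (f + \<phi>)) = 12 * \<delta> f + 2 * (6 * \<delta> \<phi>)"
    by (simp add: algebra_simps)
  then show "3 * (4 * \<delta> (f + \<phi>)) = 3 * (4 * c - 4 * (laplace (f + \<phi>) - grad_inner (f + \<phi>) (f + \<phi>)) - 4 * scalar + nH)"
    unfolding \<delta>_f dilaton i laplace_add by (simp add: algebra_simps)
qed

sublocale weighted_ring D G K \<Gamma> H "f + \<phi>" ..

sublocale flow_ring D G K \<Gamma> H "f + \<phi>" c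
  by unfold_locales (use flow_G flow_H c_const flow_F in \<open>simp_all only: L_laplace\<close>)

lemma op_mult: "op (h * u) = 12 * (u * (grad_inner (f + \<phi>) h - \<delta> h - lapF h))"
proof -
  have 1: "op (h * u) = h * op u + 12 * (u * (2 * grad_inner \<phi> h - \<delta> h - laplace h)) - 24 * grad_inner h u"
    by (simp add: op_def grad_inner_mult laplace_mult algebra_simps)
  have 2: "op u = 0"
    using u_eq by (simp add: op_def)
  have 3: "grad_inner (f + \<phi>) h = grad_inner \<phi> h + grad_inner h f"
    by (simp add: grad_inner_commute[of _ h] grad_inner_add)
  show ?thesis
    unfolding 1 2 grad_inner_u lapF_laplace 3 by (simp add: algebra_simps)
qed

lemma op_add: "op (a + b) = op a + op b"
  by (simp add: op_def grad_inner_add laplace_add algebra_simps)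

text \<open>Here \<open>B\<close> is 4\<tau> times the weighted Ricci tensor minus g/2\<tau>. The
  norm of \<open>B\<close> expands into |p|^2, |q|^2, a trace term and n; the first two come from
  \<open>\<delta>_S\<close>, the trace from the first-order terms in \<tau>, and n from
  \<open>c\<close>.\<close>

theorem op_entropy:
  assumes W: "12 * W = \<tau> * S + 12 * (f + \<phi>) - 12 * of_nat CARD('n)"
    and \<psi>: "op (\<psi> * u) = - 2 * nH * u"
  defines "B \<equiv> \<lambda>i j. \<tau> * p i j + 2 * \<tau> * q i j - 2 * G $ i $ j"
  shows "2 * \<tau> * op ((W + \<psi>) * u) = - 3 * inner2 B B * u"
proof -
  let ?F = "f + \<phi>"
  let ?G = "\<lambda>i j. G $ i $ j"
  have \<tau>': "laplace \<tau> = 0" "grad_inner b \<tau> = 0" "grad_inner \<tau> b = 0" for b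
    using const_simps[of \<tau>] \<tau>_const by (simp_all add: grad_inner_commute[of \<tau>])
  have 12: "laplace 12 = 0" "grad_inner b 12 = 0" "grad_inner 12 b = 0" for b
    using const_simps[of 12] by (simp_all add: grad_inner_commute[of 12])
  have n': "laplace (of_nat k) = 0" "grad_inner b (of_nat k) = 0" for b k
    using const_simps[of "of_nat k"] by simp_all
  have nm: "laplace (12 * a) = 12 * laplace a" "grad_inner b (12 * a) = 12 * grad_inner b a" for a b
    using laplace_mult[of 12 a] grad_inner_mult[of b 12 a] 12 by simp_all
  have lapW: "12 * lapF W = \<tau> * lapF S + 12 * L - 0"
  proof -
    have "laplace (12 * W) = \<tau> * laplace S + 12 * laplace ?F" "grad_inner ?F (12 * W) = \<tau> * grad_inner ?F S + 12 * grad_inner ?F ?F"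
      unfolding W using n' \<tau>' 12 by (simp_all only: laplace_diff laplace_add laplace_mult grad_inner_diff grad_inner_add grad_inner_mult nm) simp_all
    then show ?thesis
      unfolding nm lapF_laplace L_laplace by (simp add: algebra_simps)
  qed
  have igW: "12 * grad_inner ?F W = \<tau> * grad_inner ?F S + 12 * grad_inner ?F ?F"
    unfolding nm[symmetric] W using n' \<tau>' 12 by (simp only: grad_inner_diff grad_inner_add grad_inner_mult nm) simp
  have \<delta>W: "12 * \<delta> W = \<tau> * \<delta> S - S + 12 * \<delta> ?F"
  proof -
    have "\<delta> (12 * W) = \<tau> * \<delta> S - S + 12 * \<delta> ?F"
      unfolding W by (simp add: \<delta>_\<tau>)
    then show ?thesis by simp
  qed
  have "2 * op ((W + \<psi>) * u) = 2 * op (W * u) + 2 * op (\<psi> * u)"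
    by (simp add: distrib_right op_add distrib_left)
  also have "2 * op (W * u) = u * (2 * (12 * grad_inner ?F W) - 2 * (12 * \<delta> W) - 2 * (12 * lapF W))"
    unfolding op_mult by (simp add: algebra_simps)
  also have "\<dots> = u * (\<tau> * (2 * grad_inner ?F S - 2 * \<delta> S - 2 * lapF S) + 2 * S + 24 * grad_inner ?F ?F - 6 * (4 * \<delta> ?F) - 24 * L)"
    unfolding lapW igW \<delta>W by (simp add: algebra_simps)
  also have "2 * grad_inner ?F S - 2 * \<delta> S - 2 * lapF S = - 12 * inner2 q q - 3 * inner2 p p"
    unfolding \<delta>_S inner2_p_p by (simp add: grad_inner_def inner2_def)
  \<comment> \<open>The multiples of |H|^2 are -2 from \<open>S\<close>, -6 from the evolution of F
    and -4 from \<psi>. Their sum -12 is what makes the scalar terms a multiple of the trace of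
    \<open>p\<close>.\<close>
  also have "u * (\<tau> * (- 12 * inner2 q q - 3 * inner2 p p) + 2 * S + 24 * grad_inner ?F ?F - 6 * (4 * \<delta> ?F) - 24 * L) + 2 * op (\<psi> * u)
      = u * (12 * (4 * scalar - nH + 4 * laplace ?F) - 24 * c - 12 * (\<tau> * inner2 q q) - 3 * (\<tau> * inner2 p p))"
    unfolding \<psi> flow_F S_laplace L_laplace by (simp add: algebra_simps)
  finally have E: "2 * op ((W + \<psi>) * u)
      = u * (12 * (4 * scalar - nH + 4 * laplace ?F) - 24 * c - 12 * (\<tau> * inner2 q q) - 3 * (\<tau> * inner2 p p))" .
  have "2 * \<tau> * op ((W + \<psi>) * u) = \<tau> * (2 * op ((W + \<psi>) * u))"
    by simp
  also have "\<dots> = u * (12 * (\<tau> * (4 * scalar - nH + 4 * laplace ?F)) - 12 * (2 * (\<tau> * c)) - 12 * (\<tau> * \<tau> * inner2 q q) - 3 * (\<tau> * \<tau> * inner2 p p))"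
    unfolding E by (simp add: algebra_simps)
  finally have E2: "2 * \<tau> * op ((W + \<psi>) * u)
      = u * (12 * (\<tau> * (4 * scalar - nH + 4 * laplace ?F)) - 12 * (2 * (\<tau> * c)) - 12 * (\<tau> * \<tau> * inner2 q q) - 3 * (\<tau> * \<tau> * inner2 p p))" .
  \<comment> \<open>Mixed products with q vanish because p and the metric are symmetric; the product
    of p with the metric is \<open>trace_p\<close>.\<close>
  have BB: "inner2 B B = \<tau> * \<tau> * inner2 p p + 4 * (\<tau> * \<tau> * inner2 q q) + 4 * of_nat CARD('n) - 4 * (\<tau> * (4 * scalar - nH + 4 * laplace ?F))"
  proof -
    have z: "inner2 q p = 0" "inner2 p q = 0" "inner2 q ?G = 0" "inner2 ?G q = 0"
      using inner2_antisym_sym[OF q_antisym p_sym] inner2_antisym_sym[OF q_antisym G_comm]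
      by (simp_all only: inner2_commute[of p q] inner2_commute[of ?G q])
    have g: "inner2 p ?G = 4 * scalar - nH + 4 * laplace ?F" "inner2 ?G p = 4 * scalar - nH + 4 * laplace ?F"
      using inner2_G[of p] trace_p by (simp_all add: inner2_commute[of ?G p])
    have "inner2 B B = \<tau> * (\<tau> * inner2 p p + 2 * \<tau> * inner2 p q - 2 * inner2 p ?G) + 2 * \<tau> * (\<tau> * inner2 q p + 2 * \<tau> * inner2 q q - 2 * inner2 q ?G)
        - 2 * (\<tau> * inner2 ?G p + 2 * \<tau> * inner2 ?G q - 2 * inner2 ?G ?G)"
      unfolding B_def inner2_diff_left inner2_add_left inner2_scale_left inner2_diff_right inner2_add_right inner2_scale_right ..
    then show ?thesis
      unfolding z g inner2_G_G by (simp add: algebra_simps)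
  qed
  have "u * (12 * (\<tau> * T) - 12 * N - 12 * (\<tau> * \<tau> * Q) - 3 * (\<tau> * \<tau> * P))
      = - 3 * (\<tau> * \<tau> * P + 4 * (\<tau> * \<tau> * Q) + 4 * N - 4 * (\<tau> * T)) * u" for T N Q P
    by (simp add: algebra_simps)
  then show ?thesis
    unfolding E2 BB \<tau>_c .
qed

end

section \<open>Smooth functions\<close>

text \<open>Derivatives within a thick set are unique.\<close>

definition thick :: "'a::euclidean_space set \<Rightarrow> bool" where
  "thick S \<longleftrightarrow> (\<forall>x\<in>S. \<forall>b\<in>Basis. \<forall>e>0. \<exists>d. 0 < \<bar>d\<bar> \<and> \<bar>d\<bar> < e \<and> x + d *\<^sub>R b \<in> S)"

lemma thick_open: "open S \<Longrightarrow> thick S"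
proof -
  assume S: "open S"
  have "\<exists>d. 0 < \<bar>d\<bar> \<and> \<bar>d\<bar> < e \<and> x + d *\<^sub>R b \<in> S" if x: "x \<in> S" "b \<in> Basis" "e > 0" for x b and e :: real
  proof -
    obtain r where r: "r > 0" "ball x r \<subseteq> S"
      using S x openE by blast
    then have "x + (min e r / 2) *\<^sub>R b \<in> S"
      using x by (intro subsetD[OF r(2)]) (auto simp: dist_norm)
    then show ?thesis using x r by (intro exI[of _ "min e r / 2"]) auto
  qed
  then show ?thesis by (auto simp: thick_def)
qed

lemma nondegenerate_interval_approx:
  assumes "nondegenerate_interval I" "t \<in> I" "e > 0"
  shows "\<exists>d. 0 < \<bar>d\<bar> \<and> \<bar>d\<bar> < e \<and> t + d \<in> I"
proof -
  obtain a b where ab: "a \<in> I" "b \<in> I" "a < b"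
    using assms by (auto simp: nondegenerate_interval_def)
  have int: "is_interval I" using assms by (simp add: nondegenerate_interval_def)
  show ?thesis
  proof (cases "t < b")
    case True
    then have "t + min (e / 2) (b - t) \<in> I"
      using assms ab by (intro mem_is_interval_1_I[OF int assms(2) ab(2)]) auto
    then show ?thesis using True assms by (intro exI[of _ "min (e / 2) (b - t)"]) auto
  next
    case False
    then have "t - min (e / 2) (t - a) \<in> I"
      using assms ab by (intro mem_is_interval_1_I[OF int ab(1) assms(2)]) auto
    then show ?thesis using False assms ab by (intro exI[of _ "- min (e / 2) (t - a)"]) auto
  qed
qed

lemma thick_cylinder:
  fixes V :: "(real ^ 'n::finite) set"
  assumes I: "nondegenerate_interval I" and V: "open V"
  shows "thick (I \<times> V)"
  unfolding thick_def
proof (intro ballI allI impI)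
  fix z b and e :: real
  assume z: "z \<in> I \<times> V" and b: "(b :: real \<times> (real ^ 'n)) \<in> Basis" and e: "e > 0"
  from b consider "b = (1, 0)" | c where "b = (0, c)" "c \<in> Basis"
    by (auto simp: Basis_prod_def)
  then show "\<exists>d. 0 < \<bar>d\<bar> \<and> \<bar>d\<bar> < e \<and> z + d *\<^sub>R b \<in> I \<times> V"
  proof cases
    case 1
    then show ?thesis
      using nondegenerate_interval_approx[OF I _ e, of "fst z"] z by (cases z) auto
  next
    case 2
    then show ?thesis
      using thick_open[OF V] z e by (cases z) (auto simp: thick_def)
  qed
qed

lemma frechet_derivative_within_eq:
  assumes "thick S" "x \<in> S" "(F has_derivative F') (at x within S)"
  shows "frechet_derivative F (at x within S) = F'"
proof -
  have "(F has_derivative frechet_derivative F (at x within S)) (at x within S)"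
    using assms(3) frechet_derivative_works differentiable_def by blast
  then show ?thesis
    by (rule frechet_derivative_unique_within[OF _ assms(3)])
       (use assms in \<open>auto simp: thick_def\<close>)
qed

lemma frechet_derivative_within_cong:
  assumes "x \<in> S" "\<And>y. y \<in> S \<Longrightarrow> F y = G y"
  shows "frechet_derivative F (at x within S) = frechet_derivative G (at x within S)"
proof -
  have "(F has_derivative F') (at x within S) \<longleftrightarrow> (G has_derivative F') (at x within S)" for F'
    using assms has_derivative_transform[of x S G F F'] has_derivative_transform[of x S F G F'] by auto
  then show ?thesis by (simp add: frechet_derivative_def)
qed

lemma C_k_on_cong:
  assumes "\<And>y. y \<in> S \<Longrightarrow> F y = G y"
  shows "C_k_on k S F \<longleftrightarrow> C_k_on k S G"
  using assms
proof (induction k arbitrary: F G)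
  case 0
  then show ?case by (simp cong: continuous_on_cong)
next
  case (Suc k)
  have "F differentiable_on S \<longleftrightarrow> G differentiable_on S"
    unfolding differentiable_on_def differentiable_def
    using has_derivative_transform[of _ S G F] has_derivative_transform[of _ S F G] Suc.prems by (metis (no_types))
  moreover have "C_k_on k S (\<lambda>x. frechet_derivative F (at x within S) v) \<longleftrightarrow>
      C_k_on k S (\<lambda>x. frechet_derivative G (at x within S) v)" for v
    by (rule Suc.IH) (simp add: frechet_derivative_within_cong[of _ S F G] Suc.prems)
  ultimately show ?case by simp
qed

lemma C_k_on_le_Suc: "C_k_on (Suc k) S F \<Longrightarrow> C_k_on k S F"
proof (induction k arbitrary: F)
  case 0
  then show ?case by (simp add: differentiable_imp_continuous_on)
next
  case (Suc k)
  then show ?case by (metis C_k_on.simps(2))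
qed

text \<open>Uniqueness on thick sets allows any derivative found by the usual rules to replace
  \<open>frechet_derivative\<close>; the closure properties below rest on this.\<close>

lemma C_k_on_SucI:
  assumes "thick S" "\<And>x. x \<in> S \<Longrightarrow> (F has_derivative F' x) (at x within S)"
    "\<And>v. C_k_on k S (\<lambda>x. F' x v)"
  shows "C_k_on (Suc k) S F"
proof -
  have "C_k_on k S (\<lambda>x. frechet_derivative F (at x within S) v)" for v
    using assms(3)[of v] C_k_on_cong[of S "\<lambda>x. frechet_derivative F (at x within S) v" "\<lambda>x. F' x v" k]
      frechet_derivative_within_eq[OF assms(1) _ assms(2)] by auto
  then show ?thesis
    using assms(2) by (auto simp: differentiable_on_def differentiable_def)
qed

lemma C_k_on_derivative:
  "C_k_on (Suc k) S F \<Longrightarrow> x \<in> S \<Longrightarrow> (F has_derivative frechet_derivative F (at x within S)) (at x within S)"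
  by (simp add: differentiable_on_def frechet_derivative_works)

lemma C_k_on_const:
  assumes "thick S"
  shows "C_k_on k S (\<lambda>x. c)"
proof (induction k arbitrary: c)
  case (Suc k)
  show ?case by (rule C_k_on_SucI[OF assms]) (auto intro: Suc has_derivative_const)
qed simp

lemma C_k_on_linear_comp:
  assumes "thick S" "bounded_linear L" "C_k_on k S F"
  shows "C_k_on k S (\<lambda>x. L (F x))"
  using assms(3)
proof (induction k arbitrary: F)
  case 0
  then show ?case using assms(2) by (simp add: bounded_linear.continuous_on)
next
  case (Suc k)
  show ?case
  proof (rule C_k_on_SucI[OF assms(1)])
    show "((\<lambda>x. L (F x)) has_derivative (\<lambda>v. L (frechet_derivative F (at x within S) v))) (at x within S)"
      if "x \<in> S" for x
      by (rule bounded_linear.has_derivative[OF assms(2) C_k_on_derivative[OF Suc.prems that]])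
    show "C_k_on k S (\<lambda>x. L (frechet_derivative F (at x within S) v))" for v
      using Suc by simp
  qed
qed

lemma C_k_on_add:
  assumes "thick S" "C_k_on k S F" "C_k_on k S G"
  shows "C_k_on k S (\<lambda>x. F x + G x)"
  using assms(2,3)
proof (induction k arbitrary: F G)
  case 0
  then show ?case by (simp add: continuous_on_add)
next
  case (Suc k)
  show ?case
    by (rule C_k_on_SucI[OF assms(1) has_derivative_add[OF C_k_on_derivative[OF Suc.prems(1)] C_k_on_derivative[OF Suc.prems(2)]]])
       (use Suc in auto)
qed

lemma C_k_on_mult:
  fixes F G :: "'a::euclidean_space \<Rightarrow> real"
  assumes "thick S" "C_k_on k S F" "C_k_on k S G"
  shows "C_k_on k S (\<lambda>x. F x * G x)"
  using assms(2,3)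
proof (induction k arbitrary: F G)
  case 0
  then show ?case by (simp add: continuous_on_mult)
next
  case (Suc k)
  show ?case
  proof (rule C_k_on_SucI[OF assms(1) has_derivative_mult[OF C_k_on_derivative[OF Suc.prems(1)] C_k_on_derivative[OF Suc.prems(2)]]])
    show "C_k_on k S (\<lambda>x. F x * frechet_derivative G (at x within S) v + frechet_derivative F (at x within S) v * G x)" for v
      using Suc.prems C_k_on_le_Suc by (intro C_k_on_add assms(1) Suc.IH) auto
  qed auto
qed

lemma C_k_on_inverse:
  fixes F :: "'a::euclidean_space \<Rightarrow> real"
  assumes "thick S" "C_k_on k S F" and nz: "\<And>x. x \<in> S \<Longrightarrow> F x \<noteq> 0"
  shows "C_k_on k S (\<lambda>x. inverse (F x))"
  using assms(2)
proof (induction k)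
  case 0
  then show ?case using nz by (simp add: continuous_on_inverse)
next
  case (Suc k)
  show ?case
  proof (rule C_k_on_SucI[OF assms(1) Deriv.has_derivative_inverse[OF nz C_k_on_derivative[OF Suc.prems]]])
    have "C_k_on k S (\<lambda>x. (-1) * (inverse (F x) * frechet_derivative F (at x within S) v * inverse (F x)))" for v
      using Suc C_k_on_le_Suc by (intro C_k_on_mult C_k_on_const assms(1)) auto
    then show "C_k_on k S (\<lambda>x. - (inverse (F x) * frechet_derivative F (at x within S) v * inverse (F x)))" for v
      by simp
  qed auto
qed

lemma C_k_on_ln:
  fixes F :: "'a::euclidean_space \<Rightarrow> real"
  assumes "thick S" "C_k_on k S F" and pos: "\<And>x. x \<in> S \<Longrightarrow> F x > 0"
  shows "C_k_on k S (\<lambda>x. ln (F x))"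
proof (cases k)
  case 0
  with assms show ?thesis by (force intro!: continuous_on_ln)
next
  case (Suc j)
  have 1: "((\<lambda>x. ln (F x)) has_derivative (\<lambda>v. frechet_derivative F (at x within S) v * inverse (F x))) (at x within S)"
    if "x \<in> S" for x
    using C_k_on_derivative[OF assms(2)[unfolded Suc] that] pos[OF that]
    by (auto intro!: derivative_eq_intros simp: divide_inverse)
  have "F x \<noteq> 0" if "x \<in> S" for x using pos[OF that] by simp
  moreover have "C_k_on j S F"
    using assms(2) unfolding Suc by (rule C_k_on_le_Suc)
  ultimately show ?thesis
    unfolding Suc using assms(2)[unfolded Suc]
    by (intro C_k_on_SucI[OF assms(1) 1] C_k_on_mult C_k_on_inverse assms(1)) auto
qed

lemma C_k_on_precompose_snd:
  assumes S: "thick (I \<times> V)" and V: "C_k_on k V F"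
  shows "C_k_on k (I \<times> V) (\<lambda>z. F (snd z))"
  using V
proof (induction k arbitrary: F)
  case 0
  then show ?case by (auto intro!: continuous_on_compose2[of V F] continuous_intros)
next
  case (Suc k)
  show ?case
  proof (rule C_k_on_SucI[OF S])
    show "((\<lambda>z. F (snd z)) has_derivative (\<lambda>v. frechet_derivative F (at (snd z) within V) (snd v))) (at z within I \<times> V)"
      if z: "z \<in> I \<times> V" for z
    proof -
      have "(F has_derivative frechet_derivative F (at (snd z) within V)) (at (snd z) within snd ` (I \<times> V))"
        by (rule has_derivative_subset[OF C_k_on_derivative[OF Suc.prems]]) (use z in auto)
      then show ?thesis
        by (rule has_derivative_in_compose[OF bounded_linear_imp_has_derivative[OF bounded_linear_snd]])
    qed
    show "C_k_on k (I \<times> V) (\<lambda>z. frechet_derivative F (at (snd z) within V) (snd v))" for v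
      using Suc.IH[of "\<lambda>x. frechet_derivative F (at x within V) (snd v)"] Suc.prems by simp
  qed
qed

lemma smooth_onD: "smooth_on S F \<Longrightarrow> C_k_on k S F"
  by (simp add: smooth_on_def)

lemma smooth_on_has_derivative:
  "smooth_on S F \<Longrightarrow> x \<in> S \<Longrightarrow> (F has_derivative frechet_derivative F (at x within S)) (at x within S)"
  by (rule C_k_on_derivative[OF smooth_onD])

lemma smooth_on_frechet: "smooth_on S F \<Longrightarrow> smooth_on S (\<lambda>x. frechet_derivative F (at x within S) v)"
  unfolding smooth_on_def using C_k_on.simps(2) by blast

lemma smooth_on_cong: "(\<And>y. y \<in> S \<Longrightarrow> F y = G y) \<Longrightarrow> smooth_on S F \<longleftrightarrow> smooth_on S G"
  unfolding smooth_on_def using C_k_on_cong[of S F G] by blast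

lemma smooth_on_const: "thick S \<Longrightarrow> smooth_on S (\<lambda>x. c)"
  by (simp add: smooth_on_def C_k_on_const)

lemma smooth_on_linear_comp: "thick S \<Longrightarrow> bounded_linear L \<Longrightarrow> smooth_on S F \<Longrightarrow> smooth_on S (\<lambda>x. L (F x))"
  by (simp add: smooth_on_def C_k_on_linear_comp)

lemma smooth_on_add: "thick S \<Longrightarrow> smooth_on S F \<Longrightarrow> smooth_on S G \<Longrightarrow> smooth_on S (\<lambda>x. F x + G x)"
  by (simp add: smooth_on_def C_k_on_add)

lemma smooth_on_sum: "thick S \<Longrightarrow> (\<And>i. smooth_on S (F i)) \<Longrightarrow> smooth_on S (\<lambda>x. \<Sum>i\<in>A. F i x)"
  by (induction A rule: infinite_finite_induct) (auto intro: smooth_on_const smooth_on_add)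

lemma smooth_on_linear:
  assumes "thick S" "bounded_linear L"
  shows "smooth_on S L"
  unfolding smooth_on_def
proof
  show "C_k_on k S L" for k
  proof (cases k)
    case 0
    then show ?thesis using assms by (simp add: linear_continuous_on)
  next
    case (Suc j)
    show ?thesis unfolding Suc
      by (rule C_k_on_SucI[OF assms(1) bounded_linear_imp_has_derivative[OF assms(2)] C_k_on_const[OF assms(1)]])
  qed
qed

context
  fixes F G :: "'a::euclidean_space \<Rightarrow> real"
begin

lemma smooth_on_mult: "thick S \<Longrightarrow> smooth_on S F \<Longrightarrow> smooth_on S G \<Longrightarrow> smooth_on S (\<lambda>x. F x * G x)"
  by (simp add: smooth_on_def C_k_on_mult)

lemma smooth_on_inverse:
  "thick S \<Longrightarrow> smooth_on S F \<Longrightarrow> (\<And>x. x \<in> S \<Longrightarrow> F x \<noteq> 0) \<Longrightarrow> smooth_on S (\<lambda>x. inverse (F x))"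
  by (simp add: smooth_on_def C_k_on_inverse)

lemma smooth_on_ln:
  "thick S \<Longrightarrow> smooth_on S F \<Longrightarrow> (\<And>x. x \<in> S \<Longrightarrow> F x > 0) \<Longrightarrow> smooth_on S (\<lambda>x. ln (F x))"
  by (simp add: smooth_on_def C_k_on_ln)

end

lemma smooth_on_prod:
  fixes F :: "'i \<Rightarrow> 'a::euclidean_space \<Rightarrow> real"
  shows "thick S \<Longrightarrow> (\<And>i. smooth_on S (F i)) \<Longrightarrow> smooth_on S (\<lambda>x. \<Prod>i\<in>A. F i x)"
  by (induction A rule: infinite_finite_induct) (auto intro: smooth_on_const smooth_on_mult)

lemma smooth_on_precompose_snd: "thick (I \<times> V) \<Longrightarrow> smooth_on V F \<Longrightarrow> smooth_on (I \<times> V) (\<lambda>z. F (snd z))"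
  by (simp add: smooth_on_def C_k_on_precompose_snd)

lemma mvt_segment:
  fixes f :: "real \<Rightarrow> real"
  assumes "is_interval J" "a \<in> J" "b \<in> J" "a \<noteq> b"
    and f: "\<And>s. s \<in> J \<Longrightarrow> (f has_real_derivative f' s) (at s within J)"
  obtains \<xi> where "\<xi> \<in> J" "\<bar>\<xi> - a\<bar> \<le> \<bar>b - a\<bar>" "f b - f a = (b - a) * f' \<xi>"
proof -
  have *: "\<exists>\<xi>. \<xi> \<in> J \<and> a' < \<xi> \<and> \<xi> < b' \<and> f b' - f a' = (b' - a') * f' \<xi>"
    if ab: "a' \<in> J" "b' \<in> J" "a' < b'" for a' b'
  proof -
    have sub: "{a'..b'} \<subseteq> J"
      using mem_is_interval_1_I[OF assms(1) ab(1,2)] by auto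
    have "\<exists>x\<in>{a'<..<b'}. f b' - f a' = (\<lambda>h. f' x * h) (b' - a')"
    proof (rule mvt_simple[OF ab(3)])
      show "(f has_derivative (*) (f' x)) (at x within {a'..b'})" if "a' \<le> x" "x \<le> b'" for x
        using has_field_derivative_subset[OF f sub] sub that by (auto simp: has_field_derivative_def)
    qed
    then obtain x where x: "a' < x" "x < b'" "f b' - f a' = f' x * (b' - a')"
      by auto
    then show ?thesis using sub by (intro exI[of _ x]) (auto simp: mult.commute)
  qed
  show ?thesis
  proof (cases "a < b")
    case True
    then obtain \<xi> where "\<xi> \<in> J" "a < \<xi>" "\<xi> < b" "f b - f a = (b - a) * f' \<xi>"
      using *[OF assms(2,3) True] by blast
    then show ?thesis by (intro that[of \<xi>]) auto
  next
    case False
    then have "b < a" using assms(4) by simp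
    then obtain \<xi> where "\<xi> \<in> J" "b < \<xi>" "\<xi> < a" "f a - f b = (a - b) * f' \<xi>"
      using *[OF assms(3,2)] by blast
    then show ?thesis by (intro that[of \<xi>]) (auto simp: algebra_simps)
  qed
qed

lemma frechet_derivative_line:
  assumes "smooth_on S F" "z + s *\<^sub>R v \<in> S" "\<And>s'. s' \<in> J \<Longrightarrow> z + s' *\<^sub>R v \<in> S"
  shows "((\<lambda>s. F (z + s *\<^sub>R v)) has_vector_derivative frechet_derivative F (at (z + s *\<^sub>R v) within S) v) (at s within J)"
proof -
  have F: "(F has_derivative frechet_derivative F (at (z + s *\<^sub>R v) within S)) (at (z + s *\<^sub>R v) within S)"
    by (rule smooth_on_has_derivative) fact+
  have "((\<lambda>s. z + s *\<^sub>R v) has_derivative (\<lambda>h. h *\<^sub>R v)) (at s within J)"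
    by (auto intro!: derivative_eq_intros)
  then have "((\<lambda>s. F (z + s *\<^sub>R v)) has_derivative (\<lambda>h. frechet_derivative F (at (z + s *\<^sub>R v) within S) (h *\<^sub>R v))) (at s within J)"
    by (rule has_derivative_in_compose) (rule has_derivative_subset[OF F], use assms(3) in auto)
  then show ?thesis
    by (simp add: has_vector_derivative_def linear_frechet_derivative[OF _] linear_cmul
        bounded_linear.linear[OF has_derivative_bounded_linear[OF F]])
qed

text \<open>The point \<open>z\<close> may lie on the boundary of \<open>S\<close>, so the rectangle used for the double difference quotient
  is allowed to have \<open>z\<close> as a corner.\<close>

lemma frechet_derivative_commute:
  fixes F :: "'a::euclidean_space \<Rightarrow> real"
  assumes F: "smooth_on S F" and z: "z \<in> S"
    and J1: "is_interval J1" and J2: "is_interval J2"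
    and J1_0: "0 \<in> J1" and J2_0: "0 \<in> J2"
    and J1_approx: "\<And>e. e > 0 \<Longrightarrow> \<exists>d. 0 < \<bar>d\<bar> \<and> \<bar>d\<bar> < e \<and> d \<in> J1"
    and J2_approx: "\<And>e. e > 0 \<Longrightarrow> \<exists>d. 0 < \<bar>d\<bar> \<and> \<bar>d\<bar> < e \<and> d \<in> J2"
    and S: "\<And>s r. s \<in> J1 \<Longrightarrow> r \<in> J2 \<Longrightarrow> z + s *\<^sub>R v + r *\<^sub>R w \<in> S"
  shows "frechet_derivative (\<lambda>y. frechet_derivative F (at y within S) v) (at z within S) w
       = frechet_derivative (\<lambda>y. frechet_derivative F (at y within S) w) (at z within S) v"
proof -
  define D where "D F v = (\<lambda>y. frechet_derivative F (at y within S) v)" for v and F :: "'a \<Rightarrow> real"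
  have sm: "smooth_on S (D G v)" if "smooth_on S G" for G v
    unfolding D_def by (rule smooth_on_frechet[OF that])
  have d1: "((\<lambda>s. G (z + s *\<^sub>R v + r *\<^sub>R w)) has_real_derivative D G v (z + s *\<^sub>R v + r *\<^sub>R w)) (at s within J1)"
    if "smooth_on S G" "s \<in> J1" "r \<in> J2" for G s r
  proof -
    have e: "z + r *\<^sub>R w + s *\<^sub>R v = z + s *\<^sub>R v + r *\<^sub>R w" for s by simp
    show ?thesis
      using frechet_derivative_line[OF that(1), of "z + r *\<^sub>R w" s v J1] S that(2,3)
      unfolding e by (simp add: D_def has_real_derivative_iff_has_vector_derivative)
  qed
  have d2: "((\<lambda>r. G (z + s *\<^sub>R v + r *\<^sub>R w)) has_real_derivative D G w (z + s *\<^sub>R v + r *\<^sub>R w)) (at r within J2)"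
    if "smooth_on S G" "s \<in> J1" "r \<in> J2" for G s r
    using frechet_derivative_line[OF that(1), of "z + s *\<^sub>R v" r w J2] S that
    by (simp add: D_def has_real_derivative_iff_has_vector_derivative)
  have close: "\<bar>D (D F v) w z - D (D F w) v z\<bar> < e" if e: "e > 0" for e
  proof -
    have cont: "\<exists>d>0. \<forall>y\<in>S. norm (y - z) < d \<longrightarrow> \<bar>G y - G z\<bar> < e / 2" if "smooth_on S G" for G :: "'a \<Rightarrow> real"
    proof -
      have "\<forall>x\<in>S. \<forall>e>0. \<exists>d>0. \<forall>y\<in>S. norm (y - x) < d \<longrightarrow> \<bar>G y - G x\<bar> < e"
        using smooth_onD[OF that, of 0] by (simp add: continuous_on_iff dist_norm)
      from bspec[OF this z, THEN spec, of "e / 2"] e show ?thesis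
        by (simp only: half_gt_zero_iff simp_thms)
    qed
    obtain d1 where d1_pos: "d1 > 0"
        and c1: "\<And>y. y \<in> S \<Longrightarrow> norm (y - z) < d1 \<Longrightarrow> \<bar>D (D F v) w y - D (D F v) w z\<bar> < e / 2"
      using cont[OF sm[OF sm[OF F, of v], of w]] by auto
    obtain d2 where d2_pos: "d2 > 0"
        and c2: "\<And>y. y \<in> S \<Longrightarrow> norm (y - z) < d2 \<Longrightarrow> \<bar>D (D F w) v y - D (D F w) v z\<bar> < e / 2"
      using cont[OF sm[OF sm[OF F, of w], of v]] by auto
    \<comment> \<open>Steps shorter than m in both directions keep the rectangle within both radii
      of continuity; the summand 1 keeps the denominator positive.\<close>
    define m where "m = min d1 d2 / (norm v + norm w + 1)"
    have m: "m > 0" using d1_pos d2_pos by (simp add: m_def add_nonneg_pos)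
    obtain a where a: "0 < \<bar>a\<bar>" "\<bar>a\<bar> < m" "a \<in> J1" using J1_approx[OF m] by auto
    obtain b where b: "0 < \<bar>b\<bar>" "\<bar>b\<bar> < m" "b \<in> J2" using J2_approx[OF m] by auto
    have small: "norm (s *\<^sub>R v + r *\<^sub>R w) < min d1 d2" if "\<bar>s\<bar> \<le> \<bar>a\<bar>" "\<bar>r\<bar> \<le> \<bar>b\<bar>" for s r
    proof -
      have "norm (s *\<^sub>R v + r *\<^sub>R w) \<le> \<bar>s\<bar> * norm v + \<bar>r\<bar> * norm w"
        by (metis norm_triangle_ineq norm_scaleR)
      also have "\<dots> \<le> m * norm v + m * norm w"
        using that a b by (intro add_mono mult_right_mono) auto
      also have "\<dots> < m * (norm v + norm w + 1)"
        using m by (simp add: algebra_simps)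
      also have "\<dots> = min d1 d2"
        using add_nonneg_pos[of "norm v + norm w" 1] by (simp add: m_def)
      finally show ?thesis .
    qed
    have a0: "0 \<noteq> a" and b0: "0 \<noteq> b" using a b by auto
    have D1: "((\<lambda>s. F (z + s *\<^sub>R v + b *\<^sub>R w) - F (z + s *\<^sub>R v + 0 *\<^sub>R w)) has_real_derivative
        D F v (z + s *\<^sub>R v + b *\<^sub>R w) - D F v (z + s *\<^sub>R v + 0 *\<^sub>R w)) (at s within J1)" if "s \<in> J1" for s
      by (intro DERIV_diff d1 F b J2_0 that)
    have D2: "((\<lambda>r. F (z + a *\<^sub>R v + r *\<^sub>R w) - F (z + 0 *\<^sub>R v + r *\<^sub>R w)) has_real_derivative
        D F w (z + a *\<^sub>R v + r *\<^sub>R w) - D F w (z + 0 *\<^sub>R v + r *\<^sub>R w)) (at r within J2)" if "r \<in> J2" for r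
      by (intro DERIV_diff d2 F a J1_0 that)
    \<comment> \<open>The double difference of F over the rectangle is evaluated by two applications
      of the mean value theorem, in the order v, w and then, with \<open>r'\<close> and
      \<open>s'\<close>, in the order w, v. Dividing by the nonzero product a b compares the two
      mixed derivatives at nearby points.\<close>
    obtain s where s: "s \<in> J1" "\<bar>s - 0\<bar> \<le> \<bar>a - 0\<bar>"
      "(F (z + a *\<^sub>R v + b *\<^sub>R w) - F (z + a *\<^sub>R v + 0 *\<^sub>R w)) - (F (z + 0 *\<^sub>R v + b *\<^sub>R w) - F (z + 0 *\<^sub>R v + 0 *\<^sub>R w))
        = (a - 0) * (D F v (z + s *\<^sub>R v + b *\<^sub>R w) - D F v (z + s *\<^sub>R v + 0 *\<^sub>R w))"
      by (rule mvt_segment[OF J1 J1_0 a(3) a0 D1])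
    obtain r where r: "r \<in> J2" "\<bar>r - 0\<bar> \<le> \<bar>b - 0\<bar>"
      "D F v (z + s *\<^sub>R v + b *\<^sub>R w) - D F v (z + s *\<^sub>R v + 0 *\<^sub>R w) = (b - 0) * D (D F v) w (z + s *\<^sub>R v + r *\<^sub>R w)"
      by (rule mvt_segment[OF J2 J2_0 b(3) b0 d2[OF sm[OF F] s(1)]])
    obtain r' where r': "r' \<in> J2" "\<bar>r' - 0\<bar> \<le> \<bar>b - 0\<bar>"
      "(F (z + a *\<^sub>R v + b *\<^sub>R w) - F (z + 0 *\<^sub>R v + b *\<^sub>R w)) - (F (z + a *\<^sub>R v + 0 *\<^sub>R w) - F (z + 0 *\<^sub>R v + 0 *\<^sub>R w))
        = (b - 0) * (D F w (z + a *\<^sub>R v + r' *\<^sub>R w) - D F w (z + 0 *\<^sub>R v + r' *\<^sub>R w))"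
      by (rule mvt_segment[OF J2 J2_0 b(3) b0 D2])
    obtain s' where s': "s' \<in> J1" "\<bar>s' - 0\<bar> \<le> \<bar>a - 0\<bar>"
      "D F w (z + a *\<^sub>R v + r' *\<^sub>R w) - D F w (z + 0 *\<^sub>R v + r' *\<^sub>R w) = (a - 0) * D (D F w) v (z + s' *\<^sub>R v + r' *\<^sub>R w)"
      by (rule mvt_segment[OF J1 J1_0 a(3) a0 d1[OF sm[OF F] _ r'(1)]])
    have "a * b * D (D F v) w (z + s *\<^sub>R v + r *\<^sub>R w) = a * b * D (D F w) v (z + s' *\<^sub>R v + r' *\<^sub>R w)"
      using s(3) r(3) r'(3) s'(3) by (simp add: algebra_simps)
    then have "D (D F v) w (z + s *\<^sub>R v + r *\<^sub>R w) = D (D F w) v (z + s' *\<^sub>R v + r' *\<^sub>R w)"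
      using a(1) b(1) by simp
    moreover have "\<bar>D (D F v) w (z + s *\<^sub>R v + r *\<^sub>R w) - D (D F v) w z\<bar> < e / 2"
      using small[of s r] s r by (intro c1 S s r) (simp add: add.assoc)
    moreover have "\<bar>D (D F w) v (z + s' *\<^sub>R v + r' *\<^sub>R w) - D (D F w) v z\<bar> < e / 2"
      using small[of s' r'] s' r' by (intro c2 S s' r') (simp add: add.assoc)
    ultimately show ?thesis by linarith
  qed
  have "D (D F v) w z = D (D F w) v z"
    using close[of "\<bar>D (D F v) w z - D (D F w) v z\<bar>"] by auto
  then show ?thesis by (simp add: D_def)
qed

section \<open>Jets\<close>

text \<open>A jet records all iterated partial derivatives of a function at a point, indexed by words;
  multiplication is the Leibniz rule.\<close>

typedef 'd jet = "{a :: 'd list \<Rightarrow> real. \<forall>u i j w. a (u @ i # j # w) = a (u @ j # i # w)}"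
  morphisms coeff Jet
  by (rule exI[of _ "\<lambda>_. 0"]) simp

setup_lifting type_definition_jet

text \<open>Sums over all ways to distribute the letters of the word between the two factors.
  Coefficients are plain derivatives without factorials, so differentiation of jets is a shift of
  words and satisfies the product rule by the defining equation.\<close>

primrec leibniz :: "'d list \<Rightarrow> ('d list \<Rightarrow> real) \<Rightarrow> ('d list \<Rightarrow> real) \<Rightarrow> real" where
  "leibniz [] a b = a [] * b []"
| "leibniz (i # w) a b = leibniz w (\<lambda>u. a (i # u)) b + leibniz w a (\<lambda>u. b (i # u))"

lemma leibniz_commute: "leibniz w a b = leibniz w b a"
  by (induction w arbitrary: a b) simp_all

lemma leibniz_add: "leibniz w (\<lambda>u. a u + b u) c = leibniz w a c + leibniz w b c"
  by (induction w arbitrary: a b c) (simp_all add: algebra_simps)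

lemma leibniz_scale: "leibniz w (\<lambda>u. r * a u) c = r * leibniz w a c"
  by (induction w arbitrary: a c) (simp_all add: algebra_simps)

lemma leibniz_add_right: "leibniz w a (\<lambda>u. b u + c u) = leibniz w a b + leibniz w a c"
  by (metis leibniz_add leibniz_commute)

lemma leibniz_assoc: "leibniz w (\<lambda>u. leibniz u a b) c = leibniz w a (\<lambda>u. leibniz u b c)"
  by (induction w arbitrary: a b c) (simp_all add: leibniz_add leibniz_add_right)

lemma leibniz_zero: "leibniz w (\<lambda>_. 0) c = 0"
  by (induction w arbitrary: c) simp_all

lemma leibniz_one: "leibniz w (\<lambda>u. if u = [] then 1 else 0) c = c w"
  by (induction w arbitrary: c) (simp_all add: leibniz_zero)

lemma leibniz_swap:
  assumes "\<And>u w. a (u @ i # j # w) = a (u @ j # i # w)" "\<And>u w. b (u @ i # j # w) = b (u @ j # i # w)"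
  shows "leibniz (u @ i # j # w) a b = leibniz (u @ j # i # w) a b"
  using assms
proof (induction u arbitrary: a b)
  case Nil
  have "(\<lambda>u. a (i # j # u)) = (\<lambda>u. a (j # i # u))" "(\<lambda>u. b (i # j # u)) = (\<lambda>u. b (j # i # u))"
    using Nil(1,2)[of "[]"] by simp_all
  then show ?case by simp
next
  case (Cons k u)
  have "a (k # v @ i # j # w) = a (k # v @ j # i # w)" "b (k # v @ i # j # w) = b (k # v @ j # i # w)" for v w
    using Cons.prems[of "k # v"] by simp_all
  then show ?case
    using Cons.prems by (simp add: Cons.IH[of "\<lambda>u. a (k # u)" b] Cons.IH[of a "\<lambda>u. b (k # u)"])
qed

instantiation jet :: (type) "{comm_ring_1, real_algebra_1}"
begin

lift_definition zero_jet :: "'a jet" is "\<lambda>_. 0" by simp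
lift_definition one_jet :: "'a jet" is "\<lambda>w. if w = [] then 1 else 0" by simp
lift_definition plus_jet :: "'a jet \<Rightarrow> 'a jet \<Rightarrow> 'a jet" is "\<lambda>a b w. a w + b w" by auto
lift_definition uminus_jet :: "'a jet \<Rightarrow> 'a jet" is "\<lambda>a w. - a w" by auto
lift_definition minus_jet :: "'a jet \<Rightarrow> 'a jet \<Rightarrow> 'a jet" is "\<lambda>a b w. a w - b w" by auto
lift_definition times_jet :: "'a jet \<Rightarrow> 'a jet \<Rightarrow> 'a jet" is "\<lambda>a b w. leibniz w a b"
  by (rule leibniz_swap allI)+ auto
lift_definition scaleR_jet :: "real \<Rightarrow> 'a jet \<Rightarrow> 'a jet" is "\<lambda>r a w. r * a w" by auto

instance
proof
  fix a b c :: "'a jet" and r s :: real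
  show "a + b + c = a + (b + c)" "a + b = b + a" "0 + a = a" "- a + a = 0" "a - b = a + - b"
    by (transfer; simp add: fun_eq_iff)+
  show "a * b * c = a * (b * c)" by transfer (simp add: leibniz_assoc)
  have comm: "a * b = b * a" for a b :: "'a jet" by transfer (simp add: leibniz_commute)
  then show "a * b = b * a" .
  show "1 * a = a" by transfer (simp add: leibniz_one)
  show "(a + b) * c = a * c + b * c" by transfer (simp add: leibniz_add)
  show "a * (b + c) = a * b + a * c" by transfer (simp add: leibniz_add_right)
  show "a * 1 = a" by transfer (subst leibniz_commute, simp add: leibniz_one)
  show "(0 :: 'a jet) \<noteq> 1" by transfer (simp add: fun_eq_iff)
  show "r *\<^sub>R (a + b) = r *\<^sub>R a + r *\<^sub>R b" "(r + s) *\<^sub>R a = r *\<^sub>R a + s *\<^sub>R a"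
    "r *\<^sub>R s *\<^sub>R a = (r * s) *\<^sub>R a" "1 *\<^sub>R a = a"
    by (transfer; simp add: fun_eq_iff algebra_simps)+
  have scale: "r *\<^sub>R a * b = r *\<^sub>R (a * b)" for a b :: "'a jet"
    by transfer (simp add: leibniz_scale)
  then show "r *\<^sub>R a * b = r *\<^sub>R (a * b)" .
  show "a * r *\<^sub>R b = r *\<^sub>R (a * b)"
    using scale[of b a] by (simp only: comm[of a])
qed

end

lift_definition jet_deriv :: "'d \<Rightarrow> 'd jet \<Rightarrow> 'd jet" is "\<lambda>d a w. a (d # w)"
  by (metis append_Cons)

lift_definition jet_val :: "'d jet \<Rightarrow> real" is "\<lambda>a. a []" .

lemma jet_deriv_add: "jet_deriv d (a + b) = jet_deriv d a + jet_deriv d b"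
  by transfer simp

lemma jet_deriv_mult: "jet_deriv d (a * b) = jet_deriv d a * b + a * jet_deriv d b"
  by transfer simp

lemma jet_deriv_commute: "jet_deriv d (jet_deriv e a) = jet_deriv e (jet_deriv d a)"
proof (transfer, rule ext)
  fix d e :: 'd and a :: "'d list \<Rightarrow> real" and w
  assume "\<forall>u i j w. a (u @ i # j # w) = a (u @ j # i # w)"
  from this[rule_format, of "[]"] show "a (e # d # w) = a (d # e # w)" by simp
qed

lemma jet_val_simps [simp]:
  "jet_val 0 = 0" "jet_val 1 = 1" "jet_val (a + b) = jet_val a + jet_val b" "jet_val (- a) = - jet_val a"
  "jet_val (a - b) = jet_val a - jet_val b" "jet_val (a * b) = jet_val a * jet_val b"
  "jet_val (r *\<^sub>R a) = r * jet_val a"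
  by (transfer; simp)+

lemma jet_val_sum [simp]: "jet_val (sum f A) = (\<Sum>i\<in>A. jet_val (f i))"
  by (induction A rule: infinite_finite_induct) simp_all

lemma jet_val_of_nat: "jet_val (of_nat n) = of_nat n"
  by (induction n) simp_all

lemma jet_val_numeral [simp]: "jet_val (numeral n) = numeral n"
  using jet_val_of_nat[of "numeral n"] by simp

section \<open>Functions on space-time and their jets\<close>

locale cylinder =
  fixes I :: "real set" and V :: "(real ^ 'n::finite) set"
  assumes I: "nondegenerate_interval I" and V: "open V"
begin

abbreviation "\<Omega> \<equiv> I \<times> V"

lemma thick: "thick \<Omega>"
  by (rule thick_cylinder[OF I V])

definition dvec :: "'n option \<Rightarrow> real \<times> (real ^ 'n)" where
  "dvec d = (case d of None \<Rightarrow> (1, 0) | Some i \<Rightarrow> (0, axis i 1))"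

definition dir :: "'n option \<Rightarrow> (real \<times> (real ^ 'n) \<Rightarrow> real) \<Rightarrow> real \<times> (real ^ 'n) \<Rightarrow> real" where
  "dir d F z = frechet_derivative F (at z within \<Omega>) (dvec d)"

lemma dir_cong: "z \<in> \<Omega> \<Longrightarrow> (\<And>y. y \<in> \<Omega> \<Longrightarrow> F y = G y) \<Longrightarrow> dir d F z = dir d G z"
  unfolding dir_def by (simp add: frechet_derivative_within_cong[of z \<Omega> F G])

lemma smooth_dir: "smooth_on \<Omega> F \<Longrightarrow> smooth_on \<Omega> (dir d F)"
  unfolding dir_def[abs_def] by (rule smooth_on_frechet)

lemma dir_eq: "z \<in> \<Omega> \<Longrightarrow> (F has_derivative F') (at z within \<Omega>) \<Longrightarrow> dir d F z = F' (dvec d)"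
  unfolding dir_def by (simp add: frechet_derivative_within_eq[OF thick])

lemma dir_add:
  assumes "z \<in> \<Omega>" "smooth_on \<Omega> F" "smooth_on \<Omega> G"
  shows "dir d (\<lambda>y. F y + G y) z = dir d F z + dir d G z"
  using dir_eq[OF assms(1) has_derivative_add[OF smooth_on_has_derivative[OF assms(2,1)] smooth_on_has_derivative[OF assms(3,1)]]]
  by (simp add: dir_def)

lemma dir_mult:
  assumes "z \<in> \<Omega>" "smooth_on \<Omega> F" "smooth_on \<Omega> G"
  shows "dir d (\<lambda>y. F y * G y) z = dir d F z * G z + F z * dir d G z"
  using dir_eq[OF assms(1) has_derivative_mult[OF smooth_on_has_derivative[OF assms(2,1)] smooth_on_has_derivative[OF assms(3,1)]]]
  by (simp add: dir_def)

lemma dir_const: "z \<in> \<Omega> \<Longrightarrow> dir d (\<lambda>y. c) z = 0"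
  using dir_eq[OF _ has_derivative_const] by simp

lemma ball_subset:
  assumes "x \<in> V"
  obtains r where "r > 0" "\<And>y. norm y < r \<Longrightarrow> x + y \<in> V"
proof -
  obtain r where "r > 0" "ball x r \<subseteq> V" using V assms openE by blast
  then show thesis by (intro that[of r]) (auto simp: dist_norm)
qed

lemma dir_commute:
  assumes F: "smooth_on \<Omega> F" and z: "z \<in> \<Omega>"
  shows "dir d (dir e F) z = dir e (dir d F) z"
proof -
  obtain t x where tx: "z = (t, x)" "t \<in> I" "x \<in> V" using z by auto
  obtain r where r: "r > 0" "\<And>y. norm y < r \<Longrightarrow> x + y \<in> V" using ball_subset[OF tx(3)] by blast
  \<comment> \<open>The admissible steps: in time a translate of I, in space an interval of
    half-width r/2, so that two spatial steps together stay inside the ball of radius r.\<close>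
  define J where "J d = (case d of None \<Rightarrow> (\<lambda>s. s - t) ` I | Some (_::'n) \<Rightarrow> {- r / 2 <..< r / 2})" for d
  have int: "is_interval (J d)" for d
  proof (cases d)
    case None
    have "is_interval ((\<lambda>s. - t + s) ` I)"
      using I by (simp only: is_interval_translation nondegenerate_interval_def)
    then show ?thesis using None by (simp add: J_def)
  qed (simp add: J_def is_interval_oo)
  have zero: "0 \<in> J d" for d
    using r tx by (cases d) (auto simp: J_def)
  have approx: "\<exists>b. 0 < \<bar>b\<bar> \<and> \<bar>b\<bar> < \<epsilon> \<and> b \<in> J d" if "\<epsilon> > 0" for \<epsilon> d
  proof (cases d)
    case None
    obtain b where "0 < \<bar>b\<bar>" "\<bar>b\<bar> < \<epsilon>" "t + b \<in> I"
      using nondegenerate_interval_approx[OF I tx(2) \<open>\<epsilon> > 0\<close>] by blast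
    then show ?thesis using None by (intro exI[of _ b]) (auto simp: J_def image_iff intro!: bexI[of _ "t + b"])
  next
    case (Some i)
    then show ?thesis using r that by (intro exI[of _ "min (\<epsilon> / 2) (r / 4)"]) (auto simp: J_def)
  qed
  \<comment> \<open>Restricted to distinct directions, since two time steps from t could leave I;
    for equal directions there is nothing to commute.\<close>
  have in\<Omega>: "z + a *\<^sub>R dvec d + b *\<^sub>R dvec e \<in> \<Omega>" if "d \<noteq> e" "a \<in> J d" "b \<in> J e" for d e a b
  proof -
    have *: "x + (a' *\<^sub>R axis i 1 + b' *\<^sub>R axis j 1) \<in> V" if "\<bar>a'\<bar> < r / 2" "\<bar>b'\<bar> < r / 2" for a' b' i j
    proof (rule r(2))
      have "norm (a' *\<^sub>R axis i 1 + b' *\<^sub>R axis j 1 :: real ^ 'n) \<le> \<bar>a'\<bar> + \<bar>b'\<bar>"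
        using norm_triangle_ineq[of "a' *\<^sub>R axis i 1 :: real ^ 'n" "b' *\<^sub>R axis j 1"] by (simp add: norm_axis_1)
      then show "norm (a' *\<^sub>R axis i 1 + b' *\<^sub>R axis j 1 :: real ^ 'n) < r" using that by simp
    qed
    have **: "x + b' *\<^sub>R axis j 1 \<in> V" if "\<bar>b'\<bar> < r / 2" for b' j
      using *[of 0 b' j j] that r by simp
    show ?thesis
      using that tx * ** by (cases d; cases e) (auto simp: dvec_def J_def add.assoc abs_less_iff)
  qed
  show ?thesis
  proof (cases "d = e")
    case False
    have "frechet_derivative (\<lambda>y. frechet_derivative F (at y within \<Omega>) (dvec e)) (at z within \<Omega>) (dvec d)
        = frechet_derivative (\<lambda>y. frechet_derivative F (at y within \<Omega>) (dvec d)) (at z within \<Omega>) (dvec e)"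
      by (rule frechet_derivative_commute[OF F z int[of e] int[of d] zero zero approx approx])
         (use in\<Omega> False in auto)
    then show ?thesis by (simp add: dir_def[abs_def])
  qed simp
qed

text \<open>The head of the word is differentiated first, so that the jet of \<open>dir d F\<close>
  is the shifted jet of \<open>F\<close>.\<close>

primrec iter :: "'n option list \<Rightarrow> (real \<times> (real ^ 'n) \<Rightarrow> real) \<Rightarrow> real \<times> (real ^ 'n) \<Rightarrow> real" where
  "iter [] F = F"
| "iter (d # w) F = iter w (dir d F)"

lemma iter_cong: "z \<in> \<Omega> \<Longrightarrow> (\<And>y. y \<in> \<Omega> \<Longrightarrow> F y = G y) \<Longrightarrow> iter w F z = iter w G z"
proof (induction w arbitrary: F G)
  case (Cons d w)
  have "iter w (dir d F) z = iter w (dir d G) z"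
    by (rule Cons.IH[OF Cons.prems(1)]) (rule dir_cong, auto simp: Cons.prems(2))
  then show ?case by simp
qed simp

lemma iter_swap: "smooth_on \<Omega> F \<Longrightarrow> z \<in> \<Omega> \<Longrightarrow> iter (u @ i # j # w) F z = iter (u @ j # i # w) F z"
proof (induction u arbitrary: F)
  case Nil
  have "iter w (dir j (dir i F)) z = iter w (dir i (dir j F)) z"
    by (rule iter_cong[OF Nil(2)]) (rule dir_commute[OF Nil(1)])
  then show ?case by simp
next
  case (Cons k u)
  then show ?case using smooth_dir by simp
qed

definition jet :: "real \<times> (real ^ 'n) \<Rightarrow> (real \<times> (real ^ 'n) \<Rightarrow> real) \<Rightarrow> 'n option jet" where
  "jet z F = Jet (\<lambda>w. iter w F z)"

lemma coeff_jet: "smooth_on \<Omega> F \<Longrightarrow> z \<in> \<Omega> \<Longrightarrow> coeff (jet z F) = (\<lambda>w. iter w F z)"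
  unfolding jet_def by (rule Jet_inverse) (simp add: iter_swap)

lemma jet_cong: "z \<in> \<Omega> \<Longrightarrow> (\<And>y. y \<in> \<Omega> \<Longrightarrow> F y = G y) \<Longrightarrow> jet z F = jet z G"
  unfolding jet_def by (simp add: iter_cong[of z F G])

lemma jet_val_jet: "smooth_on \<Omega> F \<Longrightarrow> z \<in> \<Omega> \<Longrightarrow> jet_val (jet z F) = F z"
  by (simp add: jet_val.rep_eq coeff_jet)

lemma jet_dir: "smooth_on \<Omega> F \<Longrightarrow> z \<in> \<Omega> \<Longrightarrow> jet z (dir d F) = jet_deriv d (jet z F)"
  by (simp add: jet_deriv.rep_eq coeff_jet smooth_dir flip: coeff_inject)

lemma iter_add:
  "smooth_on \<Omega> F \<Longrightarrow> smooth_on \<Omega> G \<Longrightarrow> z \<in> \<Omega> \<Longrightarrow> iter w (\<lambda>y. F y + G y) z = iter w F z + iter w G z"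
proof (induction w arbitrary: F G)
  case (Cons d w)
  have "iter w (dir d (\<lambda>y. F y + G y)) z = iter w (\<lambda>y. dir d F y + dir d G y) z"
    by (rule iter_cong[OF Cons.prems(3)]) (rule dir_add[OF _ Cons.prems(1,2)])
  then show ?case using Cons smooth_dir by simp
qed simp

lemma jet_add: "smooth_on \<Omega> F \<Longrightarrow> smooth_on \<Omega> G \<Longrightarrow> z \<in> \<Omega> \<Longrightarrow> jet z (\<lambda>y. F y + G y) = jet z F + jet z G"
  by (simp add: plus_jet.rep_eq coeff_jet smooth_on_add[OF thick] iter_add flip: coeff_inject)

lemma iter_mult:
  "smooth_on \<Omega> F \<Longrightarrow> smooth_on \<Omega> G \<Longrightarrow> z \<in> \<Omega> \<Longrightarrow>
    iter w (\<lambda>y. F y * G y) z = leibniz w (\<lambda>u. iter u F z) (\<lambda>u. iter u G z)"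
proof (induction w arbitrary: F G)
  case (Cons d w)
  have s: "smooth_on \<Omega> (\<lambda>y. dir d F y * G y)" "smooth_on \<Omega> (\<lambda>y. F y * dir d G y)"
    using Cons.prems smooth_dir by (auto intro!: smooth_on_mult[OF thick])
  have "iter w (dir d (\<lambda>y. F y * G y)) z = iter w (\<lambda>y. dir d F y * G y + F y * dir d G y) z"
    by (rule iter_cong[OF Cons.prems(3)]) (rule dir_mult[OF _ Cons.prems(1,2)])
  then show ?case using Cons smooth_dir s by (simp add: iter_add)
qed simp

lemma jet_mult: "smooth_on \<Omega> F \<Longrightarrow> smooth_on \<Omega> G \<Longrightarrow> z \<in> \<Omega> \<Longrightarrow> jet z (\<lambda>y. F y * G y) = jet z F * jet z G"
  by (simp add: times_jet.rep_eq coeff_jet smooth_on_mult[OF thick] iter_mult flip: coeff_inject)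

lemma iter_zero: "z \<in> \<Omega> \<Longrightarrow> iter w (\<lambda>y. 0) z = 0"
proof (induction w)
  case (Cons d w)
  have "iter w (dir d (\<lambda>y. 0)) z = iter w (\<lambda>y. 0) z"
    by (rule iter_cong[OF Cons.prems]) (rule dir_const)
  then show ?case using Cons by simp
qed simp

lemma jet_const: "z \<in> \<Omega> \<Longrightarrow> jet z (\<lambda>y. c) = c *\<^sub>R 1"
proof -
  assume z: "z \<in> \<Omega>"
  have "iter w (\<lambda>y. c) z = c * (if w = [] then 1 else 0)" for w
  proof (cases w)
    case (Cons d v)
    have "iter v (dir d (\<lambda>y. c)) z = iter v (\<lambda>y. 0) z"
      by (rule iter_cong[OF z]) (rule dir_const)
    then show ?thesis using Cons by (simp add: iter_zero[OF z])
  qed simp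
  then show ?thesis
    by (simp add: scaleR_jet.rep_eq one_jet.rep_eq coeff_jet[OF smooth_on_const[OF thick] z] fun_eq_iff flip: coeff_inject)
qed

lemma vector_derivative_I:
  assumes "t \<in> I" "(F has_vector_derivative D) (at t within I)"
  shows "vector_derivative F (at t within I) = D"
proof -
  have "t islimpt I"
    unfolding islimpt_approachable
  proof (intro allI impI)
    fix e :: real
    assume "e > 0"
    then obtain d where "0 < \<bar>d\<bar>" "\<bar>d\<bar> < e" "t + d \<in> I"
      using nondegenerate_interval_approx[OF I assms(1)] by blast
    then show "\<exists>x'\<in>I. x' \<noteq> t \<and> dist x' t < e"
      by (intro bexI[of _ "t + d"]) (auto simp: dist_real_def)
  qed
  then show ?thesis
    using assms(2) by (intro vector_derivative_within) (simp_all add: trivial_limit_within)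
qed

lemma dir_None:
  assumes "smooth_on \<Omega> F" "t \<in> I" "x \<in> V"
  shows "dir None F (t, x) = vector_derivative (\<lambda>s. F (s, x)) (at t within I)"
proof -
  have F: "(F has_derivative frechet_derivative F (at (t, x) within \<Omega>)) (at (t, x) within \<Omega>)"
    using assms by (intro smooth_on_has_derivative) auto
  have "((\<lambda>s. (s, x)) has_derivative (\<lambda>h. (h, 0))) (at t within I)"
    by (auto intro!: derivative_eq_intros)
  then have "((\<lambda>s. F (s, x)) has_derivative (\<lambda>h. frechet_derivative F (at (t, x) within \<Omega>) (h, 0))) (at t within I)"
    by (rule has_derivative_in_compose) (rule has_derivative_subset[OF F], use assms in auto)
  moreover have "frechet_derivative F (at (t, x) within \<Omega>) (h, 0) = h *\<^sub>R dir None F (t, x)" for h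
    using linear_cmul[OF has_derivative_linear[OF F], of h "(1, 0)"] by (simp add: dir_def dvec_def)
  ultimately have "((\<lambda>s. F (s, x)) has_vector_derivative dir None F (t, x)) (at t within I)"
    by (simp add: has_vector_derivative_def)
  then show ?thesis
    by (rule vector_derivative_I[OF assms(2), symmetric])
qed

lemma dir_Some:
  assumes "smooth_on \<Omega> F" "t \<in> I" "x \<in> V"
  shows "dir (Some i) F (t, x) = pd i (\<lambda>y. F (t, y)) x"
proof -
  have F: "(F has_derivative frechet_derivative F (at (t, x) within \<Omega>)) (at (t, x) within \<Omega>)"
    using assms by (intro smooth_on_has_derivative) auto
  have "((\<lambda>y. (t, y)) has_derivative (\<lambda>h. (0, h))) (at x within V)"
    by (auto intro!: derivative_eq_intros)
  then have "((\<lambda>y. F (t, y)) has_derivative (\<lambda>h. frechet_derivative F (at (t, x) within \<Omega>) (0, h))) (at x within V)"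
    by (rule has_derivative_in_compose) (rule has_derivative_subset[OF F], use assms in auto)
  then have "((\<lambda>y. F (t, y)) has_derivative (\<lambda>h. frechet_derivative F (at (t, x) within \<Omega>) (0, h))) (at x)"
    by (simp only: at_within_open[OF assms(3) V])
  then have "frechet_derivative (\<lambda>y. F (t, y)) (at x) = (\<lambda>h. frechet_derivative F (at (t, x) within \<Omega>) (0, h))"
    by (rule frechet_derivative_at[symmetric])
  then show ?thesis
    by (simp add: pd_def dir_def dvec_def)
qed

end

section \<open>Translation between functions and jets at a point\<close>

locale jet_point = cylinder I V
  for I :: "real set" and V :: "(real ^ 'n::finite) set" +
  fixes t0 :: real and x0 :: "real ^ 'n"
  assumes t0: "t0 \<in> I" and x0: "x0 \<in> V"
begin

text \<open>Smoothness is included because the iterated derivatives of an arbitrary function need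
  not satisfy the symmetry required of a jet.\<close>

definition rep :: "(real \<Rightarrow> real ^ 'n \<Rightarrow> real) \<Rightarrow> 'n option jet \<Rightarrow> bool" where
  "rep F a \<longleftrightarrow> smooth_on \<Omega> (\<lambda>(t, x). F t x) \<and> jet (t0, x0) (\<lambda>(t, x). F t x) = a"

lemma z0: "(t0, x0) \<in> \<Omega>"
  using t0 x0 by simp

lemma rep_val: "rep F a \<Longrightarrow> F t0 x0 = jet_val a"
  using jet_val_jet[OF _ z0, of "\<lambda>(t, x). F t x"] by (auto simp: rep_def)

lemma rep_cong: "rep F a \<Longrightarrow> (\<And>t x. t \<in> I \<Longrightarrow> x \<in> V \<Longrightarrow> F t x = G t x) \<Longrightarrow> rep G a"
  using smooth_on_cong[of \<Omega> "\<lambda>(t, x). F t x" "\<lambda>(t, x). G t x"]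
    jet_cong[OF z0, of "\<lambda>(t, x). F t x" "\<lambda>(t, x). G t x"]
  by (auto simp: rep_def)

text \<open>The way in which an equation between functions on the cylinder becomes one between jets;
  agreement at the base point alone would not suffice, as jets see all derivatives.\<close>

lemma rep_eq: "rep F a \<Longrightarrow> rep G b \<Longrightarrow> (\<And>t x. t \<in> I \<Longrightarrow> x \<in> V \<Longrightarrow> F t x = G t x) \<Longrightarrow> a = b"
  using rep_cong[of F a G] by (auto simp: rep_def)

lemma rep_add: "rep F a \<Longrightarrow> rep G b \<Longrightarrow> rep (\<lambda>t x. F t x + G t x) (a + b)"
  using smooth_on_add[OF thick, of "\<lambda>(t, x). F t x" "\<lambda>(t, x). G t x"]
    jet_add[OF _ _ z0, of "\<lambda>(t, x). F t x" "\<lambda>(t, x). G t x"]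
  by (simp add: rep_def case_prod_unfold)

lemma rep_mult: "rep F a \<Longrightarrow> rep G b \<Longrightarrow> rep (\<lambda>t x. F t x * G t x) (a * b)"
  using smooth_on_mult[OF thick, of "\<lambda>(t, x). F t x" "\<lambda>(t, x). G t x"]
    jet_mult[OF _ _ z0, of "\<lambda>(t, x). F t x" "\<lambda>(t, x). G t x"]
  by (simp add: rep_def case_prod_unfold)

lemma rep_const: "rep (\<lambda>t x. c) (c *\<^sub>R 1)"
  using smooth_on_const[OF thick, of c] jet_const[OF z0, of c] by (simp add: rep_def case_prod_unfold)

lemma rep_0: "rep (\<lambda>t x. 0) 0" and rep_1: "rep (\<lambda>t x. 1) 1"
  using rep_const[of 0] rep_const[of 1] by simp_all

lemma rep_of_nat: "rep (\<lambda>t x. of_nat n) (of_nat n)"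
  using rep_const[of "of_nat n"] by (simp add: scaleR_conv_of_real)

lemma rep_numeral: "rep (\<lambda>t x. numeral n) (numeral n)"
  using rep_const[of "numeral n"] by (simp add: scaleR_conv_of_real)

lemma rep_minus: "rep F a \<Longrightarrow> rep (\<lambda>t x. - F t x) (- a)"
  using rep_mult[OF rep_const[of "-1"], of F a] by simp

lemma rep_diff: "rep F a \<Longrightarrow> rep G b \<Longrightarrow> rep (\<lambda>t x. F t x - G t x) (a - b)"
  using rep_add[OF _ rep_minus, of F a G b] by simp

lemma rep_sum: "(\<And>i. rep (\<lambda>t x. F i t x) (a i)) \<Longrightarrow> rep (\<lambda>t x. \<Sum>i\<in>A. F i t x) (\<Sum>i\<in>A. a i)"
  by (induction A rule: infinite_finite_induct) (auto intro: rep_0 rep_add)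

lemma rep_dir:
  assumes "rep F a"
  shows "rep (\<lambda>t x. dir d (\<lambda>(t, x). F t x) (t, x)) (jet_deriv d a)"
proof -
  have "(\<lambda>(t, x). dir d (\<lambda>(t, x). F t x) (t, x)) = dir d (\<lambda>(t, x). F t x)"
    by (rule ext) (simp add: case_prod_unfold)
  then show ?thesis
    using assms unfolding rep_def by (simp only: jet_dir[OF _ z0] smooth_dir)
qed

lemma rep_pd: "rep F a \<Longrightarrow> rep (\<lambda>t x. pd i (F t) x) (jet_deriv (Some i) a)"
proof (rule rep_cong[OF rep_dir])
  fix t x assume "rep F a" "t \<in> I" "x \<in> V"
  then show "dir (Some i) (\<lambda>(t, x). F t x) (t, x) = pd i (F t) x"
    by (subst dir_Some) (simp_all add: rep_def)
qed

lemma rep_dt: "rep F a \<Longrightarrow> rep (\<lambda>t x. vector_derivative (\<lambda>s. F s x) (at t within I)) (jet_deriv None a)"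
proof (rule rep_cong[OF rep_dir])
  fix t x assume "rep F a" "t \<in> I" "x \<in> V"
  then show "dir None (\<lambda>(t, x). F t x) (t, x) = vector_derivative (\<lambda>s. F s x) (at t within I)"
    by (subst dir_None) (simp_all add: rep_def)
qed

lemmas rep_intros = rep_add rep_mult rep_minus rep_diff rep_sum rep_pd rep_dt rep_numeral rep_0 rep_1

end

lemma smooth_on_det:
  fixes A :: "'a::euclidean_space \<Rightarrow> real ^ 'n ^ 'n"
  assumes "thick S" "\<And>i j. smooth_on S (\<lambda>x. A x $ i $ j)"
  shows "smooth_on S (\<lambda>x. det (A x))"
  unfolding det_def by (intro smooth_on_sum smooth_on_mult smooth_on_prod smooth_on_const assms)

lemma matrix_inv_posdef:
  fixes A :: "real ^ 'n ^ 'n"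
  assumes "\<And>v. v \<noteq> 0 \<Longrightarrow> v \<bullet> (A *v v) > 0"
  shows "matrix_inv A ** A = mat 1" "A ** matrix_inv A = mat 1" "det A \<noteq> 0"
proof -
  have "\<forall>x. A *v x = 0 \<longrightarrow> x = 0"
    using assms by (metis inner_zero_right less_irrefl)
  then obtain B where "B ** A = mat 1"
    using matrix_left_invertible_ker by blast
  then have "A ** B = mat 1 \<and> B ** A = mat 1"
    using matrix_left_right_inverse by blast
  then show "matrix_inv A ** A = mat 1" "A ** matrix_inv A = mat 1"
    unfolding matrix_inv_def by (metis (mono_tags, lifting) someI_ex)+
  show "det A \<noteq> 0"
    using \<open>A ** B = mat 1 \<and> B ** A = mat 1\<close> by (auto simp: invertible_det_nz[symmetric] invertible_def)
qed

text \<open>Cramer's rule writes the entries of the inverse as quotients of polynomials in the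
  entries of A, which gives smoothness of the inverse metric.\<close>

lemma matrix_inv_nth:
  fixes A :: "real ^ 'n ^ 'n"
  assumes "\<And>v. v \<noteq> 0 \<Longrightarrow> v \<bullet> (A *v v) > 0"
  shows "matrix_inv A $ i $ j = det (\<chi> a b. if b = i then axis j 1 $ a else A $ a $ b) * inverse (det A)"
proof -
  have "A *v (matrix_inv A *v axis j 1) = axis j 1"
    by (simp add: matrix_vector_mul_assoc matrix_inv_posdef[OF assms])
  then have "matrix_inv A *v axis j 1 = (\<chi> k. det (\<chi> a b. if b = k then axis j 1 $ a else A $ a $ b) / det A)"
    using cramer[OF matrix_inv_posdef(3)[OF assms]] by blast
  then have "(matrix_inv A *v axis j 1) $ i = det (\<chi> a b. if b = i then axis j 1 $ a else A $ a $ b) / det A"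
    by simp
  then show ?thesis
    by (simp add: matrix_vector_mult_basis column_def divide_inverse)
qed

context cylinder begin

lemma smooth_on_nth2: "smooth_on \<Omega> (\<lambda>(t, x). A t x) \<Longrightarrow> smooth_on \<Omega> (\<lambda>(t, x). A t x $ i $ j)"
  for A :: "real \<Rightarrow> real ^ 'n \<Rightarrow> real ^ 'm ^ 'l"
  using smooth_on_linear_comp[OF thick bounded_linear_compose[OF bounded_linear_vec_nth[of j] bounded_linear_vec_nth[of i]],
      of "\<lambda>(t, x). A t x"]
  by (simp add: case_prod_unfold)

end

context jet_point begin

definition J :: "(real \<Rightarrow> real ^ 'n \<Rightarrow> real) \<Rightarrow> 'n option jet" where
  "J F = jet (t0, x0) (\<lambda>(t, x). F t x)"

lemma rep_J: "smooth_on \<Omega> (\<lambda>(t, x). F t x) \<Longrightarrow> rep F (J F)"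
  by (simp add: rep_def J_def)

lemma rep_inverse:
  assumes "rep F a" "\<And>t x. t \<in> I \<Longrightarrow> x \<in> V \<Longrightarrow> F t x \<noteq> 0"
  shows "rep (\<lambda>t x. inverse (F t x)) (J (\<lambda>t x. inverse (F t x)))" "a * J (\<lambda>t x. inverse (F t x)) = 1"
proof -
  have "smooth_on \<Omega> (\<lambda>z. inverse ((\<lambda>(t, x). F t x) z))"
    using assms by (intro smooth_on_inverse[OF thick]) (auto simp: rep_def)
  then show *: "rep (\<lambda>t x. inverse (F t x)) (J (\<lambda>t x. inverse (F t x)))"
    by (intro rep_J) (simp add: case_prod_unfold)
  show "a * J (\<lambda>t x. inverse (F t x)) = 1"
    by (rule rep_eq[OF rep_mult[OF assms(1) *] rep_1]) (simp add: assms(2))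
qed

text \<open>The second relation is what the ring sees of the logarithm; it suffices for the
  derivatives of f.\<close>

lemma rep_ln:
  assumes "rep F a" and pos: "\<And>t x. t \<in> I \<Longrightarrow> x \<in> V \<Longrightarrow> F t x > 0"
  shows "rep (\<lambda>t x. ln (F t x)) (J (\<lambda>t x. ln (F t x)))"
    "a * jet_deriv d (J (\<lambda>t x. ln (F t x))) = jet_deriv d a"
proof -
  let ?F = "\<lambda>(t, x). F t x"
  have F: "smooth_on \<Omega> ?F" using assms by (simp add: rep_def)
  have "smooth_on \<Omega> (\<lambda>z. ln (?F z))"
    using pos by (intro smooth_on_ln[OF thick F]) auto
  then have ln: "smooth_on \<Omega> (\<lambda>(t, x). ln (F t x))"
    by (simp add: case_prod_unfold)
  then show *: "rep (\<lambda>t x. ln (F t x)) (J (\<lambda>t x. ln (F t x)))"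
    by (rule rep_J)
  have "dir d (\<lambda>(t, x). ln (F t x)) z = dir d ?F z / ?F z" if z: "z \<in> \<Omega>" for z
  proof -
    have "((\<lambda>z. ln (?F z)) has_derivative (\<lambda>h. frechet_derivative ?F (at z within \<Omega>) h / ?F z)) (at z within \<Omega>)"
      using has_derivative_ln[OF _ smooth_on_has_derivative[OF F z]] pos z by (auto simp: divide_inverse mult.commute)
    from dir_eq[OF z this] show ?thesis
      by (simp add: dir_def case_prod_unfold)
  qed
  then show "a * jet_deriv d (J (\<lambda>t x. ln (F t x))) = jet_deriv d a"
    by (intro rep_eq[OF rep_mult[OF assms(1) rep_dir[OF *]] rep_dir[OF assms(1)]])
       (use pos in \<open>force simp: less_imp_neq[symmetric]\<close>)
qed

lemma rep_time: "rep (\<lambda>t x. t) (J (\<lambda>t x. t))"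
  using smooth_on_linear[OF thick bounded_linear_fst] by (intro rep_J) (simp add: case_prod_unfold)

lemma rep_static: "smooth_on V F \<Longrightarrow> rep (\<lambda>t x. F x) (J (\<lambda>t x. F x))"
  using smooth_on_precompose_snd[OF thick] by (intro rep_J) (simp add: case_prod_unfold)

lemma jet_deriv_static: "rep (\<lambda>t x. F x) a \<Longrightarrow> jet_deriv None a = 0"
  by (rule rep_eq[OF rep_dt rep_0]) (auto intro!: vector_derivative_I derivative_eq_intros)

lemma jet_deriv_homogeneous: "rep (\<lambda>t x. F t) a \<Longrightarrow> jet_deriv (Some i) a = 0"
  by (rule rep_eq[OF rep_pd rep_0]) (auto simp: pd_def)

sublocale differential_ring "jet_deriv :: 'n option \<Rightarrow> 'n option jet \<Rightarrow> 'n option jet"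
  by unfold_locales (rule jet_deriv_add jet_deriv_mult jet_deriv_commute)+

end

section \<open>Jets of the flow\<close>

locale metric_point = jet_point I V t0 x0
  for I and V :: "(real ^ 'n::finite) set" and t0 x0 +
  fixes g :: "real \<Rightarrow> 'n mat_field"
  assumes g_smooth: "smooth_on \<Omega> (\<lambda>(t, x). g t x)"
    and g_sym: "\<And>t x. t \<in> I \<Longrightarrow> x \<in> V \<Longrightarrow> transpose (g t x) = g t x"
    and g_pos: "\<And>t x v. t \<in> I \<Longrightarrow> x \<in> V \<Longrightarrow> v \<noteq> 0 \<Longrightarrow> v \<bullet> (g t x *v v) > 0"
begin

definition gJ :: "'n option jet ^ 'n ^ 'n" where "gJ = (\<chi> i j. J (\<lambda>t x. g t x $ i $ j))"

definition KJ :: "'n option jet ^ 'n ^ 'n" where "KJ = (\<chi> i j. J (\<lambda>t x. ginv (g t) x i j))"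

definition \<Gamma>J :: "'n \<Rightarrow> 'n \<Rightarrow> 'n \<Rightarrow> 'n option jet" where
  "\<Gamma>J k i j = ((1 / 2) *\<^sub>R 1) * (\<Sum>l\<in>UNIV. KJ $ k $ l * (jet_deriv (Some i) (gJ $ j $ l)
     + jet_deriv (Some j) (gJ $ i $ l) - jet_deriv (Some l) (gJ $ i $ j)))"

lemma rep_g: "rep (\<lambda>t x. g t x $ i $ j) (gJ $ i $ j)"
  unfolding gJ_def using smooth_on_nth2[OF g_smooth] by (simp add: rep_J)

lemma rep_ginv: "rep (\<lambda>t x. ginv (g t) x i j) (KJ $ i $ j)"
proof -
  let ?g = "\<lambda>z. g (fst z) (snd z)"
  let ?M = "\<lambda>z. \<chi> a b. if b = i then axis j 1 $ a else ?g z $ a $ b"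
  have g: "smooth_on \<Omega> (\<lambda>z. ?g z $ a $ b)" for a b
    using smooth_on_nth2[OF g_smooth, of a b] by (simp add: case_prod_unfold)
  have "smooth_on \<Omega> (\<lambda>z. if b = i then axis j (1::real) $ a else ?g z $ a $ b)" for a b
    using g smooth_on_const[OF thick] by (cases "b = i") auto
  then have "smooth_on \<Omega> (\<lambda>z. det (?M z))"
    by (intro smooth_on_det[OF thick]) simp
  moreover have "smooth_on \<Omega> (\<lambda>z. inverse (det (?g z)))"
    using g matrix_inv_posdef(3)[OF g_pos] by (intro smooth_on_inverse[OF thick] smooth_on_det[OF thick]) auto
  ultimately have "smooth_on \<Omega> (\<lambda>z. det (?M z) * inverse (det (?g z)))"
    by (rule smooth_on_mult[OF thick])
  moreover have "ginv (g (fst z)) (snd z) i j = det (?M z) * inverse (det (?g z))" if "z \<in> \<Omega>" for z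
    unfolding ginv_def using that by (intro matrix_inv_nth g_pos) auto
  ultimately have "smooth_on \<Omega> (\<lambda>(t, x). ginv (g t) x i j)"
    using smooth_on_cong[of \<Omega> "\<lambda>(t, x). ginv (g t) x i j" "\<lambda>z. det (?M z) * inverse (det (?g z))"]
    by (auto simp: case_prod_unfold)
  then show ?thesis
    by (simp add: KJ_def rep_J)
qed

lemma rep_christoffel: "rep (\<lambda>t x. christoffel (g t) k i j x) (\<Gamma>J k i j)"
  unfolding christoffel_def \<Gamma>J_def by (intro rep_intros rep_const rep_g rep_ginv)

sublocale metric_ring jet_deriv gJ KJ \<Gamma>J
proof
  show "transpose gJ = gJ"
  proof -
    have "gJ $ j $ i = gJ $ i $ j" for i j
    proof (rule rep_eq[OF rep_g rep_g])
      fix t x assume "t \<in> I" "x \<in> V"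
      then have "transpose (g t x) $ i $ j = g t x $ i $ j" by (simp only: g_sym)
      then show "g t x $ j $ i = g t x $ i $ j" by (simp add: transpose_def)
    qed
    then show ?thesis by (simp add: vec_eq_iff transpose_def)
  qed
  have "(\<Sum>k\<in>UNIV. KJ $ i $ k * gJ $ k $ j) = (if i = j then 1 else 0)" for i j
  proof (rule rep_eq[OF rep_sum[OF rep_mult[OF rep_ginv rep_g]]])
    show "rep (\<lambda>t x. if i = j then 1 else 0) (if i = j then 1 else 0)"
      using rep_0 rep_1 by simp
    show "(\<Sum>k\<in>UNIV. ginv (g t) x i k * g t x $ k $ j) = (if i = j then 1 else 0)" if "t \<in> I" "x \<in> V" for t x
      using matrix_inv_posdef(1)[OF g_pos[OF that]] by (simp add: vec_eq_iff ginv_def matrix_matrix_mult_def mat_def)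
  qed
  then show "KJ ** gJ = mat 1"
    by (simp add: vec_eq_iff matrix_matrix_mult_def mat_def)
  have "(\<Sum>k\<in>UNIV. gJ $ i $ k * KJ $ k $ j) = (if i = j then 1 else 0)" for i j
  proof (rule rep_eq[OF rep_sum[OF rep_mult[OF rep_g rep_ginv]]])
    show "rep (\<lambda>t x. if i = j then 1 else 0) (if i = j then 1 else 0)"
      using rep_0 rep_1 by simp
    show "(\<Sum>k\<in>UNIV. g t x $ i $ k * ginv (g t) x k j) = (if i = j then 1 else 0)" if "t \<in> I" "x \<in> V" for t x
      using matrix_inv_posdef(2)[OF g_pos[OF that]] by (simp add: vec_eq_iff ginv_def matrix_matrix_mult_def mat_def)
  qed
  then show "gJ ** KJ = mat 1"
    by (simp add: vec_eq_iff matrix_matrix_mult_def mat_def)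
  show "2 * \<Gamma>J k i j = (\<Sum>l\<in>UNIV. KJ $ k $ l * (jet_deriv (Some i) (gJ $ j $ l)
     + jet_deriv (Some j) (gJ $ i $ l) - jet_deriv (Some l) (gJ $ i $ j)))" for k i j
  proof -
    have half: "2 * ((1 / 2) *\<^sub>R 1 * a) = a" for a :: "'n option jet"
      by (simp only: mult_scaleR_left mult_scaleR_right mult_1 mult_2 scaleR_half_double)
    show ?thesis
      unfolding \<Gamma>J_def half ..
  qed
qed

text \<open>The algebraic side is first brought to the literal shape of the coordinate definition,
  so that the rules for \<open>rep\<close> apply symbol by symbol. The translations that follow use
  the same pattern.\<close>

lemma rep_ricci: "rep (\<lambda>t x. ricci (g t) x $ i $ j) (Ric i j)"
  unfolding ricci_def riemann_def Ric_def Rm_nth vec_lambda_beta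
  by (intro rep_intros rep_christoffel)

lemma rep_scal: "rep (\<lambda>t x. scal (g t) x) scalar"
  unfolding scal_def trace_g_def scalar_eq by (intro rep_intros rep_ginv rep_ricci)

lemma rep_hess: "rep F a \<Longrightarrow> rep (\<lambda>t x. hess (g t) (F t) x $ i $ j) (hessian a i j)"
  unfolding hess_def hessian_def vec_lambda_beta by (intro rep_intros rep_christoffel)

lemma rep_laplacian: "rep F a \<Longrightarrow> rep (\<lambda>t x. laplacian (g t) (F t) x) (laplace a)"
  unfolding laplacian_def trace_g_def laplace_def lap_trace[symmetric] by (intro rep_intros rep_ginv rep_hess)

lemma rep_grad: "rep F a \<Longrightarrow> rep (\<lambda>t x. grad (g t) (F t) x $ i) (gradient a i)"
  unfolding grad_def gradient_def vec_lambda_beta by (intro rep_intros rep_ginv)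

lemma rep_inner_grad:
  "rep F a \<Longrightarrow> rep F' b \<Longrightarrow> rep (\<lambda>t x. inner_g (g t) x (grad (g t) (F t) x) (grad (g t) (F' t) x)) (grad_inner a b)"
  unfolding inner_g_def grad_inner_def inner_gradient[symmetric] by (intro rep_intros rep_g rep_grad)

end

locale three_form_point = metric_point I V t0 x0 g
  for I and V :: "(real ^ 'n::finite) set" and t0 x0 g +
  fixes H :: "real \<Rightarrow> 'n cube_field"
  assumes H_smooth: "\<And>i j k. smooth_on \<Omega> (\<lambda>(t, x). H t x $ i $ j $ k)"
    and H_antisym: "\<And>t x i j k. t \<in> I \<Longrightarrow> x \<in> V \<Longrightarrow> H t x $ i $ j $ k = - H t x $ j $ i $ k"
      "\<And>t x i j k. t \<in> I \<Longrightarrow> x \<in> V \<Longrightarrow> H t x $ i $ j $ k = - H t x $ i $ k $ j"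
    and H_closed: "\<And>t x. t \<in> I \<Longrightarrow> x \<in> V \<Longrightarrow> ext_deriv3 (H t) x = 0"
begin

definition HJ :: "'n \<Rightarrow> 'n \<Rightarrow> 'n \<Rightarrow> 'n option jet" where "HJ i j k = J (\<lambda>t x. H t x $ i $ j $ k)"

lemma rep_H: "rep (\<lambda>t x. H t x $ i $ j $ k) (HJ i j k)"
  unfolding HJ_def by (rule rep_J[OF H_smooth])

sublocale three_form_ring jet_deriv gJ KJ \<Gamma>J HJ
proof
  show "HJ i j k = - HJ j i k" for i j k
    by (rule rep_eq[OF rep_H rep_minus[OF rep_H]]) (rule H_antisym)
  show "HJ i j k = - HJ i k j" for i j k
    by (rule rep_eq[OF rep_H rep_minus[OF rep_H]]) (rule H_antisym)
  show "jet_deriv (Some i) (HJ j k l) - jet_deriv (Some j) (HJ i k l) + jet_deriv (Some k) (HJ i j l)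
      - jet_deriv (Some l) (HJ i j k) = 0" for i j k l
    by (rule rep_eq[OF _ rep_0, of "\<lambda>t x. ext_deriv3 (H t) x $ i $ j $ k $ l"])
       (unfold ext_deriv3_def vec_lambda_beta, intro rep_intros rep_H,
        use H_closed in \<open>simp add: ext_deriv3_def vec_eq_iff\<close>)
qed

lemma rep_H_sq: "rep (\<lambda>t x. H_sq (g t) (H t) x $ i $ j) (H2 i j)"
  unfolding H_sq_def H2_eq vec_lambda_beta by (intro rep_intros rep_H rep_ginv)

lemma rep_norm3_sq: "rep (\<lambda>t x. norm3_sq (g t) (H t) x) nH"
  unfolding norm3_sq_def nH_full by (intro rep_intros rep_H rep_ginv)

lemma rep_codiff3: "rep (\<lambda>t x. codiff3 (g t) (H t) x $ i $ j) (- Bl i j)"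
  unfolding codiff3_def cov_deriv3_def Bl_def cH_def vec_lambda_beta
  by (intro rep_intros rep_H rep_ginv rep_christoffel)

lemma rep_interior3_grad:
  "rep F a \<Longrightarrow> rep (\<lambda>t x. interior3 (grad (g t) (F t) x) (H t x) $ j $ k) (\<Sum>i\<in>UNIV. gradient a i * HJ i j k)"
  unfolding interior3_def vec_lambda_beta by (intro rep_intros rep_grad rep_H)

lemma rep_R_HF:
  "rep F a \<Longrightarrow> rep (\<lambda>t x. R_HF (g t) (H t) (F t) x) (scalar - ((1 / 12) *\<^sub>R 1) * nH + 2 * laplace a - grad_inner a a)"
  unfolding R_HF_def by (intro rep_intros rep_const rep_scal rep_norm3_sq rep_laplacian rep_inner_grad)

lemma R_HF_twelve:
  "12 * (scalar - ((1 / 12) *\<^sub>R 1) * nH + 2 * laplace a - grad_inner a a) = 12 * scalar - nH + 24 * laplace a - 12 * grad_inner a a"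
proof -
  have "12 * (((1 / 12) *\<^sub>R 1) * nH) = ((12 :: real) *\<^sub>R (1 / 12) *\<^sub>R nH)"
    by (simp only: mult_scaleR_left mult_1 scaleR_conv_of_real[of 12] of_real_numeral)
  then show ?thesis by (simp add: algebra_simps)
qed

lemma rep_conj_heat_op:
  assumes "rep P \<phi>" "rep F a"
  shows "rep (\<lambda>t x. 12 * conj_heat_op I g H P F t x)
    (12 * (2 * grad_inner \<phi> a - jet_deriv None a - laplace a) + (12 * scalar - nH + 24 * laplace \<phi> - 12 * grad_inner \<phi> \<phi>) * a)"
  by (rule rep_cong[of "\<lambda>t x. 12 * (2 * inner_g (g t) x (grad (g t) (P t) x) (grad (g t) (F t) x)
        - vector_derivative (\<lambda>s. F s x) (at t within I) - laplacian (g t) (F t) x) + 12 * R_HF (g t) (H t) (P t) x * F t x"])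
     (unfold R_HF_twelve[symmetric] conj_heat_op_def,
      intro rep_intros rep_inner_grad rep_laplacian rep_R_HF assms, simp add: algebra_simps)

end

text \<open>Smoothness, antisymmetry and closedness of H are consequences of H = H0 + db. They are
  derived in a locale of their own because \<open>three_form_point\<close> assumes them on the whole
  cylinder, so the pointwise results are needed at every point beforehand.\<close>

locale potential_point = jet_point I V t0 x0
  for I and V :: "(real ^ 'n::finite) set" and t0 x0 +
  fixes H0 :: "'n cube_field" and b :: "real \<Rightarrow> 'n mat_field" and H :: "real \<Rightarrow> 'n cube_field"
  assumes H0_smooth: "\<And>i j k. smooth_on V (\<lambda>x. H0 x $ i $ j $ k)"
    and H0_antisym: "\<And>x i j k. x \<in> V \<Longrightarrow> H0 x $ i $ j $ k = - H0 x $ j $ i $ k"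
      "\<And>x i j k. x \<in> V \<Longrightarrow> H0 x $ i $ j $ k = - H0 x $ i $ k $ j"
    and H0_closed: "\<And>x. x \<in> V \<Longrightarrow> ext_deriv3 H0 x = 0"
    and b_smooth: "smooth_on \<Omega> (\<lambda>(t, x). b t x)"
    and b_antisym: "\<And>t x i j. t \<in> I \<Longrightarrow> x \<in> V \<Longrightarrow> b t x $ i $ j = - b t x $ j $ i"
    and H_potential: "\<And>t x. t \<in> I \<Longrightarrow> x \<in> V \<Longrightarrow> H t x = H0 x + ext_deriv2 (b t) x"
begin

definition "bJ i j = J (\<lambda>t x. b t x $ i $ j)"

definition "H0J i j k = J (\<lambda>t x. H0 x $ i $ j $ k)"

definition "HbJ i j k = H0J i j k + (jet_deriv (Some i) (bJ j k) + jet_deriv (Some j) (bJ k i) + jet_deriv (Some k) (bJ i j))"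

lemma rep_b: "rep (\<lambda>t x. b t x $ i $ j) (bJ i j)"
  unfolding bJ_def using smooth_on_nth2[OF b_smooth] by (simp add: rep_J)

lemma rep_H0: "rep (\<lambda>t x. H0 x $ i $ j $ k) (H0J i j k)"
  unfolding H0J_def by (rule rep_static[OF H0_smooth])

lemma rep_potential: "rep (\<lambda>t x. H t x $ i $ j $ k) (HbJ i j k)"
  unfolding HbJ_def
  by (rule rep_cong[OF rep_add[OF rep_H0 rep_add[OF rep_add[OF rep_pd[OF rep_b] rep_pd[OF rep_b]] rep_pd[OF rep_b]]]])
     (simp add: H_potential ext_deriv2_def)

lemma potential_smooth: "smooth_on \<Omega> (\<lambda>(t, x). H t x $ i $ j $ k)"
  using rep_potential by (simp add: rep_def)

lemma bJ_antisym: "bJ i j = - bJ j i"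
  by (rule rep_eq[OF rep_b rep_minus[OF rep_b]]) (rule b_antisym)

lemma potential_antisym:
  "H t0 x0 $ i $ j $ k = - H t0 x0 $ j $ i $ k" "H t0 x0 $ i $ j $ k = - H t0 x0 $ i $ k $ j"
proof -
  have "H0J j i k = - H0J i j k" "H0J i k j = - H0J i j k"
    by (rule rep_eq[OF rep_H0 rep_minus[OF rep_H0]], rule H0_antisym, assumption)+
  moreover have "bJ k j = - bJ j k" "bJ i k = - bJ k i" "bJ j i = - bJ i j"
    by (rule bJ_antisym)+
  ultimately have "HbJ i j k = - HbJ j i k" "HbJ i j k = - HbJ i k j"
    by (simp_all add: HbJ_def)
  then show "H t0 x0 $ i $ j $ k = - H t0 x0 $ j $ i $ k" "H t0 x0 $ i $ j $ k = - H t0 x0 $ i $ k $ j"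
    using rep_val[OF rep_potential] by simp_all
qed

lemma potential_closed: "ext_deriv3 (H t0) x0 = 0"
proof -
  have H0: "jet_deriv (Some i) (H0J j k l) - jet_deriv (Some j) (H0J i k l) + jet_deriv (Some k) (H0J i j l)
      - jet_deriv (Some l) (H0J i j k) = 0" for i j k l
    by (rule rep_eq[OF _ rep_0, of "\<lambda>t x. ext_deriv3 H0 x $ i $ j $ k $ l"])
       (unfold ext_deriv3_def vec_lambda_beta, intro rep_intros rep_H0,
        use H0_closed in \<open>simp add: ext_deriv3_def vec_eq_iff\<close>)
  \<comment> \<open>The contribution of b is d(db), which vanishes since derivatives commute and b
    is antisymmetric.\<close>
  have "jet_deriv (Some i) (HbJ j k l) - jet_deriv (Some j) (HbJ i k l) + jet_deriv (Some k) (HbJ i j l)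
      - jet_deriv (Some l) (HbJ i j k) = 0" for i j k l
  proof -
    have "bJ j i = - bJ i j" "bJ k i = - bJ i k" "bJ l i = - bJ i l" "bJ k j = - bJ j k" "bJ l j = - bJ j l" "bJ l k = - bJ k l"
      by (rule bJ_antisym)+
    then have "jet_deriv (Some i) (HbJ j k l) - jet_deriv (Some j) (HbJ i k l) + jet_deriv (Some k) (HbJ i j l)
        - jet_deriv (Some l) (HbJ i j k)
      = jet_deriv (Some i) (H0J j k l) - jet_deriv (Some j) (H0J i k l) + jet_deriv (Some k) (H0J i j l)
        - jet_deriv (Some l) (H0J i j k)"
      by (simp add: HbJ_def D_commute[of "Some j" "Some i"] D_commute[of "Some k" "Some i"] D_commute[of "Some l" "Some i"]
          D_commute[of "Some k" "Some j"] D_commute[of "Some l" "Some j"] D_commute[of "Some l" "Some k"])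
    then show ?thesis by (simp only: H0)
  qed
  moreover have "rep (\<lambda>t x. ext_deriv3 (H t) x $ i $ j $ k $ l) (jet_deriv (Some i) (HbJ j k l) - jet_deriv (Some j) (HbJ i k l)
      + jet_deriv (Some k) (HbJ i j l) - jet_deriv (Some l) (HbJ i j k))" for i j k l
    unfolding ext_deriv3_def vec_lambda_beta by (intro rep_intros rep_potential)
  ultimately have "ext_deriv3 (H t0) x0 $ i $ j $ k $ l = 0" for i j k l
    using rep_val[of "\<lambda>t x. ext_deriv3 (H t) x $ i $ j $ k $ l"] by fastforce
  then show ?thesis by (simp add: vec_eq_iff)
qed

end

locale entropy_point = three_form_point I V t0 x0 g H + potential_point I V t0 x0 H0 b H
  for I and V :: "(real ^ 'n::finite) set" and t0 x0 g H H0 b +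
  fixes \<phi> f u \<psi> :: "real \<Rightarrow> real ^ 'n \<Rightarrow> real" and T :: real
  assumes g_flow: "\<And>t x. t \<in> I \<Longrightarrow> x \<in> V \<Longrightarrow>
        ((\<lambda>s. g s x) has_vector_derivative (-2) *\<^sub>R ricci (g t) x + (1/2) *\<^sub>R H_sq (g t) (H t) x) (at t within I)"
    and b_flow: "\<And>t x. t \<in> I \<Longrightarrow> x \<in> V \<Longrightarrow>
        ((\<lambda>s. b s x) has_vector_derivative - codiff3 (g t) (H t) x) (at t within I)"
    and \<phi>_smooth: "smooth_on \<Omega> (\<lambda>(t, x). \<phi> t x)"
    and \<phi>_flow: "\<And>t x. t \<in> I \<Longrightarrow> x \<in> V \<Longrightarrow> heat_op I g \<phi> t x = (1/6) * norm3_sq (g t) (H t) x"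
    and T_pos: "\<And>t. t \<in> I \<Longrightarrow> T - t > 0"
    and u_f: "\<And>t x. t \<in> I \<Longrightarrow> x \<in> V \<Longrightarrow> u t x = (4 * pi * (T - t)) powr (- real CARD('n) / 2) * exp (- f t x)"
    and u_smooth: "smooth_on \<Omega> (\<lambda>(t, x). u t x)"
    and u_conj: "\<And>t x. t \<in> I \<Longrightarrow> x \<in> V \<Longrightarrow> conj_heat_op I g H \<phi> u t x = 0"
    and \<psi>_smooth: "smooth_on \<Omega> (\<lambda>(t, x). \<psi> t x)"
    and \<psi>_conj: "\<And>t x. t \<in> I \<Longrightarrow> x \<in> V \<Longrightarrow>
        conj_heat_op I g H \<phi> (\<lambda>s y. \<psi> s y * u s y) t x = - (1/6) * norm3_sq (g t) (H t) x * u t x"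
begin

lemma u_pos: "t \<in> I \<Longrightarrow> x \<in> V \<Longrightarrow> u t x > 0"
  using T_pos[of t] by (simp add: u_f)

definition "nh = (real CARD('n) / 2) *\<^sub>R (1 :: 'n option jet)"
definition "\<phi>J = J \<phi>"
definition "uJ = J u"
definition "wJ = J (\<lambda>t x. inverse (u t x))"
definition "luJ = J (\<lambda>t x. ln (u t x))"
definition "\<tau>J = J (\<lambda>t x. T - t)"
definition "l\<tau>J = J (\<lambda>t x. ln (T - t))"
definition "fJ = - luJ - nh * (l\<tau>J + ln (4 * pi) *\<^sub>R 1)"
definition "cJ = nh * J (\<lambda>t x. inverse (T - t))"

lemma rep_\<phi>: "rep \<phi> \<phi>J"
  unfolding \<phi>J_def by (rule rep_J[OF \<phi>_smooth])

lemma rep_u: "rep u uJ"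
  unfolding uJ_def by (rule rep_J[OF u_smooth])

lemma uJ_wJ: "uJ * wJ = 1"
  unfolding wJ_def by (rule rep_inverse(2)[OF rep_u]) (use u_pos in force)

lemma rep_\<tau>: "rep (\<lambda>t x. T - t) \<tau>J"
  using rep_diff[OF rep_const[of T] rep_time] unfolding \<tau>J_def by (intro rep_J) (simp add: rep_def)

lemma \<tau>_inverse: "rep (\<lambda>t x. inverse (T - t)) (J (\<lambda>t x. inverse (T - t)))" "\<tau>J * J (\<lambda>t x. inverse (T - t)) = 1"
  by (rule rep_inverse[OF rep_\<tau>], use T_pos in force)+

lemma \<tau>_ln: "rep (\<lambda>t x. ln (T - t)) l\<tau>J" "\<tau>J * jet_deriv d l\<tau>J = jet_deriv d \<tau>J"
  unfolding l\<tau>J_def by (rule rep_ln[OF rep_\<tau> T_pos], assumption)+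

lemma u_ln: "rep (\<lambda>t x. ln (u t x)) luJ" "uJ * jet_deriv d luJ = jet_deriv d uJ"
  unfolding luJ_def by (rule rep_ln[OF rep_u u_pos], assumption+)+

text \<open>Smoothness is given for u, not for f. Solving the formula for u gives f = -ln u - (n/2)
  (ln(T - t) + ln 4\<pi>), and with it both the smoothness and the jet of f.\<close>

lemma rep_f: "rep f fJ"
  unfolding fJ_def nh_def
proof (rule rep_cong[OF rep_diff[OF rep_minus[OF u_ln(1)] rep_mult[OF rep_const rep_add[OF \<tau>_ln(1) rep_const]]]])
  fix t x assume tx: "t \<in> I" "x \<in> V"
  have "ln (u t x) = - real CARD('n) / 2 * ln (4 * pi * (T - t)) - f t x"
    using T_pos[OF tx(1)] by (simp add: u_f[OF tx] ln_mult ln_powr)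
  moreover have "ln (4 * pi * (T - t)) = ln (T - t) + ln (4 * pi)"
    using T_pos[OF tx(1)] by (simp add: ln_mult)
  ultimately show "- ln (u t x) - real CARD('n) / 2 * (ln (T - t) + ln (4 * pi)) = f t x"
    by simp
qed

lemma jet_deriv_const [simp]: "jet_deriv d (r *\<^sub>R (1 :: 'n option jet)) = 0"
proof (cases d)
  case None
  then show ?thesis using jet_deriv_static[OF rep_const] by simp
next
  case (Some i)
  then show ?thesis using jet_deriv_homogeneous[OF rep_const] by simp
qed

lemma jet_deriv_nh [simp]: "jet_deriv d nh = 0"
  by (simp add: nh_def)

lemma two_nh: "2 * nh = of_nat CARD('n)"
proof -
  have "of_nat CARD('n) = (of_real (2 * (real CARD('n) / 2)) :: 'n option jet)"
    by simp
  also have "\<dots> = 2 * nh"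
    by (simp only: nh_def of_real_mult of_real_numeral scaleR_conv_of_real mult_1_right)
  finally show ?thesis by simp
qed

lemma jet_deriv_\<tau>: "jet_deriv None \<tau>J = - 1" "jet_deriv (Some i) \<tau>J = 0"
proof -
  show "jet_deriv None \<tau>J = - 1"
    by (rule rep_eq[OF rep_dt[OF rep_\<tau>] rep_minus[OF rep_1]])
       (auto intro!: vector_derivative_I derivative_eq_intros)
  show "jet_deriv (Some i) \<tau>J = 0"
    by (rule jet_deriv_homogeneous[OF rep_\<tau>])
qed

lemma jet_deriv_l\<tau>: "jet_deriv None l\<tau>J = - J (\<lambda>t x. inverse (T - t))" "jet_deriv (Some i) l\<tau>J = 0"
proof -
  have *: "jet_deriv d l\<tau>J = J (\<lambda>t x. inverse (T - t)) * jet_deriv d \<tau>J" for d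
    unfolding \<tau>_ln(2)[symmetric] using \<tau>_inverse(2) by (simp add: mult.assoc[symmetric] mult.commute)
  show "jet_deriv None l\<tau>J = - J (\<lambda>t x. inverse (T - t))" "jet_deriv (Some i) l\<tau>J = 0"
    unfolding * jet_deriv_\<tau> by simp_all
qed

lemma jet_deriv_f: "jet_deriv (Some i) fJ = - jet_deriv (Some i) luJ" "jet_deriv None fJ = cJ - jet_deriv None luJ"
  by (simp_all add: fJ_def cJ_def jet_deriv_l\<tau>)

lemma component_flow:
  fixes A :: "real \<Rightarrow> real ^ 'n ^ 'n"
  assumes "t \<in> I" "((\<lambda>s. A s) has_vector_derivative B) (at t within I)"
  shows "vector_derivative (\<lambda>s. A s $ i $ j) (at t within I) = B $ i $ j"
  using bounded_linear.has_vector_derivative[OF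
      bounded_linear_compose[OF bounded_linear_vec_nth[of j] bounded_linear_vec_nth[of i]] assms(2)]
  by (rule vector_derivative_I[OF assms(1)])

sublocale conjugate_ring jet_deriv gJ KJ \<Gamma>J HJ fJ \<phi>J uJ wJ \<tau>J cJ
proof
  show "2 * jet_deriv None (gJ $ i $ j) = H2 i j - 4 * Ric i j" for i j
    by (rule rep_eq[OF rep_mult[OF rep_numeral rep_dt[OF rep_g]] rep_diff[OF rep_H_sq rep_mult[OF rep_numeral rep_ricci]]])
       (simp add: component_flow[OF _ g_flow])
  \<comment> \<open>Passing to the potential turns the evolution of b into that of H: H0 is static,
    and the time derivative commutes with the exterior derivative.\<close>
  have HJ: "HJ i j k = HbJ i j k" for i j k
    by (rule rep_eq[OF rep_H rep_potential]) simp
  have b: "jet_deriv None (bJ i j) = Bl i j" for i j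
    by (rule rep_eq[OF rep_dt[OF rep_b] rep_minus[OF rep_codiff3, simplified minus_minus]])
       (simp add: component_flow[OF _ b_flow])
  show "jet_deriv None (HJ i j k) = jet_deriv (Some i) (Bl j k) + jet_deriv (Some j) (Bl k i) + jet_deriv (Some k) (Bl i j)" for i j k
    by (simp add: HJ HbJ_def jet_deriv_static[OF rep_H0] D_commute[of None] b)
  show "jet_deriv (Some i) cJ = 0" for i
    using jet_deriv_homogeneous[OF \<tau>_inverse(1)] by (simp add: cJ_def)
  show "jet_deriv (Some i) \<tau>J = 0" for i by (rule jet_deriv_\<tau>)
  show "jet_deriv None \<tau>J = - 1" by (rule jet_deriv_\<tau>)
  show "2 * (\<tau>J * cJ) = of_nat CARD('n)"
  proof -
    have "\<tau>J * cJ = nh"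
      unfolding cJ_def using \<tau>_inverse(2) by (simp add: mult.left_commute)
    then show ?thesis
      by (simp only: two_nh)
  qed
  show "uJ * wJ = 1" by (rule uJ_wJ)
  show "jet_deriv (Some i) uJ = - (uJ * jet_deriv (Some i) fJ)" for i
    by (simp add: jet_deriv_f u_ln(2))
  show "jet_deriv None uJ = uJ * (cJ - jet_deriv None fJ)"
    by (simp add: jet_deriv_f u_ln(2))
  show "6 * jet_deriv None \<phi>J = 6 * laplace \<phi>J + nH"
    by (rule rep_eq[OF rep_mult[OF rep_numeral rep_dt[OF rep_\<phi>]]
          rep_add[OF rep_mult[OF rep_numeral rep_laplacian[OF rep_\<phi>]] rep_norm3_sq]])
       (use \<phi>_flow in \<open>simp add: heat_op_def field_simps\<close>)
  show "12 * (2 * grad_inner \<phi>J uJ - jet_deriv None uJ - laplace uJ) + (12 * scalar - nH + 24 * laplace \<phi>J - 12 * grad_inner \<phi>J \<phi>J) * uJ = 0"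
    by (rule rep_eq[OF rep_conj_heat_op[OF rep_\<phi> rep_u] rep_0]) (simp add: u_conj)
qed

lemma rep_op: "rep F a \<Longrightarrow> rep (\<lambda>t x. 12 * conj_heat_op I g H \<phi> F t x) (op a)"
  unfolding op_def by (rule rep_conj_heat_op[OF rep_\<phi>])

theorem conj_heat_op_entropy:
  defines "F \<equiv> \<lambda>s y. f s y + \<phi> s y"
  shows "conj_heat_op I g H \<phi> (\<lambda>s y. (W_HF (T - s) (g s) (H s) (F s) y + \<psi> s y) * u s y) t0 x0
    = - 2 * (T - t0) * norm2_sq (g t0) (\<lambda>y. Rc_HF (g t0) (H t0) (F t0) y - (1 / (2 * (T - t0))) *\<^sub>R g t0 y) x0 * u t0 x0"
proof -
  define \<tau> where "\<tau> = T - t0"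
  have \<tau>: "\<tau> > 0" "jet_val \<tau>J = \<tau>"
    using T_pos[OF t0] rep_val[OF rep_\<tau>] by (simp_all add: \<tau>_def)
  have F: "rep F (fJ + \<phi>J)"
    unfolding F_def by (rule rep_add[OF rep_f rep_\<phi>])
  let ?R = "scalar - ((1 / 12) *\<^sub>R 1) * nH + 2 * laplace (fJ + \<phi>J) - grad_inner (fJ + \<phi>J) (fJ + \<phi>J)"
  define WJ where "WJ = \<tau>J * ?R + (fJ + \<phi>J) - of_nat CARD('n)"
  define \<psi>J where "\<psi>J = J \<psi>"
  have W: "rep (\<lambda>s y. W_HF (T - s) (g s) (H s) (F s) y) WJ"
    unfolding W_HF_def WJ_def by (intro rep_intros rep_of_nat rep_\<tau> rep_R_HF F)
  have \<psi>: "rep \<psi> \<psi>J"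
    unfolding \<psi>J_def by (rule rep_J[OF \<psi>_smooth])
  have "12 * WJ = \<tau>J * (12 * ?R) + 12 * (fJ + \<phi>J) - 12 * of_nat CARD('n)"
    unfolding WJ_def by (simp only: distrib_left right_diff_distrib mult.left_commute)
  then have 1: "12 * WJ = \<tau>J * S + 12 * (fJ + \<phi>J) - 12 * of_nat CARD('n)"
    unfolding R_HF_twelve S_laplace .
  have 2: "op (\<psi>J * uJ) = - 2 * nH * uJ"
    by (rule rep_eq[OF rep_op[OF rep_mult[OF \<psi> rep_u]]
          rep_mult[OF rep_mult[OF rep_minus[OF rep_numeral] rep_norm3_sq] rep_u]])
       (simp add: \<psi>_conj)
  define A where "A y = Rc_HF (g t0) (H t0) (F t0) y - (1 / (2 * \<tau>)) *\<^sub>R g t0 y" for y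
  \<comment> \<open>The factor 4\<tau> clears the coefficients 1/4, 1/2 and 1/2\<tau> in the tensor
    A; it reappears squared, as 16\<tau>^2, in the norm.\<close>
  have "jet_val (\<tau>J * p i j + 2 * \<tau>J * q i j - 2 * gJ $ i $ j) = 4 * \<tau> * A x0 $ i $ j" for i j
  proof -
    have pv: "jet_val (p i j) = 4 * ricci (g t0) x0 $ i $ j - H_sq (g t0) (H t0) x0 $ i $ j + 4 * hess (g t0) (F t0) x0 $ i $ j"
      by (simp add: p_def rep_val[OF rep_ricci] rep_val[OF rep_H_sq] rep_val[OF rep_hess[OF F]])
    have qv: "jet_val (q i j) = - codiff3 (g t0) (H t0) x0 $ i $ j - interior3 (grad (g t0) (F t0) x0) (H t0 x0) $ i $ j"
      unfolding q_def \<iota>_def rep_val[OF rep_codiff3] rep_val[OF rep_interior3_grad[OF F]] by simp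
    have l: "jet_val (\<tau>J * p i j + 2 * \<tau>J * q i j - 2 * gJ $ i $ j)
        = \<tau> * jet_val (p i j) + 2 * \<tau> * jet_val (q i j) - 2 * g t0 x0 $ i $ j"
      by (simp add: \<tau>(2) rep_val[OF rep_g])
    show ?thesis
      unfolding l pv qv using \<tau>(1) by (simp add: A_def Rc_HF_def field_simps)
  qed
  then have 3: "jet_val (inner2 (\<lambda>i j. \<tau>J * p i j + 2 * \<tau>J * q i j - 2 * gJ $ i $ j) (\<lambda>i j. \<tau>J * p i j + 2 * \<tau>J * q i j - 2 * gJ $ i $ j))
      = 16 * \<tau>\<^sup>2 * norm2_sq (g t0) A x0"
    unfolding inner2_eq norm2_sq_def
    by (simp add: rep_val[OF rep_ginv] sum_distrib_left power2_eq_square ac_simps)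
  have "rep (\<lambda>t x. 12 * conj_heat_op I g H \<phi> (\<lambda>s y. (W_HF (T - s) (g s) (H s) (F s) y + \<psi> s y) * u s y) t x) (op ((WJ + \<psi>J) * uJ))"
    by (intro rep_op rep_mult rep_add W \<psi> rep_u)
  then have 4: "12 * conj_heat_op I g H \<phi> (\<lambda>s y. (W_HF (T - s) (g s) (H s) (F s) y + \<psi> s y) * u s y) t0 x0
      = jet_val (op ((WJ + \<psi>J) * uJ))"
    by (rule rep_val)
  have "2 * \<tau> * jet_val (op ((WJ + \<psi>J) * uJ)) = - 3 * (16 * \<tau>\<^sup>2 * norm2_sq (g t0) A x0) * u t0 x0"
    using arg_cong[OF op_entropy[OF 1 2], of jet_val] by (simp add: 3 \<tau>(2) rep_val[OF rep_u])
  then have "24 * \<tau> * (conj_heat_op I g H \<phi> (\<lambda>s y. (W_HF (T - s) (g s) (H s) (F s) y + \<psi> s y) * u s y) t0 x0)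
      = 24 * \<tau> * (- 2 * \<tau> * norm2_sq (g t0) A x0 * u t0 x0)"
    unfolding 4[symmetric] by (simp add: power2_eq_square)
  \<comment> \<open>The factor to divide out is 2\<tau> from \<open>op_entropy\<close> times 12 from
    \<open>op\<close>.\<close>
  moreover have "24 * \<tau> \<noteq> 0"
    using \<tau>(1) by simp
  ultimately have "conj_heat_op I g H \<phi> (\<lambda>s y. (W_HF (T - s) (g s) (H s) (F s) y + \<psi> s y) * u s y) t0 x0
      = - 2 * \<tau> * norm2_sq (g t0) A x0 * u t0 x0"
    by (simp only: mult_cancel_left simp_thms)
  then show ?thesis
    unfolding A_def \<tau>_def .
qed

end

theorem proposition1p6:
  fixes A :: "('m::{t2_space, second_countable_topology}, 'n::finite) chart set"
    and I :: "real set"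
    and T :: real
    and g :: "real \<Rightarrow> ('m, 'n) tensor2"
    and H :: "real \<Rightarrow> ('m, 'n) tensor3"
    and \<phi> f u \<psi> :: "real \<Rightarrow> 'm \<Rightarrow> real"
  assumes "smooth_atlas A"
    and "nondegenerate_interval I"
    and "generalized_Ricci_flow A I g H \<phi>"
    and "\<forall>t\<in>I. T - t > 0"
    and "\<forall>t\<in>I. \<forall>p. u t p = (4 * pi * (T - t)) powr (- real CARD('n) / 2) * exp (- f t p)"
    and "conj_heat_solution A I g H \<phi> u"
    and "conj_dilaton_flow A I g H \<phi> u \<psi>"
    and "c \<in> A" and "t \<in> I" and "x \<in> cimg c"
  shows "conj_heat_op I (\<lambda>s. g s c) (\<lambda>s. H s c) (\<lambda>s. coord c (\<phi> s))
           (\<lambda>s y. (W_HF (T - s) (g s c) (H s c) (coord c (\<lambda>p. f s p + \<phi> s p)) y + coord c (\<psi> s) y)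
                   * coord c (u s) y) t x
         = - 2 * (T - t)
             * norm2_sq (g t c)
                 (\<lambda>y. Rc_HF (g t c) (H t c) (coord c (\<lambda>p. f t p + \<phi> t p)) y
                       - (1 / (2 * (T - t))) *\<^sub>R g t c y) x
             * coord c (u t) x"
proof -
  let ?V = "cimg c"
  have V: "open ?V"
    using assms(1,8) by (auto simp: smooth_atlas_def is_chart_def)
  interpret cylinder I ?V
    by unfold_locales (rule assms(2), rule V)
  obtain H0 b where H0: "closed_three_form A H0" and b: "two_form_family A I b"
    and flow: "\<forall>t\<in>I. \<forall>c\<in>A. \<forall>x\<in>cimg c.
           H t c x = H0 c x + ext_deriv2 (b t c) x \<and>
           ((\<lambda>s. g s c x) has_vector_derivative
              (-2) *\<^sub>R ricci (g t c) x + (1/2) *\<^sub>R H_sq (g t c) (H t c) x) (at t within I) \<and>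
           ((\<lambda>s. b s c x) has_vector_derivative - codiff3 (g t c) (H t c) x) (at t within I)"
    using assms(3) unfolding generalized_Ricci_flow_def by blast
  have H0c: "smooth_on ?V (H0 c)"
    "\<And>x i j k. x \<in> ?V \<Longrightarrow> H0 c x $ i $ j $ k = - H0 c x $ j $ i $ k"
    "\<And>x i j k. x \<in> ?V \<Longrightarrow> H0 c x $ i $ j $ k = - H0 c x $ i $ k $ j"
    "\<And>x. x \<in> ?V \<Longrightarrow> ext_deriv3 (H0 c) x = 0"
    using H0 assms(8) unfolding closed_three_form_def three_form_def by blast+
  have bc: "smooth_on (I \<times> ?V) (\<lambda>(t, x). b t c x)"
    "\<And>t x i j. t \<in> I \<Longrightarrow> x \<in> ?V \<Longrightarrow> b t c x $ i $ j = - b t c x $ j $ i"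
    using b assms(8) unfolding two_form_family_def by blast+
  \<comment> \<open>Every point of the cylinder is covered, not only (t, x), in order to verify the
    global assumptions on H below.\<close>
  have pot: "potential_point I ?V s y (H0 c) (\<lambda>s. b s c) (\<lambda>s. H s c)" if "s \<in> I" "y \<in> ?V" for s y
  proof
    show "smooth_on ?V (\<lambda>x. H0 c x $ i $ j $ k)" for i j k
      by (rule smooth_on_linear_comp[OF thick_open[OF V] bounded_linear_compose[OF bounded_linear_vec_nth[of k]
            bounded_linear_compose[OF bounded_linear_vec_nth[of j] bounded_linear_vec_nth[of i]]] H0c(1)])
  qed (use that H0c(2-4) bc flow assms(8) in blast)+
  have gc: "smooth_on (I \<times> ?V) (\<lambda>(t, x). g t c x)"
    "\<And>t x. t \<in> I \<Longrightarrow> x \<in> ?V \<Longrightarrow> transpose (g t c x) = g t c x"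
    "\<And>t x v. t \<in> I \<Longrightarrow> x \<in> ?V \<Longrightarrow> v \<noteq> 0 \<Longrightarrow> v \<bullet> (g t c x *v v) > 0"
    using assms(3,8) unfolding generalized_Ricci_flow_def metric_family_def by blast+
  interpret potential_point I ?V t x "H0 c" "\<lambda>s. b s c" "\<lambda>s. H s c"
    using pot assms(9,10) .
  interpret entropy_point I ?V t x "\<lambda>s. g s c" "\<lambda>s. H s c" "H0 c" "\<lambda>s. b s c"
    "\<lambda>s. coord c (\<phi> s)" "\<lambda>s. coord c (f s)" "\<lambda>s. coord c (u s)" "\<lambda>s. coord c (\<psi> s)" T
  proof
    show "smooth_on (I \<times> ?V) (\<lambda>(t, x). H t c x $ i $ j $ k)" for i j k
      by (rule potential_smooth)
    show "H s c y $ i $ j $ k = - H s c y $ j $ i $ k" "H s c y $ i $ j $ k = - H s c y $ i $ k $ j"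
      "ext_deriv3 (H s c) y = 0" if "s \<in> I" "y \<in> ?V" for s y i j k
      by (rule potential_point.potential_antisym[OF pot[OF that]] potential_point.potential_closed[OF pot[OF that]])+
    show "smooth_on (I \<times> ?V) (\<lambda>(t, x). coord c (\<phi> t) x)"
      using assms(3,8) unfolding generalized_Ricci_flow_def smooth_scalar_family_def by blast
    show "smooth_on (I \<times> ?V) (\<lambda>(t, x). coord c (u t) x)"
      using assms(6,8) unfolding conj_heat_solution_def smooth_scalar_family_def by blast
    show "smooth_on (I \<times> ?V) (\<lambda>(t, x). coord c (\<psi> t) x)"
      using assms(7,8) unfolding conj_dilaton_flow_def smooth_scalar_family_def by blast
    show "heat_op I (\<lambda>s. g s c) (\<lambda>s. coord c (\<phi> s)) s y = 1 / 6 * norm3_sq (g s c) (H s c) y"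
      if "s \<in> I" "y \<in> ?V" for s y
      using assms(3,8) that unfolding generalized_Ricci_flow_def by blast
    show "conj_heat_op I (\<lambda>s. g s c) (\<lambda>s. H s c) (\<lambda>s. coord c (\<phi> s)) (\<lambda>s. coord c (u s)) s y = 0"
      if "s \<in> I" "y \<in> ?V" for s y
      using assms(6,8) that unfolding conj_heat_solution_def by blast
    show "conj_heat_op I (\<lambda>s. g s c) (\<lambda>s. H s c) (\<lambda>s. coord c (\<phi> s)) (\<lambda>s y. coord c (\<psi> s) y * coord c (u s) y) s y
        = - (1 / 6) * norm3_sq (g s c) (H s c) y * coord c (u s) y" if "s \<in> I" "y \<in> ?V" for s y
    proof -
      have "conj_heat_op I (\<lambda>s. g s c) (\<lambda>s. H s c) (\<lambda>s. coord c (\<phi> s)) (\<lambda>s. coord c (\<lambda>p. \<psi> s p * u s p)) s y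
        = - (1 / 6) * norm3_sq (g s c) (H s c) y * coord c (u s) y"
        using assms(7,8) that unfolding conj_dilaton_flow_def by blast
      then show ?thesis by (simp add: coord_def)
    qed
    show "coord c (u s) y = (4 * pi * (T - s)) powr (- real CARD('n) / 2) * exp (- coord c (f s) y)"
      if "s \<in> I" "y \<in> ?V" for s y
      using assms(5) that by (simp add: coord_def)
  qed (use gc flow assms(4,8) in blast)+
  show ?thesis
    using conj_heat_op_entropy by (simp add: coord_def)
qed

end
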